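(* Assume that either $$\operatorname{Im}(e^{ta_0}b_0)\subseteq\operatorname{Im}\sigma\ \ \forall t>0,\qquad b_1\in L^2([-d,0],\mathcal L(\mathbb R^m;\mathbb R^n)),\qquad\operatorname{Im}b_1(s)\subseteq\operatorname{Im}\sigma\ \text{ for a.e. }s\in[-d,0],$$ or $$\operatorname{Im}\left(e^{ta_0}b_0+\int_{-d}^01_{[-t,0]}(r)e^{(t+r)a_0}b_1(dr)\right)\subseteq\operatorname{Im}\sigma\qquad\forall t>0.$$ Then, for any bounded measurable $\bar\phi:\mathbb R^n\to\mathbb R$, setting $\phi(x)=\bar\phi(x_0)$ for $x=(x_0,x_1)\in\mathcal H$, the function $R_t[\phi]$ is $B$-Fréchet differentiable for every $t>0$ and, for every $x\in\mathcal H$, $k\in\mathbb R^m$, $$\langle\nabla^B(R_t[\phi])(x),k\rangle_{\mathbb R^m}=\int_{\mathbb R^n}\bar\phi\left(z_0+(e^{tA}x)_0\right)\left\langle(Q_t^0)^{-1/2}(e^{tA}Bk)_0,(Q_t^0)^{-1/2}z_0\right\rangle_{\mathbb R^n}\mathcal N(0,Q_t^0)(dz_0),$$ $$|\langle\nabla^B(R_t[\phi])(x),k\rangle_{\mathbb R^m}|\le\|\bar\phi\|_\infty\left\|(Q_t^0)^{-1/2}(e^{tA}B)_0\right\|_{\mathcal L(\mathbb R^m;\mathbb R^n)}|k|_{\mathbb R^m}.$$ Moreover for all $T>0$ there exists $C_T$ such that, for $t\in(0,T]$, $$|\langle\nabla^B(R_t[\phi])(x),k\rangle_{\mathbb R^m}|\le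 C_T\,t^{-1/2}\,\|\bar\phi\|_\infty\,|k|_{\mathbb R^m}.$$
   Context: Model: $a_0\in\mathcal L(\mathbb R^n;\mathbb R^n)$, $\sigma\in\mathcal L(\mathbb R^q;\mathbb R^n)$, $b_0\in\mathcal L(\mathbb R^m;\mathbb R^n)$, $d>0$, and $b_1$ is a matrix of finite signed Radon measures on $[-d,0]$ (an element of the dual of $C([-d,0],\mathcal L(\mathbb R^m;\mathbb R^n))$, so that $b_1(dr)k$ is an $\mathbb R^n$-valued measure for $k\in\mathbb R^m$); a density $b_1\in L^2([-d,0],\mathcal L(\mathbb R^m;\mathbb R^n))$ is identified with $b_1(r)dr$. $\mathcal H=\mathbb R^n\times L^2([-d,0],\mathbb R^n)$, with elements $x=(x_0,x_1)$; $(\cdot)_0$ is the first component. $A(y_0,y_1)=(a_0y_0+y_1(0),-y_1')$ with domain $\{(y_0,y_1)\in\mathcal H: y_1\in W^{1,2}([-d,0],\mathbb R^n),\,y_1(-d)=0\}$ generates the $C_0$-semigroup $$e^{tA}(y_0,y_1)=\Big(e^{ta_0}y_0+\int_{-d}^01_{[-t,0]}(s)e^{(t+s)a_0}y_1(s)ds,\;\; y_1(\cdot-t)1_{[-d+t,0]}(\cdot)\Big).$$ $G:\mathbb R^q\to\mathcal H$, $Gy=(\sigma y,0)$. $Bk=(b_0k,b_1k)$, a bounded operator $\mathbb R^m\to\mathcal H$ if $b_1\in L^2$, and in general $B:\mathbb R^m\to\mathbb R^n\times C^*([-d,0],\mathbb R^n)$. In all cases $$(e^{tA}B)_0k=(e^{tA}Bk)_0:=e^{ta_0}b_0k+\int_{-d}^01_{[-t,0]}(r)e^{(t+r)a_0}b_1(dr)k.$$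 $Q_t=\int_0^te^{sA}GG^*e^{sA^*}ds$ on $\mathcal H$, $Q_t^0=\int_0^te^{sa_0}\sigma\sigma^*e^{sa_0^*}ds$ on $\mathbb R^n$; $R_t[f](x)=\int_{\mathcal H}f(z+e^{tA}x)\,\mathcal N(0,Q_t)(dz)$ for bounded Borel $f$, with $\mathcal N(0,Q)$ the centered Gaussian measure with covariance $Q$. $(Q_t^0)^{-1/2}$ is the pseudoinverse of $(Q_t^0)^{1/2}$ (minimal norm preimage), defined on $\operatorname{Im}(Q_t^0)^{1/2}$. $B$-derivative: $\nabla^Bf(x)\in\mathbb R^m$ is defined by $\langle\nabla^Bf(x),k\rangle=\lim_{s\to0}\frac{f(x+sBk)-f(x)}{s}$; $f$ is $B$-Fréchet differentiable at $x$ if the limit exists for every $k\in\mathbb R^m$, is linear and bounded in $k$, and is uniform for $k$ in the unit ball. If $b_1$ is a measure and $Bk\notin\mathcal H$, this is used for functions of the form $f(x)=g((e^{tA}x)_0)$, with $f(x+sBk)$ understood as $g((e^{tA}x)_0+s(e^{tA}Bk)_0)$. The constant $C_T$ does not depend on $t$, $x$, $k$, $\bar\phi$. *)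

theory Defs
  imports "HOL-Probability.Probability"
begin

section \<open>The Hilbert space\<close>

definition square_integrable :: "(real \<Rightarrow> 'a::euclidean_space) \<Rightarrow> bool" where
  "square_integrable f \<longleftrightarrow>
     f \<in> borel_measurable borel \<and> integrable lborel (\<lambda>x. (norm (f x))\<^sup>2)"

definition L2_eq :: "(real \<Rightarrow> 'a::euclidean_space) \<Rightarrow> (real \<Rightarrow> 'a) \<Rightarrow> bool" where
  "L2_eq f g \<longleftrightarrow> square_integrable f \<and> square_integrable g \<and> (AE x in lborel. f x = g x)"

lemma square_integrable_0: "square_integrable (\<lambda>x. 0)"
  by (simp add: square_integrable_def)

lemma square_integrable_scaleR:
  "square_integrable f \<Longrightarrow> square_integrable (\<lambda>x. c *\<^sub>R f x)"
  by (auto simp: square_integrable_def power_mult_distrib)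

lemma square_integrable_uminus:
  "square_integrable f \<Longrightarrow> square_integrable (\<lambda>x. - f x)"
  by (auto simp: square_integrable_def)

lemma square_integrable_add:
  fixes f g :: "real \<Rightarrow> 'a::euclidean_space"
  assumes "square_integrable f" "square_integrable g"
  shows "square_integrable (\<lambda>x. f x + g x)"
proof -
  have [measurable]: "f \<in> borel_measurable borel" "g \<in> borel_measurable borel"
    using assms by (auto simp: square_integrable_def)
  have "integrable lborel (\<lambda>x. (norm (f x + g x))\<^sup>2)"
  proof (rule Bochner_Integration.integrable_bound)
    show "integrable lborel (\<lambda>x. 2 * (norm (f x))\<^sup>2 + 2 * (norm (g x))\<^sup>2)"
      using assms by (auto simp: square_integrable_def)
    have "(norm (a + b))\<^sup>2 \<le> 2 * (norm a)\<^sup>2 + 2 * (norm b)\<^sup>2" for a b :: 'a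
      using inner_ge_zero[of "a - b"]
      by (simp add: power2_norm_eq_inner inner_add inner_diff inner_commute del: inner_ge_zero)
    then show "AE x in lborel. norm ((norm (f x + g x))\<^sup>2)
        \<le> norm (2 * (norm (f x))\<^sup>2 + 2 * (norm (g x))\<^sup>2)"
      by (auto intro!: AE_I2)
  qed measurable
  then show ?thesis by (simp add: square_integrable_def)
qed

lemma square_integrable_diff:
  "square_integrable f \<Longrightarrow> square_integrable g \<Longrightarrow> square_integrable (\<lambda>x. f x - g x)"
  using square_integrable_add[OF _ square_integrable_uminus] by fastforce

lemma square_integrable_inner:
  fixes f g :: "real \<Rightarrow> 'a::euclidean_space"
  assumes "square_integrable f" "square_integrable g"
  shows "integrable lborel (\<lambda>x. f x \<bullet> g x)"
proof -
  have [measurable]: "f \<in> borel_measurable borel" "g \<in> borel_measurable borel"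
    using assms by (auto simp: square_integrable_def)
  show ?thesis
  proof (rule Bochner_Integration.integrable_bound)
    show "integrable lborel (\<lambda>x. (norm (f x))\<^sup>2 + (norm (g x))\<^sup>2)"
      using assms by (auto simp: square_integrable_def)
    have "\<bar>a \<bullet> b\<bar> \<le> (norm a)\<^sup>2 + (norm b)\<^sup>2" for a b :: 'a
      using Cauchy_Schwarz_ineq2[of a b] sum_squares_bound[of "norm a" "norm b"]
        mult_nonneg_nonneg[of "norm a" "norm b"] by simp
    then show "AE x in lborel. norm (f x \<bullet> g x) \<le> norm ((norm (f x))\<^sup>2 + (norm (g x))\<^sup>2)"
      by (auto intro!: AE_I2)
  qed measurable
qed

quotient_type (overloaded) 'a L2 = "real \<Rightarrow> 'a::euclidean_space" / partial: L2_eq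
proof (rule part_equivpI)
  show "\<exists>f :: real \<Rightarrow> 'a. L2_eq f f"
    by (rule exI[of _ "\<lambda>x. 0"]) (simp add: L2_eq_def square_integrable_0)
  show "symp (L2_eq :: (real \<Rightarrow> 'a) \<Rightarrow> _)"
    by (auto simp: symp_def L2_eq_def)
  show "transp (L2_eq :: (real \<Rightarrow> 'a) \<Rightarrow> _)"
    by (auto simp: transp_def L2_eq_def elim!: AE_mp)
qed

instantiation L2 :: (euclidean_space) real_inner
begin

lift_definition zero_L2 :: "'a L2" is "\<lambda>x. 0"
  by (simp add: L2_eq_def square_integrable_0)

lift_definition plus_L2 :: "'a L2 \<Rightarrow> 'a L2 \<Rightarrow> 'a L2" is "\<lambda>f g x. f x + g x"
  by (auto simp: L2_eq_def square_integrable_add elim: AE_mp)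

lift_definition minus_L2 :: "'a L2 \<Rightarrow> 'a L2 \<Rightarrow> 'a L2" is "\<lambda>f g x. f x - g x"
  by (auto simp: L2_eq_def square_integrable_diff elim: AE_mp)

lift_definition uminus_L2 :: "'a L2 \<Rightarrow> 'a L2" is "\<lambda>f x. - f x"
  by (auto simp: L2_eq_def square_integrable_uminus elim: AE_mp)

lift_definition scaleR_L2 :: "real \<Rightarrow> 'a L2 \<Rightarrow> 'a L2" is "\<lambda>c f x. c *\<^sub>R f x"
  by (auto simp: L2_eq_def square_integrable_scaleR elim: AE_mp)

lift_definition inner_L2 :: "'a L2 \<Rightarrow> 'a L2 \<Rightarrow> real" is "\<lambda>f g. LINT x|lborel. f x \<bullet> g x"
proof -
  fix f f' g g' :: "real \<Rightarrow> 'a"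
  assume *: "L2_eq f f'" "L2_eq g g'"
  then have [measurable]: "f \<in> borel_measurable borel" "f' \<in> borel_measurable borel"
      "g \<in> borel_measurable borel" "g' \<in> borel_measurable borel"
    by (auto simp: L2_eq_def square_integrable_def)
  have "AE x in lborel. f x = f' x" "AE x in lborel. g x = g' x"
    using * by (auto simp: L2_eq_def)
  then have "AE x in lborel. f x \<bullet> g x = f' x \<bullet> g' x"
    by eventually_elim simp
  then show "(LINT x|lborel. f x \<bullet> g x) = (LINT x|lborel. f' x \<bullet> g' x)"
    by (intro integral_cong_AE) measurable
qed

definition norm_L2 :: "'a L2 \<Rightarrow> real" where "norm_L2 x = sqrt (x \<bullet> x)"
definition sgn_L2 :: "'a L2 \<Rightarrow> 'a L2" where "sgn_L2 x = inverse (norm x) *\<^sub>R x"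
definition dist_L2 :: "'a L2 \<Rightarrow> 'a L2 \<Rightarrow> real" where "dist_L2 x y = norm (x - y)"
definition uniformity_L2 :: "('a L2 \<times> 'a L2) filter" where
  "uniformity_L2 = (INF e\<in>{0 <..}. principal {(x, y). dist x y < e})"
definition open_L2 :: "'a L2 set \<Rightarrow> bool" where
  "open_L2 U \<longleftrightarrow> (\<forall>x\<in>U. eventually (\<lambda>(x', y). x' = x \<longrightarrow> y \<in> U) uniformity)"

instance
proof
  fix x y z :: "'a L2" and a b :: real
  show "x + y + z = x + (y + z)"
    by transfer (auto simp: L2_eq_def add.assoc intro!: square_integrable_add)
  show "x + y = y + x"
    by transfer (auto simp: L2_eq_def add.commute intro!: square_integrable_add)
  show "0 + x = x"
    by transfer (auto simp: L2_eq_def)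
  show "- x + x = 0"
    by transfer (auto simp: L2_eq_def square_integrable_0)
  show "x - y = x + - y"
    by transfer (auto simp: L2_eq_def square_integrable_diff)
  show "a *\<^sub>R (x + y) = a *\<^sub>R x + a *\<^sub>R y"
    by transfer (auto simp: L2_eq_def scaleR_add_right intro!: square_integrable_add square_integrable_scaleR)
  show "(a + b) *\<^sub>R x = a *\<^sub>R x + b *\<^sub>R x"
    by transfer (auto simp: L2_eq_def scaleR_add_left intro!: square_integrable_add square_integrable_scaleR)
  show "a *\<^sub>R b *\<^sub>R x = (a * b) *\<^sub>R x"
    by transfer (auto simp: L2_eq_def intro!: square_integrable_scaleR)
  show "1 *\<^sub>R x = x"
    by transfer (auto simp: L2_eq_def)
  show "sgn x = inverse (norm x) *\<^sub>R x" by (rule sgn_L2_def)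
  show "dist x y = norm (x - y)" by (rule dist_L2_def)
  show "uniformity = (INF e\<in>{0 <..}. principal {(x :: 'a L2, y). dist x y < e})"
    by (rule uniformity_L2_def)
  show "open U \<longleftrightarrow> (\<forall>x\<in>U. eventually (\<lambda>(x', y). x' = x \<longrightarrow> y \<in> U) uniformity)"
    for U :: "'a L2 set" by (rule open_L2_def)
  show "x \<bullet> y = y \<bullet> x"
    by transfer (simp add: inner_commute)
  show "(x + y) \<bullet> z = x \<bullet> z + y \<bullet> z"
    by transfer (auto simp: L2_eq_def inner_add_left square_integrable_inner)
  show "(a *\<^sub>R x) \<bullet> y = a * (x \<bullet> y)"
    by transfer simp
  show "0 \<le> x \<bullet> x"
    by transfer (simp add: integral_nonneg_AE)
  show "x \<bullet> x = 0 \<longleftrightarrow> x = 0"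
  proof transfer
    fix f :: "real \<Rightarrow> 'a" assume "L2_eq f f"
    then have "square_integrable f" by (simp add: L2_eq_def)
    moreover have "(LINT x|lborel. f x \<bullet> f x) = 0 \<longleftrightarrow> (AE x in lborel. f x \<bullet> f x = 0)"
      using square_integrable_inner[OF \<open>square_integrable f\<close> \<open>square_integrable f\<close>]
      by (intro integral_nonneg_eq_0_iff_AE) auto
    ultimately show "(LINT x|lborel. f x \<bullet> f x) = 0 \<longleftrightarrow> L2_eq f (\<lambda>x. 0)"
      by (auto simp: L2_eq_def square_integrable_0)
  qed
  show "norm x = sqrt (x \<bullet> x)" by (rule norm_L2_def)
qed

end

text \<open>The type \<open>'a L2\<close> is \<open>L\<^sup>2(\<real>, 'a)\<close>.  Since \<open>d\<close> is a term and not a type,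
  \<open>L\<^sup>2([-d,0], 'a)\<close> is rendered as the closed subspace of the classes vanishing a.e. outside
  \<open>[-d,0]\<close> (extension by zero is an isometry), and \<open>\<H>\<close> as a closed subspace of
  \<open>'a \<times> 'a L2\<close> with the inherited inner product.\<close>

definition L2_on :: "real \<Rightarrow> 'a::euclidean_space L2 set" where
  "L2_on d = {h. AE s in lborel. s \<notin> {-d..0} \<longrightarrow> rep_L2 h s = 0}"

definition state_space :: "real \<Rightarrow> ('n::euclidean_space \<times> 'n L2) set" where
  "state_space d = UNIV \<times> L2_on d"


section \<open>The delay semigroup and the noise\<close>

text \<open>\<open>exp_op A\<close> is the operator \<open>e\<^sup>A\<close>; the library's \<open>exp\<close> is not available on operators.\<close>

definition exp_op :: "('n::euclidean_space \<Rightarrow> 'n) \<Rightarrow> 'n \<Rightarrow> 'n" where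
  "exp_op A x = (\<Sum>k. (1 / fact k) *\<^sub>R (A ^^ k) x)"

text \<open>\<open>e\<^sup>t\<^sup>A\<close> in closed form, where \<open>A (y\<^sub>0, y\<^sub>1) = (a\<^sub>0 y\<^sub>0 + y\<^sub>1(0), - y\<^sub>1')\<close> with \<open>y\<^sub>1 \<in> W\<^sup>1\<^sup>,\<^sup>2\<close> and
  \<open>y\<^sub>1(-d) = 0\<close> on the domain.\<close>

definition delay_semigroup ::
  "real \<Rightarrow> ('n::euclidean_space \<Rightarrow>\<^sub>L 'n) \<Rightarrow> real \<Rightarrow> 'n \<times> 'n L2 \<Rightarrow> 'n \<times> 'n L2" where
  "delay_semigroup d a0 t y =
     (exp_op (t *\<^sub>R a0) (fst y) +
        (LINT s:{-d..0}|lborel. indicator {-t..0} s *\<^sub>R exp_op ((t + s) *\<^sub>R a0) (rep_L2 (snd y) s)),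
      abs_L2 (\<lambda>r. indicator {-d+t..0} r *\<^sub>R rep_L2 (snd y) (r - t)))"

definition noise_op :: "('q::euclidean_space \<Rightarrow>\<^sub>L 'n::euclidean_space) \<Rightarrow> 'q \<Rightarrow> 'n \<times> 'n L2" where
  "noise_op \<sigma> y = (\<sigma> y, 0)"

text \<open>\<open>delay_semigroup d a0 s\<close> and \<open>noise_op \<sigma>\<close> take values in \<open>\<H>\<close>, and the former vanishes on the
  orthogonal complement of \<open>\<H>\<close> for \<open>s \<ge> 0\<close>; hence the ambient adjoints below restrict to the
  adjoints taken in \<open>\<H>\<close>.  The integrals over \<open>[0,t]\<close> are strong operator integrals.\<close>

definition covar :: "real \<Rightarrow> ('n::euclidean_space \<Rightarrow>\<^sub>L 'n) \<Rightarrow> ('q::euclidean_space \<Rightarrow>\<^sub>L 'n) \<Rightarrow> real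
    \<Rightarrow> 'n \<times> 'n L2 \<Rightarrow> 'n \<times> 'n L2" where
  "covar d a0 \<sigma> t x = integral {0..t} (\<lambda>s.
     delay_semigroup d a0 s (noise_op \<sigma> (adjoint (noise_op \<sigma>) (adjoint (delay_semigroup d a0 s) x))))"

definition covar0 :: "('n::euclidean_space \<Rightarrow>\<^sub>L 'n) \<Rightarrow> ('q::euclidean_space \<Rightarrow>\<^sub>L 'n) \<Rightarrow> real \<Rightarrow> 'n \<Rightarrow> 'n" where
  "covar0 a0 \<sigma> t x = integral {0..t} (\<lambda>s.
     exp_op (s *\<^sub>R a0) (\<sigma> (adjoint \<sigma> (exp_op (\<lambda>y. s *\<^sub>R adjoint a0 y) x))))"

text \<open>Centered Gaussian measures on a closed subspace \<open>S\<close> of an inner product space, characterised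
  by their Fourier transform; uniqueness holds for separable \<open>S\<close>, so the choice below is immaterial.\<close>

definition centered_gaussian :: "'h::real_inner set \<Rightarrow> ('h \<Rightarrow> 'h) \<Rightarrow> 'h measure \<Rightarrow> bool" where
  "centered_gaussian S C \<mu> \<longleftrightarrow>
     prob_space \<mu> \<and> space \<mu> = S \<and> sets \<mu> = sets (restrict_space borel S) \<and>
     (\<forall>h\<in>S. (CLINT z|\<mu>. iexp (h \<bullet> z)) = of_real (exp (- (C h \<bullet> h) / 2)))"

definition gaussian :: "'h::real_inner set \<Rightarrow> ('h \<Rightarrow> 'h) \<Rightarrow> 'h measure" where
  "gaussian S C = (SOME \<mu>. centered_gaussian S C \<mu>)"

text \<open>The Ornstein-Uhlenbeck transition semigroup \<open>R\<^sub>t\<close>\<close>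

definition OU :: "real \<Rightarrow> ('n::euclidean_space \<Rightarrow>\<^sub>L 'n) \<Rightarrow> ('q::euclidean_space \<Rightarrow>\<^sub>L 'n) \<Rightarrow> real
    \<Rightarrow> ('n \<times> 'n L2 \<Rightarrow> real) \<Rightarrow> 'n \<times> 'n L2 \<Rightarrow> real" where
  "OU d a0 \<sigma> t f x =
     (LINT z|gaussian (state_space d) (covar d a0 \<sigma> t). f (z + delay_semigroup d a0 t x))"

definition psd_sqrt :: "('n::euclidean_space \<Rightarrow> 'n) \<Rightarrow> 'n \<Rightarrow> 'n" where
  "psd_sqrt C = (THE R. linear R \<and> (\<forall>x y. R x \<bullet> y = x \<bullet> R y) \<and> (\<forall>x. 0 \<le> R x \<bullet> x) \<and> R \<circ> R = C)"

text \<open>Only meaningful for \<open>y \<in> range F\<close>.\<close>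

definition pseudoinverse :: "('a::euclidean_space \<Rightarrow> 'b::euclidean_space) \<Rightarrow> 'b \<Rightarrow> 'a" where
  "pseudoinverse F y = (THE x. F x = y \<and> (\<forall>x'. F x' = y \<longrightarrow> norm x \<le> norm x'))"


section \<open>The delayed control operator\<close>

text \<open>Finite signed (or vector valued) measures on the Borel subsets of a Borel set \<open>S\<close>; on the
  compact interval \<open>[-d,0]\<close> the Radon property is automatic.  With values in
  \<open>'m \<Rightarrow>\<^sub>L 'n\<close> these are exactly the matrices of finite signed measures.\<close>

definition vector_measure :: "real set \<Rightarrow> (real set \<Rightarrow> 'a::real_normed_vector) \<Rightarrow> bool" where
  "vector_measure S \<nu> \<longleftrightarrow> \<nu> {} = 0 \<and>
     (\<forall>A :: nat \<Rightarrow> real set. (\<forall>i. A i \<in> sets borel \<and> A i \<subseteq> S) \<longrightarrow> disjoint_family A \<longrightarrow>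
        (\<lambda>i. \<nu> (A i)) sums \<nu> (\<Union>i. A i))"

text \<open>Jordan decomposition: \<open>pos_variation S \<nu>\<close> is \<open>\<nu>\<^sup>+\<close> and \<open>pos_variation S (- \<nu>)\<close> is \<open>\<nu>\<^sup>-\<close>.\<close>

definition pos_variation :: "real set \<Rightarrow> (real set \<Rightarrow> real) \<Rightarrow> real measure" where
  "pos_variation S \<nu> = measure_of S (sets (restrict_space borel S))
     (\<lambda>E. SUP F\<in>{F \<in> sets borel. F \<subseteq> E}. ennreal (\<nu> F))"

definition signed_integral ::
  "real set \<Rightarrow> (real set \<Rightarrow> real) \<Rightarrow> (real \<Rightarrow> 'a::euclidean_space) \<Rightarrow> 'a" where
  "signed_integral S \<nu> f =
     (LINT r|pos_variation S \<nu>. f r) - (LINT r|pos_variation S (\<lambda>E. - \<nu> E). f r)"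

text \<open>\<open>matrix_integral S b M\<close> is \<open>k \<mapsto> \<integral>\<^sub>S M(r) b(dr) k\<close>, computed from the matrix entries
  \<open>\<lambda>E. b E j \<bullet> i\<close> of \<open>b\<close>.\<close>

definition matrix_integral ::
  "real set \<Rightarrow> (real set \<Rightarrow> 'm::euclidean_space \<Rightarrow>\<^sub>L 'n::euclidean_space) \<Rightarrow> (real \<Rightarrow> 'n \<Rightarrow> 'n) \<Rightarrow> 'm \<Rightarrow> 'n" where
  "matrix_integral S b M k =
     (\<Sum>j\<in>Basis. (k \<bullet> j) *\<^sub>R (\<Sum>i\<in>Basis. signed_integral S (\<lambda>E. b E j \<bullet> i) (\<lambda>r. M r i)))"

definition etAB0 :: "real \<Rightarrow> ('n::euclidean_space \<Rightarrow>\<^sub>L 'n) \<Rightarrow> ('m::euclidean_space \<Rightarrow>\<^sub>L 'n)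
    \<Rightarrow> (real set \<Rightarrow> 'm \<Rightarrow>\<^sub>L 'n) \<Rightarrow> real \<Rightarrow> 'm \<Rightarrow> 'n" where
  "etAB0 d a0 b0 b1 t k = exp_op (t *\<^sub>R a0) (b0 k) +
     matrix_integral {-d..0} b1 (\<lambda>r y. indicator {-t..0} r *\<^sub>R exp_op ((t + r) *\<^sub>R a0) y) k"

definition has_L2_operator_density :: "real \<Rightarrow> (real set \<Rightarrow> 'm::euclidean_space \<Rightarrow>\<^sub>L 'n::euclidean_space)
    \<Rightarrow> (real \<Rightarrow> 'm \<Rightarrow>\<^sub>L 'n) \<Rightarrow> bool" where
  "has_L2_operator_density d b1 \<beta> \<longleftrightarrow>
     \<beta> \<in> borel_measurable borel \<and> set_integrable lborel {-d..0} (\<lambda>s. (norm (\<beta> s))\<^sup>2) \<and>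
     (\<forall>E\<in>sets borel. E \<subseteq> {-d..0} \<longrightarrow> (\<forall>k. b1 E k = (LINT s:E|lborel. \<beta> s k)))"

text \<open>\<open>B k \<in> \<H>\<close> iff \<open>b1(dr) k\<close> has such a density, and then
  \<open>B k = (b0 k, h)\<close>.\<close>

definition has_L2_density :: "real \<Rightarrow> (real set \<Rightarrow> 'n::euclidean_space) \<Rightarrow> 'n L2 \<Rightarrow> bool" where
  "has_L2_density d \<nu> h \<longleftrightarrow> h \<in> L2_on d \<and>
     (\<forall>E\<in>sets borel. E \<subseteq> {-d..0} \<longrightarrow> \<nu> E = (LINT s:E|lborel. rep_L2 h s))"


section \<open>The B-derivative\<close>

text \<open>\<open>f (x + s B k)\<close>.  If \<open>B k \<notin> \<H>\<close>, then \<open>f\<close> has to be of the form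
  \<open>f y = g ((e\<^sup>t\<^sup>A y)\<^sub>0)\<close> on \<open>\<H>\<close>, and \<open>f (x + s B k)\<close> stands for
  \<open>g ((e\<^sup>t\<^sup>A x)\<^sub>0 + s (e\<^sup>t\<^sup>A B k)\<^sub>0)\<close>; \<open>g\<close> is unique because \<open>y \<mapsto> (e\<^sup>t\<^sup>A y)\<^sub>0\<close> maps \<open>\<H>\<close> onto
  \<open>'n\<close>.  The time \<open>t\<close> is used in this case only.\<close>

definition B_shift :: "real \<Rightarrow> ('n::euclidean_space \<Rightarrow>\<^sub>L 'n) \<Rightarrow> ('m::euclidean_space \<Rightarrow>\<^sub>L 'n)
    \<Rightarrow> (real set \<Rightarrow> 'm \<Rightarrow>\<^sub>L 'n) \<Rightarrow> real
    \<Rightarrow> ('n \<times> 'n L2 \<Rightarrow> real) \<Rightarrow> 'n \<times> 'n L2 \<Rightarrow> real \<Rightarrow> 'm \<Rightarrow> real" where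
  "B_shift d a0 b0 b1 t f x s k =
     (if \<exists>h. has_L2_density d (\<lambda>E. b1 E k) h
      then f (x + s *\<^sub>R (b0 k, THE h. has_L2_density d (\<lambda>E. b1 E k) h))
      else (THE g. \<forall>y\<in>state_space d. f y = g (fst (delay_semigroup d a0 t y)))
             (fst (delay_semigroup d a0 t x) + s *\<^sub>R etAB0 d a0 b0 b1 t k))"

definition B_Frechet_differentiable :: "real \<Rightarrow> ('n::euclidean_space \<Rightarrow>\<^sub>L 'n)
    \<Rightarrow> ('m::euclidean_space \<Rightarrow>\<^sub>L 'n) \<Rightarrow> (real set \<Rightarrow> 'm \<Rightarrow>\<^sub>L 'n) \<Rightarrow> real
    \<Rightarrow> ('n \<times> 'n L2 \<Rightarrow> real) \<Rightarrow> 'n \<times> 'n L2 \<Rightarrow> bool" where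
  "B_Frechet_differentiable d a0 b0 b1 t f x \<longleftrightarrow>
     (\<exists>L. bounded_linear L \<and>
        (\<forall>k. ((\<lambda>s. (B_shift d a0 b0 b1 t f x s k - f x) / s) \<longlongrightarrow> L k) (at 0)) \<and>
        uniform_limit (cball 0 1) (\<lambda>s k. (B_shift d a0 b0 b1 t f x s k - f x) / s) L (at 0))"

definition B_gradient :: "real \<Rightarrow> ('n::euclidean_space \<Rightarrow>\<^sub>L 'n)
    \<Rightarrow> ('m::euclidean_space \<Rightarrow>\<^sub>L 'n) \<Rightarrow> (real set \<Rightarrow> 'm \<Rightarrow>\<^sub>L 'n) \<Rightarrow> real
    \<Rightarrow> ('n \<times> 'n L2 \<Rightarrow> real) \<Rightarrow> 'n \<times> 'n L2 \<Rightarrow> 'm" where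
  "B_gradient d a0 b0 b1 t f x =
     (THE v. \<forall>k. ((\<lambda>s. (B_shift d a0 b0 b1 t f x s k - f x) / s) \<longlongrightarrow> v \<bullet> k) (at 0))"

end

theory Submission
  imports Defs "HOL-Computational_Algebra.Polynomial"
begin

text \<open>Since \<open>G\<close> takes values in \<open>\<real>\<^sup>n \<times> {0}\<close>, which the semigroup leaves invariant,
  \<open>R\<^sub>t[\<phi>](x) = g((e\<^sup>t\<^sup>A x)\<^sub>0)\<close> with \<open>g = \<phi> * N(0, Q\<^sub>t\<^sup>0)\<close> a function on \<open>\<real>\<^sup>n\<close>, and moving \<open>x\<close> along
  \<open>B k\<close> moves the argument of \<open>g\<close> along \<open>v = (e\<^sup>t\<^sup>A B k)\<^sub>0\<close>.  If \<open>v = (Q\<^sub>t\<^sup>0)\<^bsup>1/2\<^esup> w\<close>, the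
  Cameron-Martin formula turns the shift into the density \<open>exp (s \<langle>w, \<xi>\<rangle> - s\<^sup>2 |w|\<^sup>2 / 2)\<close>, which
  differs from \<open>1 + s \<langle>w, \<xi>\<rangle>\<close> by \<open>O(s\<^sup>2 |w|\<^sup>2)\<close> in \<open>L\<^sup>1\<close>.

  By duality, \<open>v\<close> lies in the image of \<open>(Q\<^sub>t\<^sup>0)\<^bsup>1/2\<^esup>\<close> with \<open>|w| \<le> c\<close> as soon as
  \<open>|\<langle>v, x\<rangle>| \<le> c |(Q\<^sub>t\<^sup>0)\<^bsup>1/2\<^esup> x|\<close> for all \<open>x\<close>, where the square of the norm on the right is the
  integral of \<open>|\<sigma>\<^sup>* e\<^bsup>s a\<^sub>0\<^sup>*\<^esup> x|\<^sup>2\<close> over \<open>[0,t]\<close>.  For \<open>v \<in> Im \<sigma>\<close> this holds with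
  \<open>c = O(t\<^bsup>-1/2\<^esup>)\<close>: there is a scalar \<open>q = O(1/t)\<close> on \<open>[0,t]\<close> with
  \<open>\<integral> q(s) e\<^bsup>s a\<^sub>0\<^esup> v ds = v\<close>.  For the distributed part in the \<open>L\<^sup>2\<close> case it holds with a constant
  \<open>c\<close> by the Cauchy-Schwarz inequality.\<close>

section \<open>Self-adjoint operators and pseudoinverses\<close>

text \<open>The rate rests on a steering problem: reach \<open>v = \<sigma> y\<close> from 0 in time
  t with energy O(1/t). The constant control y/t reaches only the average of e^(s a0) v, and the
  error, made of a0 v, a0^2 v and so on, need not lie in Im \<sigma>. These vectors span a space of
  finite dimension, so a scalar profile q along the fixed direction y can cancel them all; this is
  where an annihilating polynomial comes in. Since q depends on v, while v varies with t and k, it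
  is built for images of basis vectors only.

  A second obstacle is that \<open>psd_sqrt\<close>, \<open>pseudoinverse\<close>,
  \<open>adjoint\<close>, \<open>gaussian\<close> and the values in \<open>B_shift\<close> and
  \<open>B_gradient\<close> are given by choice operators, so each has to be identified before it
  can be used. The Gaussian measure on the state space enters only through its first marginal, a
  measure on R^n determined by its characteristic function. As the covariance may be singular,
  \<open>pseudoinverse\<close> is controlled on the range of the root; N(0, Q) lives there, being
  the image of the standard Gaussian under that root.\<close>

lemma borel_measurable_linear:
  fixes f :: "'a::euclidean_space \<Rightarrow> 'b::euclidean_space"
  assumes "linear f" shows "f \<in> borel_measurable borel"
  using assms by (intro borel_measurable_continuous_onI linear_continuous_on) (simp add: linear_conv_bounded_linear)

text \<open>A maximizer \<open>e\<close> of the Rayleigh quotient on the unit sphere of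
  \<open>S\<close> works. The gradient of the quotient at \<open>e\<close> is -2 \<open>w\<close>
  for \<open>w = M e - f e\<close>, so moving against \<open>w\<close> would raise it above the
  maximum \<open>M\<close> unless \<open>w\<close> vanishes.\<close>

lemma symmetric_max_eigenvector:
  fixes f :: "'n::euclidean_space \<Rightarrow> 'n"
  assumes f: "linear f" and sym: "\<And>x y. f x \<bullet> y = x \<bullet> f y"
    and S: "subspace S" "f ` S \<subseteq> S" "S \<noteq> {0}"
  obtains e l where "e \<in> S" "norm e = 1" "f e = l *\<^sub>R e"
proof -
  obtain u where u: "u \<in> S" "u \<noteq> 0" using S(1,3) subspace_0 by blast
  have "compact (sphere 0 1 \<inter> S)"
    using closed_subspace[OF S(1)] by (intro compact_Int_closed) auto
  moreover have "(1 / norm u) *\<^sub>R u \<in> sphere 0 1 \<inter> S"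
    using u S(1) by (auto simp: subspace_scale)
  moreover have "continuous_on (sphere 0 1 \<inter> S) (\<lambda>x. f x \<bullet> x)"
    by (intro continuous_intros linear_continuous_on linear_conv_bounded_linear[THEN iffD1] f)
  ultimately obtain e where e: "e \<in> sphere 0 1 \<inter> S"
    and max: "\<And>x. x \<in> sphere 0 1 \<inter> S \<Longrightarrow> f x \<bullet> x \<le> f e \<bullet> e"
    using continuous_attains_sup[of "sphere 0 1 \<inter> S" "\<lambda>x. f x \<bullet> x"] by blast
  define M where "M = f e \<bullet> e"
  have le: "f x \<bullet> x \<le> M * (x \<bullet> x)" if "x \<in> S" for x
  proof (cases "x = 0")
    case False
    have "f ((1 / norm x) *\<^sub>R x) \<bullet> ((1 / norm x) *\<^sub>R x) \<le> M"
      unfolding M_def using that False S(1) by (intro max) (auto simp: subspace_scale)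
    then show ?thesis using False
      by (simp add: linear_cmul[OF f] dot_square_norm field_simps power2_eq_square)
  qed (simp add: linear_0[OF f])
  define w where "w = M *\<^sub>R e - f e"
  have wS: "w \<in> S" using e S by (auto simp: w_def subspace_diff subspace_scale)
  have we: "w \<bullet> e = 0"
    using e by (simp add: w_def inner_diff_left M_def dot_square_norm)
  have fe: "f e \<bullet> w = - (w \<bullet> w)"
  proof -
    have "f e = M *\<^sub>R e - w" by (simp add: w_def)
    then show ?thesis using we by (simp add: inner_diff_left inner_commute[of e w])
  qed
  define c where "c = M * (w \<bullet> w) - f w \<bullet> w"
  have quad: "0 \<le> 2 * s * (w \<bullet> w) + s\<^sup>2 * c" for s
  proof -
    have "f (e + s *\<^sub>R w) \<bullet> (e + s *\<^sub>R w) \<le> M * ((e + s *\<^sub>R w) \<bullet> (e + s *\<^sub>R w))"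
      using e wS S(1) by (intro le) (auto simp: subspace_add subspace_scale)
    moreover have "f w \<bullet> e = f e \<bullet> w" using sym[of w e] by (simp add: inner_commute)
    ultimately show ?thesis using we fe e
      by (simp add: linear_add[OF f] linear_cmul[OF f] inner_add_left inner_add_right
          inner_commute[of e w] M_def[symmetric] c_def dot_square_norm[of e] power2_eq_square algebra_simps)
  qed
  have "w = 0"
  proof (rule ccontr)
    assume "w \<noteq> 0"
    then have p: "0 < w \<bullet> w" by simp
    have c: "0 \<le> c" using le[OF wS] by (simp add: c_def)
    \<comment> \<open>The quadratic is smallest at -|w|^2 / c; the added 1 covers c = 0 and still
      gives a negative value.\<close>
    define s where "s = - (w \<bullet> w) / (c + 1)"
    have "2 * s * (w \<bullet> w) + s\<^sup>2 * c = - (w \<bullet> w)\<^sup>2 * (c + 2) / (c + 1)\<^sup>2"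
      using c unfolding s_def by (simp add: divide_simps power2_eq_square) (simp add: algebra_simps)
    also have "\<dots> < 0" using p c by (simp add: divide_less_0_iff mult_pos_pos)
    finally show False using quad[of s] by simp
  qed
  then have "f e = M *\<^sub>R e" by (simp add: w_def)
  with e that[of e M] show ?thesis by auto
qed

text \<open>Symmetry makes the orthogonal complement of an eigenvector inside an invariant subspace
  invariant again, with smaller dimension. The form with a general invariant subspace is what this
  induction needs.\<close>

lemma symmetric_eigenbasis_subspace:
  fixes f :: "'n::euclidean_space \<Rightarrow> 'n"
  assumes f: "linear f" and sym: "\<And>x y. f x \<bullet> y = x \<bullet> f y"
  shows "subspace S \<Longrightarrow> f ` S \<subseteq> S \<Longrightarrow> \<exists>B. finite B \<and> pairwise orthogonal B \<and> span B = S \<and>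
    (\<forall>b\<in>B. norm b = 1 \<and> (\<exists>l. f b = l *\<^sub>R b))"
proof (induction "dim S" arbitrary: S rule: less_induct)
  case less
  show ?case
  proof (cases "S = {0}")
    case True then show ?thesis by (intro exI[of _ "{}"]) auto
  next
    case False
    obtain e l where e: "e \<in> S" "norm e = 1" "f e = l *\<^sub>R e"
      using symmetric_max_eigenvector[OF f sym less.prems False] by blast
    define S' where "S' = S \<inter> {x. e \<bullet> x = 0}"
    have sub: "subspace S'" unfolding S'_def by (intro subspace_inter less.prems subspace_hyperplane)
    have inv: "f ` S' \<subseteq> S'"
      using less.prems(2) sym[of e, symmetric] e(3) by (auto simp: S'_def)
    have ee: "e \<bullet> e = 1" using e(2) by (simp add: dot_square_norm)
    have "e \<notin> S'" "S' \<subseteq> S" using ee by (auto simp: S'_def)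
    with e(1) have "S' \<subset> S" by blast
    then have "span S' \<subset> span S"
      using sub less.prems(1) by (simp add: span_eq_iff[THEN iffD2])
    from less.hyps[OF dim_psubset[OF this] sub inv] obtain B where
      B: "finite B" "pairwise orthogonal B" "span B = S'"
        "\<forall>b\<in>B. norm b = 1 \<and> (\<exists>l. f b = l *\<^sub>R b)" by (elim exE conjE) metis
    have Bo: "e \<bullet> b = 0" if "b \<in> B" for b
      using B(3) span_superset[of B] that by (auto simp: S'_def)
    have "span (insert e B) = S"
    proof
      show "span (insert e B) \<subseteq> S"
        using less.prems(1) e(1) B(3) span_superset[of B] by (intro span_minimal) (auto simp: S'_def)
      show "S \<subseteq> span (insert e B)"
      proof
        fix x assume x: "x \<in> S"
        have "x - (e \<bullet> x) *\<^sub>R e \<in> span B"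
          using x e less.prems(1) ee
          by (auto simp: B(3) S'_def subspace_diff subspace_scale inner_diff_right)
        then show "x \<in> span (insert e B)" unfolding span_insert by blast
      qed
    qed
    moreover have "pairwise orthogonal (insert e B)"
      using B(2) Bo by (auto simp: pairwise_insert orthogonal_def inner_commute)
    ultimately show ?thesis using B(1,4) e by (intro exI[of _ "insert e B"]) auto
  qed
qed

lemma symmetric_eigenbasis:
  fixes f :: "'n::euclidean_space \<Rightarrow> 'n"
  assumes f: "linear f" and sym: "\<And>x y. f x \<bullet> y = x \<bullet> f y"
  obtains B l where "finite B" "pairwise orthogonal B" "\<And>b. b \<in> B \<Longrightarrow> norm b = 1"
    "\<And>b. b \<in> B \<Longrightarrow> f b = l b *\<^sub>R b" "\<And>x. (\<Sum>b\<in>B. (x \<bullet> b) *\<^sub>R b) = x"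
proof -
  obtain B where B: "finite B" "pairwise orthogonal B" "span B = UNIV"
    "\<forall>b\<in>B. norm b = 1 \<and> (\<exists>l. f b = l *\<^sub>R b)"
    using symmetric_eigenbasis_subspace[OF f sym, of UNIV] by auto
  then obtain l where l: "\<And>b. b \<in> B \<Longrightarrow> f b = l b *\<^sub>R b" by metis
  have "(\<Sum>b\<in>B. (x \<bullet> b) *\<^sub>R b) = x" for x
    using B by (intro orthonormal_basis_expand) auto
  with B l that show ?thesis by blast
qed

text \<open>The \<open>THE\<close> in \<open>psd_sqrt\<close> is resolved by an orthonormal
  eigenbasis of \<open>C\<close>. Taking roots of the eigenvalues gives existence; for uniqueness,
  every positive root is shown to act on each eigenvector by the root of its eigenvalue.\<close>

lemma psd_sqrt_works:
  fixes C :: "'n::euclidean_space \<Rightarrow> 'n"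
  assumes C: "linear C" and sym: "\<And>x y. C x \<bullet> y = x \<bullet> C y" and psd: "\<And>x. 0 \<le> C x \<bullet> x"
  shows "linear (psd_sqrt C)" "psd_sqrt C x \<bullet> y = x \<bullet> psd_sqrt C y" "psd_sqrt C (psd_sqrt C x) = C x"
proof -
  let ?P = "\<lambda>R. linear R \<and> (\<forall>x y. R x \<bullet> y = x \<bullet> R y) \<and> (\<forall>x. 0 \<le> R x \<bullet> x) \<and> R \<circ> R = C"
  obtain B l where B: "finite B" "pairwise orthogonal B" "\<And>b. b \<in> B \<Longrightarrow> norm b = 1"
    and l: "\<And>b. b \<in> B \<Longrightarrow> C b = l b *\<^sub>R b" and expand: "\<And>x. (\<Sum>b\<in>B. (x \<bullet> b) *\<^sub>R b) = x"
    by (rule symmetric_eigenbasis[OF C sym]) blast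
  have bb: "b \<bullet> b' = (if b' = b then 1 else 0)" if "b \<in> B" "b' \<in> B" for b b'
    using B that by (auto simp: pairwise_def orthogonal_def dot_square_norm)
  have l0: "0 \<le> l b" if "b \<in> B" for b
    using psd[of b] that bb by (simp add: l)
  have eqI: "R = R'" if "linear R" "linear R'" "\<And>b. b \<in> B \<Longrightarrow> R b = R' b" for R R' :: "'n \<Rightarrow> 'n"
  proof
    fix x show "R x = R' x"
      using that by (subst (1 2) expand[symmetric]) (simp add: linear_sum linear_cmul)
  qed
  define R where "R x = (\<Sum>b\<in>B. (sqrt (l b) * (x \<bullet> b)) *\<^sub>R b)" for x
  have Rb: "R b = sqrt (l b) *\<^sub>R b" if "b \<in> B" for b
  proof -
    have "R b = (\<Sum>b'\<in>B. if b' = b then sqrt (l b) *\<^sub>R b else 0)"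
      unfolding R_def using that by (intro sum.cong) (auto simp: bb)
    then show ?thesis using B(1) that by simp
  qed
  have linR: "linear R"
    by (intro linearI)
       (simp_all add: R_def inner_add_left algebra_simps sum.distrib scaleR_sum_right)
  have "?P R"
  proof (intro conjI allI)
    show "linear R" by fact
    show "R x \<bullet> y = x \<bullet> R y" for x y
      by (simp add: R_def inner_sum_left inner_sum_right inner_commute mult_ac)
    show "0 \<le> R x \<bullet> x" for x
      using l0 by (auto simp: R_def inner_sum_left inner_commute[of x] mult.assoc intro!: sum_nonneg)
    show "R \<circ> R = C"
      using linR C Rb l l0 by (intro eqI linear_compose) (auto simp: linear_cmul)
  qed
  moreover have "R' = R" if P: "?P R'" for R'
  proof (rule eqI)
    show "linear R'" "linear R" using P linR by auto
    have R': "linear R'" "\<And>x y. R' x \<bullet> y = x \<bullet> R' y" "\<And>x. 0 \<le> R' x \<bullet> x" "\<And>x. R' (R' x) = C x"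
      using P by (auto simp: fun_eq_iff)
    fix b assume b: "b \<in> B"
    let ?m = "sqrt (l b)"
    have "R' b = ?m *\<^sub>R b"
    proof (cases "l b = 0")
      case True
      have "R' b \<bullet> R' b = C b \<bullet> b" using R'(2)[of "R' b" b] R'(4) by (simp add: inner_commute)
      also have "\<dots> = 0" using True b by (simp add: l)
      finally show ?thesis using True by simp
    next
      case False
      then have m: "?m > 0" using l0[OF b] by simp
      \<comment> \<open>From (R' + m)(R' - m) b = (C - m^2) b = 0 it follows that R' z = -m z, and
        positivity of R' forces z = 0 because m > 0.\<close>
      define z where "z = R' b - ?m *\<^sub>R b"
      have "R' z + ?m *\<^sub>R z = C b - (?m * ?m) *\<^sub>R b"
        by (simp add: z_def linear_diff[OF R'(1)] linear_cmul[OF R'(1)] R'(4) algebra_simps)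
      also have "\<dots> = 0" using l0[OF b] b by (simp add: l)
      finally have "R' z = - ?m *\<^sub>R z" by (simp add: eq_neg_iff_add_eq_0)
      with R'(3)[of z] m have "?m * (z \<bullet> z) \<le> 0" by simp
      with m have "z \<bullet> z \<le> 0" by (simp add: mult_le_0_iff)
      then have "z = 0" by (metis inner_eq_zero_iff inner_ge_zero order_antisym)
      then show ?thesis by (simp add: z_def)
    qed
    then show "R' b = R b" using Rb b by simp
  qed
  ultimately have "?P (psd_sqrt C)" unfolding psd_sqrt_def by (rule theI)
  then show "linear (psd_sqrt C)" "psd_sqrt C x \<bullet> y = x \<bullet> psd_sqrt C y" "psd_sqrt C (psd_sqrt C x) = C x"
    by (auto simp: fun_eq_iff)
qed

text \<open>Preimages of \<open>y\<close> differ by kernel elements, so by Pythagoras a preimage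
  orthogonal to the kernel is the unique one of least norm.\<close>

lemma pseudoinverse_eqI:
  fixes F :: "'a::euclidean_space \<Rightarrow> 'b::euclidean_space"
  assumes F: "linear F" and x: "F x = y" and orth: "\<And>z. F z = 0 \<Longrightarrow> z \<bullet> x = 0"
  shows "pseudoinverse F y = x"
  unfolding pseudoinverse_def
proof (rule the_equality)
  have pyth: "(norm x')\<^sup>2 = (norm x)\<^sup>2 + (norm (x' - x))\<^sup>2" if "F x' = y" for x'
  proof -
    have "(x' - x) \<bullet> x = 0" using that x by (intro orth) (simp add: linear_diff[OF F])
    then have "(norm (x + (x' - x)))\<^sup>2 = (norm x)\<^sup>2 + (norm (x' - x))\<^sup>2"
      by (intro norm_add_Pythagorean) (simp add: orthogonal_def inner_commute)
    then show ?thesis by simp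
  qed
  show "F x = y \<and> (\<forall>x'. F x' = y \<longrightarrow> norm x \<le> norm x')"
    using x pyth by (metis le_add_same_cancel1 norm_ge_zero power2_le_imp_le zero_le_power2)
  fix x' assume x': "F x' = y \<and> (\<forall>x''. F x'' = y \<longrightarrow> norm x' \<le> norm x'')"
  then have "(norm x')\<^sup>2 \<le> (norm x)\<^sup>2" using x by (intro power_mono) auto
  with pyth[of x'] x' show "x' = x" by (simp add: sum_power2_eq_zero_iff)
qed

context
  fixes R :: "'n::euclidean_space \<Rightarrow> 'n"
  assumes R: "linear R" and sym: "\<And>x y. R x \<bullet> y = x \<bullet> R y"
begin

text \<open>For symmetric \<open>R\<close> the orthogonal complement of the range is killed by
  \<open>R\<close>, since |R b|^2 = <b, R (R b)>.\<close>

lemma range_kernel_decomposition: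
  obtains a b where "z = a + b" "a \<in> range R" "R b = 0" "\<And>w. w \<in> range R \<Longrightarrow> w \<bullet> b = 0"
proof -
  have span: "span (range R) = range R"
    using linear_subspace_image[OF R subspace_UNIV] by (simp add: span_eq_iff)
  obtain a b where ab: "a \<in> span (range R)" "\<And>w. w \<in> span (range R) \<Longrightarrow> orthogonal b w" "z = a + b"
    using orthogonal_subspace_decomp_exists[of "range R" z] by blast
  have "R b \<bullet> R b = b \<bullet> R (R b)" by (rule sym)
  also have "\<dots> = 0" using ab(2) span by (auto simp: orthogonal_def)
  finally have "R b = 0" by simp
  with ab span that[of a b] show ?thesis by (auto simp: orthogonal_def inner_commute)
qed

text \<open>\<open>pseudoinverse R (R z)\<close> is the orthogonal projection of \<open>z\<close>
  onto \<open>range R\<close>. Its disappearance in inner products with range vectors is what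
  removes the pseudoinverses from the Gaussian integrals.\<close>

lemma pseudoinverse_symmetric:
  shows "pseudoinverse R (R z) \<in> range R" "R (pseudoinverse R (R z)) = R z"
    "w \<in> range R \<Longrightarrow> w \<bullet> pseudoinverse R (R z) = w \<bullet> z"
proof -
  obtain a b where ab: "z = a + b" "a \<in> range R" "R b = 0" "\<And>w. w \<in> range R \<Longrightarrow> w \<bullet> b = 0"
    using range_kernel_decomposition by metis
  have eq: "pseudoinverse R (R z) = a"
  proof (rule pseudoinverse_eqI[OF R])
    show "R a = R z" using ab by (simp add: linear_add[OF R])
    obtain u where "a = R u" using ab(2) by auto
    then show "y \<bullet> a = 0" if "R y = 0" for y using sym[of y u] that by simp
  qed
  show "pseudoinverse R (R z) \<in> range R" using ab eq by simp
  show "R (pseudoinverse R (R z)) = R z" using ab eq by (simp add: linear_add[OF R])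
  show "w \<in> range R \<Longrightarrow> w \<bullet> pseudoinverse R (R z) = w \<bullet> z" using ab eq by (simp add: inner_add_right)
qed

lemma kernel_pseudoinverse_orthogonal:
  assumes "R y = 0" shows "y \<bullet> pseudoinverse R (R z) = 0"
proof -
  obtain u where "pseudoinverse R (R z) = R u" using pseudoinverse_symmetric(1)[of z] by auto
  then show ?thesis using sym[of y u] assms by simp
qed

lemma pseudoinverse_add:
  assumes "v \<in> range R" "v' \<in> range R"
  shows "pseudoinverse R (v + v') = pseudoinverse R v + pseudoinverse R v'"
proof -
  obtain z z' where z: "v = R z" "v' = R z'" using assms by auto
  show ?thesis
    unfolding z by (rule pseudoinverse_eqI[OF R])
      (simp_all add: linear_add[OF R] pseudoinverse_symmetric(2) inner_add_right kernel_pseudoinverse_orthogonal)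
qed

lemma pseudoinverse_scaleR:
  assumes "v \<in> range R"
  shows "pseudoinverse R (c *\<^sub>R v) = c *\<^sub>R pseudoinverse R v"
proof -
  obtain z where z: "v = R z" using assms by auto
  show ?thesis
    unfolding z by (rule pseudoinverse_eqI[OF R])
      (simp_all add: linear_cmul[OF R] pseudoinverse_symmetric(2) kernel_pseudoinverse_orthogonal)
qed

text \<open>The hypothesis kills the kernel component of \<open>v\<close>, hence \<open>v\<close>
  lies in the range. The minimal preimage has the form w = R u, so |w|^2 = <v, u> is at most c |R u|
  = c |w|.\<close>

lemma range_dual:
  assumes c: "0 \<le> c" and v: "\<And>x. \<bar>v \<bullet> x\<bar> \<le> c * norm (R x)"
  shows "v \<in> range R" "norm (pseudoinverse R v) \<le> c"
proof -
  obtain a b where ab: "v = a + b" "a \<in> range R" "R b = 0" "\<And>w. w \<in> range R \<Longrightarrow> w \<bullet> b = 0"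
    using range_kernel_decomposition by metis
  have "v \<bullet> b = 0" using v[of b] ab(3) by simp
  with ab(1) ab(4)[OF ab(2)] have "b \<bullet> b = 0" by (simp add: inner_add_left)
  then show range: "v \<in> range R" using ab by simp
  define w where "w = pseudoinverse R v"
  have w: "w \<in> range R" "R w = v"
    using range pseudoinverse_symmetric by (auto simp: w_def)
  then obtain u where u: "w = R u" by auto
  have "norm w * norm w = w \<bullet> w" by (simp add: dot_square_norm power2_eq_square)
  also have "\<dots> = v \<bullet> u" using sym[of u w] u w by (simp add: inner_commute)
  also have "\<dots> \<le> c * norm w" using v[of u] u by simp
  finally have "w = 0 \<or> norm w \<le> c" by (metis mult_le_cancel_right norm_le_zero_iff not_le)
  then show "norm (pseudoinverse R v) \<le> c" using c by (auto simp: w_def)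
qed

end

section \<open>The operator exponential\<close>

lemma funpow_scaleR_blinfun:
  fixes A :: "'n::real_normed_vector \<Rightarrow>\<^sub>L 'n"
  shows "(blinfun_apply (t *\<^sub>R A) ^^ k) x = t ^ k *\<^sub>R (blinfun_apply A ^^ k) x"
  by (induction k) (simp_all add: blinfun.scaleR_left blinfun.scaleR_right)

lemma norm_funpow_blinfun:
  fixes A :: "'n::real_normed_vector \<Rightarrow>\<^sub>L 'n"
  shows "norm ((blinfun_apply A ^^ k) x) \<le> norm A ^ k * norm x"
proof (induction k)
  case (Suc k)
  have "norm ((blinfun_apply A ^^ Suc k) x) \<le> norm A * norm ((blinfun_apply A ^^ k) x)"
    by (simp add: norm_blinfun)
  also have "\<dots> \<le> norm A * (norm A ^ k * norm x)"
    using Suc by (intro mult_left_mono) auto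
  finally show ?case by (simp add: mult.assoc)
qed simp

context
  fixes A :: "'n::euclidean_space \<Rightarrow>\<^sub>L 'n"
begin

lemma exp_op_summable_norm: "summable (\<lambda>k. norm ((1 / fact k) *\<^sub>R (blinfun_apply A ^^ k) x))"
  and exp_op_norm: "norm (exp_op A x) \<le> exp (norm A) * norm x"
proof -
  have s: "(\<lambda>k. (norm A ^ k /\<^sub>R fact k) * norm x) sums (exp (norm A) * norm x)"
    by (intro sums_mult2 exp_converges)
  have le: "norm ((1 / fact k) *\<^sub>R (blinfun_apply A ^^ k) x) \<le> (norm A ^ k /\<^sub>R fact k) * norm x" for k
    using norm_funpow_blinfun[where A=A and k=k and x=x] by (simp add: divide_simps mult_ac)
  show sm: "summable (\<lambda>k. norm ((1 / fact k) *\<^sub>R (blinfun_apply A ^^ k) x))"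
    by (rule summable_comparison_test'[OF sums_summable[OF s], of 0]) (use le in simp)
  have "norm (exp_op A x) \<le> (\<Sum>k. norm ((1 / fact k) *\<^sub>R (blinfun_apply A ^^ k) x))"
    unfolding exp_op_def by (rule summable_norm[OF sm])
  also have "\<dots> \<le> (\<Sum>k. (norm A ^ k /\<^sub>R fact k) * norm x)"
    by (intro suminf_le le sm sums_summable[OF s])
  finally show "norm (exp_op A x) \<le> exp (norm A) * norm x" using sums_unique[OF s] by simp
qed

lemma exp_op_sums: "(\<lambda>k. (1 / fact k) *\<^sub>R (blinfun_apply A ^^ k) x) sums exp_op A x"
  unfolding exp_op_def by (rule summable_sums[OF summable_norm_cancel[OF exp_op_summable_norm]])

end

lemma linear_funpow: "linear f \<Longrightarrow> linear (f ^^ k)" for f :: "'a::real_vector \<Rightarrow> 'a"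
  by (induction k) (auto simp: linear_iff)

lemma linear_exp_op: "linear (exp_op A)" for A :: "'n::euclidean_space \<Rightarrow>\<^sub>L 'n"
proof (rule linearI)
  have lin: "linear (blinfun_apply A ^^ k)" for k
    by (intro linear_funpow blinfun.bounded_linear_right bounded_linear.linear)
  show "exp_op A (x + y) = exp_op A x + exp_op A y" for x y
    by (rule sums_unique2[OF exp_op_sums[of A "x + y"]])
       (use sums_add[OF exp_op_sums[of A x] exp_op_sums[of A y]] in
         \<open>simp add: linear_add[OF lin] scaleR_add_right\<close>)
  show "exp_op A (c *\<^sub>R x) = c *\<^sub>R exp_op A x" for c x
    by (rule sums_unique2[OF exp_op_sums[of A "c *\<^sub>R x"]])
       (use sums_scaleR_right[OF exp_op_sums[of A x], of c] in
         \<open>simp add: linear_cmul[OF lin] mult.commute\<close>)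
qed

lemma exp_op_zero [simp]: "exp_op (0 :: 'n::euclidean_space \<Rightarrow>\<^sub>L 'n) x = x"
proof -
  have "(\<lambda>k. (1 / fact k) *\<^sub>R (blinfun_apply (0 :: 'n \<Rightarrow>\<^sub>L 'n) ^^ k) x) = (\<lambda>k. if k = 0 then x else 0)"
    by (rule ext, case_tac k) auto
  then show ?thesis using sums_unique2[OF exp_op_sums[of 0 x]] sums_single[of 0 "\<lambda>_. x"] by simp
qed

context
  fixes A :: "'n::euclidean_space \<Rightarrow>\<^sub>L 'n"
begin

lemma exp_op_scaleR_sums:
  "(\<lambda>k. (t ^ k / fact k) *\<^sub>R (blinfun_apply A ^^ k) x) sums exp_op (t *\<^sub>R A) x"
  using exp_op_sums[of "t *\<^sub>R A" x] by (simp add: funpow_scaleR_blinfun)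

lemma exp_op_commute: "A (exp_op (t *\<^sub>R A) x) = exp_op (t *\<^sub>R A) (A x)"
proof (rule sums_unique2)
  have "(\<lambda>k. A ((t ^ k / fact k) *\<^sub>R (blinfun_apply A ^^ k) x)) sums A (exp_op (t *\<^sub>R A) x)"
    by (rule bounded_linear.sums[OF blinfun.bounded_linear_right exp_op_scaleR_sums])
  then show "(\<lambda>k. (t ^ k / fact k) *\<^sub>R (blinfun_apply A ^^ k) (A x)) sums A (exp_op (t *\<^sub>R A) x)"
    by (simp add: blinfun.scaleR_right funpow_swap1)
qed (rule exp_op_scaleR_sums)

text \<open>Each component is a power series in \<open>t\<close> and may be differentiated termwise;
  \<open>diffs\<close> moves one factor \<open>A\<close> onto \<open>x\<close>.\<close>

lemma exp_op_has_vector_derivative: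
  "((\<lambda>t. exp_op (t *\<^sub>R A) x) has_vector_derivative exp_op (t *\<^sub>R A) (A x)) (at t within S)"
proof -
  have comp: "(\<lambda>k. ((blinfun_apply A ^^ k) y \<bullet> i / fact k) * t ^ k) sums (exp_op (t *\<^sub>R A) y \<bullet> i)" for y i t
    using bounded_linear.sums[OF bounded_linear_inner_left exp_op_scaleR_sums[of t y], of i]
    by (simp add: mult_ac)
  have "((\<lambda>t. exp_op (t *\<^sub>R A) x \<bullet> i) has_field_derivative exp_op (t *\<^sub>R A) (A x) \<bullet> i) (at t)"
    for i :: 'n
  proof -
    define c where "c k = (blinfun_apply A ^^ k) x \<bullet> i / fact k" for k
    have d: "diffs c = (\<lambda>k. (blinfun_apply A ^^ k) (A x) \<bullet> i / fact k)"
      by (auto simp: diffs_def c_def fun_eq_iff divide_simps funpow_swap1 simp del: of_nat_Suc)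
    have "((\<lambda>t. \<Sum>k. c k * t ^ k) has_field_derivative (\<Sum>k. diffs c k * t ^ k)) (at t)"
      by (rule termdiffs_strong_converges_everywhere) (use comp[of x i] in \<open>auto simp: c_def sums_iff\<close>)
    then show ?thesis
      using comp[of x i] comp[of "A x" i] by (simp add: d sums_iff c_def)
  qed
  then have "((\<lambda>t. exp_op (t *\<^sub>R A) x) has_vector_derivative exp_op (t *\<^sub>R A) (A x)) (at t)"
    unfolding has_vector_derivative_def has_field_derivative_def
    by (subst has_derivative_componentwise_within)
       (auto simp: mult_commute_abs)
  then show ?thesis by (rule has_vector_derivative_at_within)
qed

lemma continuous_on_exp_op [continuous_intros]:
  "continuous_on S f \<Longrightarrow> continuous_on S (\<lambda>s. exp_op (f s *\<^sub>R A) x)"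
proof -
  have "continuous_on UNIV (\<lambda>t. exp_op (t *\<^sub>R A) x)"
    using exp_op_has_vector_derivative
    by (intro continuous_on_vector_derivative[of _ _ "\<lambda>t. exp_op (t *\<^sub>R A) (A x)"])
  then show "continuous_on S f \<Longrightarrow> continuous_on S (\<lambda>s. exp_op (f s *\<^sub>R A) x)"
    by (rule continuous_on_compose2) auto
qed

text \<open>Backward Gronwall: \<open>e\<^sup>2\<^sup>c\<^sup>t \<parallel>e\<^sup>t\<^sup>A x\<parallel>\<^sup>2\<close> is nondecreasing for \<open>c = \<parallel>A\<parallel>\<close>.\<close>
lemma exp_op_surj:
  assumes "0 \<le> t" shows "surj (exp_op (t *\<^sub>R A))"
proof (rule linear_inj_imp_surj)
  show "linear (exp_op (t *\<^sub>R A))" by (rule linear_exp_op)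
  have "x = 0" if x: "exp_op (t *\<^sub>R A) x = 0" for x
  proof -
    define u where "u s = exp_op (s *\<^sub>R A) x" for s
    define h where "h s = exp (2 * norm A * s) * (u s \<bullet> u s)" for s
    have u: "(u has_vector_derivative A (u s)) (at s)" for s
      unfolding u_def exp_op_commute by (rule exp_op_has_vector_derivative)
    have "((\<lambda>s. u s \<bullet> u s) has_real_derivative 2 * (u s \<bullet> A (u s))) (at s)" for s
      using has_derivative_inner[OF u[of s, unfolded has_vector_derivative_def] u[of s, unfolded has_vector_derivative_def]]
      unfolding has_field_derivative_def
      by (rule has_derivative_eq_rhs) (auto simp: inner_commute fun_eq_iff)
    then have h': "(h has_real_derivative exp (2 * norm A * s) * (2 * norm A * (u s \<bullet> u s) + 2 * (u s \<bullet> A (u s)))) (at s)" for s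
      unfolding h_def by (auto intro!: derivative_eq_intros simp: algebra_simps)
    have "h 0 \<le> h t"
    proof (rule DERIV_nonneg_imp_nondecreasing[OF assms])
      fix s
      have "\<bar>u s \<bullet> A (u s)\<bar> \<le> norm (u s) * (norm A * norm (u s))"
        by (rule order_trans[OF Cauchy_Schwarz_ineq2]) (intro mult_left_mono norm_blinfun norm_ge_zero)
      then have "0 \<le> norm A * (u s \<bullet> u s) + u s \<bullet> A (u s)"
        by (simp add: dot_square_norm power2_eq_square mult_ac)
      then have "0 \<le> exp (2 * norm A * s) * (2 * norm A * (u s \<bullet> u s) + 2 * (u s \<bullet> A (u s)))"
        by (intro mult_nonneg_nonneg) auto
      then show "\<exists>y. (h has_real_derivative y) (at s) \<and> 0 \<le> y"
        using h'[of s] by blast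
    qed
    then have "x \<bullet> x \<le> 0" using x by (simp add: h_def u_def)
    then show "x = 0" by (metis inner_eq_zero_iff inner_ge_zero order_antisym)
  qed
  then show "inj (exp_op (t *\<^sub>R A))"
    using linear_injective_0[OF linear_exp_op] by blast
qed

end

context
  fixes A :: "'n::euclidean_space \<Rightarrow>\<^sub>L 'n"
begin

lemma blinfun_adjoint: "bounded_linear (adjoint (blinfun_apply A))"
  by (simp only: linear_conv_bounded_linear[symmetric])
     (intro adjoint_linear bounded_linear.linear blinfun.bounded_linear_right)

text \<open>\<open>covar0\<close> writes the adjoint exponent as a plain function, whereas the
  series estimates are stated for bounded operators; this translates between the two.\<close>

lemma exp_op_adjoint_eq:
  "exp_op (\<lambda>y. t *\<^sub>R adjoint (blinfun_apply A) y) = exp_op (blinfun_apply (t *\<^sub>R Blinfun (adjoint (blinfun_apply A))))"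
  by (rule arg_cong[where f=exp_op])
     (simp add: fun_eq_iff blinfun.scaleR_left bounded_linear_Blinfun_apply[OF blinfun_adjoint])

lemma exp_op_adjoint:
  "exp_op (t *\<^sub>R A) x \<bullet> y = x \<bullet> exp_op (\<lambda>y. t *\<^sub>R adjoint (blinfun_apply A) y) y"
proof -
  let ?A' = "Blinfun (adjoint (blinfun_apply A))"
  have adj: "A x \<bullet> y = x \<bullet> ?A' y" for x y
    using adjoint_works[OF bounded_linear.linear[OF blinfun.bounded_linear_right[of A]], of x y]
    by (simp add: bounded_linear_Blinfun_apply[OF blinfun_adjoint] inner_commute)
  have "(blinfun_apply A ^^ k) x \<bullet> y = x \<bullet> (blinfun_apply ?A' ^^ k) y" for k x y
    by (induction k arbitrary: x y) (simp_all add: adj funpow_swap1)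
  then have eq: "(\<lambda>k. ((t ^ k / fact k) *\<^sub>R (blinfun_apply A ^^ k) x) \<bullet> y) =
      (\<lambda>k. x \<bullet> ((t ^ k / fact k) *\<^sub>R (blinfun_apply ?A' ^^ k) y))"
    by simp
  show ?thesis
    unfolding exp_op_adjoint_eq
    by (rule sums_unique2[OF bounded_linear.sums[OF bounded_linear_inner_left exp_op_scaleR_sums[where A=A and t=t and x=x], of y, unfolded eq]
      bounded_linear.sums[OF bounded_linear_inner_right exp_op_scaleR_sums[where A="?A'" and t=t and x=y], of x]])
qed

end

section \<open>The cost of control\<close>

lemma Cauchy_Schwarz_integral:
  fixes f g :: "'a \<Rightarrow> real"
  assumes [measurable]: "f \<in> borel_measurable M" "g \<in> borel_measurable M"
    and f: "integrable M (\<lambda>x. (f x)\<^sup>2)" and g: "integrable M (\<lambda>x. (g x)\<^sup>2)"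
  shows "integrable M (\<lambda>x. f x * g x)"
    "\<bar>LINT x|M. f x * g x\<bar> \<le> sqrt (LINT x|M. (f x)\<^sup>2) * sqrt (LINT x|M. (g x)\<^sup>2)"
proof -
  show fg: "integrable M (\<lambda>x. f x * g x)"
  proof (rule Bochner_Integration.integrable_bound)
    show "integrable M (\<lambda>x. (f x)\<^sup>2 + (g x)\<^sup>2)" using f g by simp
    have "\<bar>a * b\<bar> \<le> \<bar>a\<^sup>2 + b\<^sup>2\<bar>" for a b :: real
    proof -
      have "2 * (\<bar>a\<bar> * \<bar>b\<bar>) \<le> a\<^sup>2 + b\<^sup>2" "0 \<le> \<bar>a\<bar> * \<bar>b\<bar>"
        using sum_squares_bound[of "\<bar>a\<bar>" "\<bar>b\<bar>"] by (simp_all add: mult.assoc)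
      then show ?thesis unfolding abs_mult by linarith
    qed
    then show "AE x in M. norm (f x * g x) \<le> norm ((f x)\<^sup>2 + (g x)\<^sup>2)" by simp
  qed measurable
  define F where "F = (LINT x|M. (f x)\<^sup>2)"
  define G where "G = (LINT x|M. (g x)\<^sup>2)"
  define H where "H = (LINT x|M. f x * g x)"
  have FG: "0 \<le> F" "0 \<le> G" by (auto simp: F_def G_def)
  have quad: "0 \<le> F + 2 * s * H + s\<^sup>2 * G" for s
  proof -
    have "0 \<le> (LINT x|M. (f x + s * g x)\<^sup>2)" by simp
    also have "(\<lambda>x. (f x + s * g x)\<^sup>2) = (\<lambda>x. (f x)\<^sup>2 + (2 * s) * (f x * g x) + s\<^sup>2 * (g x)\<^sup>2)"
      by (auto simp: power2_eq_square algebra_simps)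
    finally show ?thesis using f g fg by (simp add: F_def G_def H_def)
  qed
  have "H\<^sup>2 \<le> F * G"
  proof (cases "G = 0")
    case True
    \<comment> \<open>For G = 0 the quadratic is affine in s, and the chosen s gives it the value
      -1.\<close>
    have "H = 0"
    proof (rule ccontr)
      assume "H \<noteq> 0"
      then show False using quad[of "- (F + 1) / (2 * H)"] True by (simp add: field_simps)
    qed
    then show ?thesis using FG by simp
  next
    case False
    then have "G > 0" using FG by simp
    then show ?thesis using quad[of "- H / G"] by (simp add: field_simps power2_eq_square)
  qed
  then have "\<bar>H\<bar> \<le> sqrt (F * G)" by (metis real_sqrt_abs real_sqrt_le_iff)
  then show "\<bar>LINT x|M. f x * g x\<bar> \<le> sqrt (LINT x|M. (f x)\<^sup>2) * sqrt (LINT x|M. (g x)\<^sup>2)"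
    by (simp add: F_def G_def H_def real_sqrt_mult)
qed

section \<open>Steering along one trajectory: annihilating and boundary polynomials\<close>

lemma sequence_in_span_of_predecessors:
  fixes u :: "nat \<Rightarrow> 'a::euclidean_space"
  obtains N where "u N \<in> span (u ` {..<N})"
proof (rule ccontr)
  assume *: "\<not> thesis"
  have "independent (u ` {..<N}) \<and> card (u ` {..<N}) = N" for N
  proof (induction N)
    case (Suc N)
    have "u N \<notin> span (u ` {..<N})" using * that by blast
    moreover from this have "u N \<notin> u ` {..<N}" by (rule contrapos_nn) (rule span_base)
    ultimately show ?case using Suc by (simp add: lessThan_Suc independent_insert)
  qed (simp add: independent_empty)
  from this[of "Suc DIM('a)"] independent_bound[of "u ` {..<Suc DIM('a)}"] show False by simp
qed

lemma span_image_lessThanE: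
  fixes u :: "nat \<Rightarrow> 'a::real_vector"
  assumes "w \<in> span (u ` {..<N})"
  obtains c where "w = (\<Sum>k<N. c k *\<^sub>R u k)"
  using assms
proof (induction N arbitrary: w thesis)
  case (Suc N)
  then have "w \<in> span (insert (u N) (u ` {..<N}))" by (simp add: lessThan_Suc)
  then obtain a where "w - a *\<^sub>R u N \<in> span (u ` {..<N})" unfolding span_insert by blast
  then obtain c where c: "w - a *\<^sub>R u N = (\<Sum>k<N. c k *\<^sub>R u k)" using Suc.IH by blast
  show ?case
  proof (rule Suc.prems(1))
    have "(\<Sum>k<N. (c(N := a)) k *\<^sub>R u k) = (\<Sum>k<N. c k *\<^sub>R u k)" by (intro sum.cong) auto
    then show "w = (\<Sum>k<Suc N. (c(N := a)) k *\<^sub>R u k)"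
      using c by (simp add: algebra_simps)
  qed
qed auto

lemma annihilating_polynomial:
  fixes A :: "'n::euclidean_space \<Rightarrow>\<^sub>L 'n"
  obtains N a where "0 < N" "a N = (1::real)" "(\<Sum>k\<le>N. a k *\<^sub>R (blinfun_apply A ^^ k) v) = 0"
proof -
  let ?u = "\<lambda>k. (blinfun_apply A ^^ k) v"
  \<comment> \<open>Shifting the sequence by one makes the degree \<open>Suc N\<close> positive even
    for v = 0, as \<open>boundary_polynomial\<close> requires.\<close>
  obtain N where "?u (Suc N) \<in> span ((\<lambda>k. ?u (Suc k)) ` {..<N})"
    using sequence_in_span_of_predecessors by metis
  moreover have "(\<lambda>k. ?u (Suc k)) ` {..<N} \<subseteq> ?u ` {..<Suc N}"
    by (intro image_subsetI image_eqI[OF refl]) auto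
  ultimately have "?u (Suc N) \<in> span (?u ` {..<Suc N})" using span_mono by blast
  then obtain c where c: "?u (Suc N) = (\<Sum>k<Suc N. c k *\<^sub>R ?u k)" by (rule span_image_lessThanE)
  define a where "a k = (if k = Suc N then 1 else - c k)" for k
  have "(\<Sum>k\<le>Suc N. a k *\<^sub>R ?u k) = (\<Sum>k<Suc N. a k *\<^sub>R ?u k) + ?u (Suc N)"
    by (simp add: a_def lessThan_Suc_atMost[symmetric])
  also have "(\<Sum>k<Suc N. a k *\<^sub>R ?u k) = (\<Sum>k<Suc N. - (c k *\<^sub>R ?u k))"
    by (intro sum.cong) (auto simp: a_def)
  also have "\<dots> + ?u (Suc N) = 0" by (simp only: c sum_negf) simp
  finally show ?thesis by (intro that[of "Suc N" a]) (auto simp: a_def)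
qed

text \<open>Each differentiation costs at most one factor of a power of \<open>r\<close>.\<close>

lemma higher_pderiv_dvd:
  fixes r :: "real poly"
  shows "r ^ (i + m) dvd p \<Longrightarrow> r ^ m dvd (pderiv ^^ i) p"
proof (induction i arbitrary: p)
  case (Suc i)
  then obtain s where s: "p = r ^ Suc (i + m) * s" by (metis add_Suc dvd_def)
  have "r ^ (i + m) dvd pderiv p"
    unfolding s pderiv_mult pderiv_power_Suc
    by (intro dvd_add dvd_mult2 dvd_mult dvd_smult dvd_refl) (simp add: mult.commute)
  then show ?case using Suc.IH by (simp add: funpow_swap1)
qed simp

text \<open>The witness is c / (N-1)! times x^(N-1) (1-x)^N. The monomial gives the zero of order
  N-1 at 0; the other factor equals 1 at 0 and has a zero of order N at 1. The factorial cancels the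
  one produced by N-1 differentiations at 0.\<close>

lemma boundary_polynomial:
  assumes "0 < N"
  obtains p :: "real poly" where
    "\<And>i. Suc i < N \<Longrightarrow> poly ((pderiv ^^ i) p) 0 = 0" "poly ((pderiv ^^ (N - 1)) p) 0 = c"
    "\<And>i. i < N \<Longrightarrow> poly ((pderiv ^^ i) p) 1 = 0"
proof
  define p :: "real poly" where "p = smult (c / fact (N - 1)) (monom 1 (N - 1) * [:1, -1:] ^ N)"
  have at0: "poly ((pderiv ^^ i) p) 0 = fact i * (c / fact (N - 1) * (if i < N - 1 then 0 else coeff ([:1, -1:] ^ N) (i - (N - 1))))" for i
    by (simp add: poly_0_coeff_0 coeff_higher_pderiv p_def coeff_monom_mult pochhammer_fact)
  show "poly ((pderiv ^^ i) p) 0 = 0" if "Suc i < N" for i using that by (simp add: at0)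
  have "coeff ([:1, -1:] ^ N) 0 = (1::real)" by (simp add: poly_0_coeff_0[symmetric])
  then show "poly ((pderiv ^^ (N - 1)) p) 0 = c" by (simp add: at0)
  show "poly ((pderiv ^^ i) p) 1 = 0" if "i < N" for i
  proof -
    have "[:1, -1:] ^ (i + (N - i)) dvd p" using that by (simp add: p_def dvd_smult)
    then have "[:1, -1:] ^ (N - i) dvd (pderiv ^^ i) p" by (rule higher_pderiv_dvd)
    then have "[:1, -1:] dvd (pderiv ^^ i) p" using that
      by (metis dvd_power dvd_trans zero_less_diff)
    then show ?thesis by auto
  qed
qed

text \<open>Let \<open>P\<close> be a polynomial of degree \<open>N\<close> with \<open>P(A) v = 0\<close>.  Then \<open>P(D) (e\<^sup>s\<^sup>A v) = 0\<close>, so for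
  \<open>q = P(-D) \<eta>\<close> integration by parts reduces \<open>\<integral> q(s) e\<^sup>s\<^sup>A v ds\<close> to boundary terms; these add
  up to \<open>v\<close> if \<open>\<eta>\<close> vanishes to order \<open>N\<close> at \<open>t\<close> and to order \<open>N - 1\<close> at \<open>0\<close>.  Scaling
  \<open>\<eta>(s) = t\<^bsup>N-1\<^esup> p(s/t)\<close> gives \<open>q = O(1/t)\<close>.\<close>
lemma scalar_control:
  fixes A :: "'n::euclidean_space \<Rightarrow>\<^sub>L 'n" and T :: real
  assumes "0 < T"
  obtains C where "0 \<le> C" "\<And>t. t \<in> {0<..T} \<Longrightarrow> \<exists>q. continuous_on {0..t} q \<and>
    (\<forall>s\<in>{0..t}. \<bar>q s\<bar> \<le> C / t) \<and> ((\<lambda>s. q s *\<^sub>R exp_op (s *\<^sub>R A) v) has_integral v) {0..t}"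
proof -
  obtain N a where N: "0 < N" and aN: "a N = (1::real)"
    and ann: "(\<Sum>k\<le>N. a k *\<^sub>R (blinfun_apply A ^^ k) v) = 0"
    by (rule annihilating_polynomial[of A v])
  \<comment> \<open>The prescribed value cancels the sign that N-1 integrations by parts leave on
    the only surviving boundary term at 0.\<close>
  obtain p :: "real poly" where p0: "\<And>i. Suc i < N \<Longrightarrow> poly ((pderiv ^^ i) p) 0 = 0"
    and pN: "poly ((pderiv ^^ (N - 1)) p) 0 = (-1) ^ (N - 1)"
    and p1: "\<And>i. i < N \<Longrightarrow> poly ((pderiv ^^ i) p) 1 = 0"
    by (rule boundary_polynomial[OF N, of "(-1) ^ (N - 1)"]) blast
  have "\<exists>c. \<forall>r\<in>{0..1}. \<bar>poly ((pderiv ^^ i) p) r\<bar> \<le> c" for i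
  proof -
    have "bounded ((\<lambda>r. poly ((pderiv ^^ i) p) r) ` {0..1})"
      by (intro compact_imp_bounded compact_continuous_image continuous_intros) auto
    then show ?thesis by (auto simp: bounded_iff)
  qed
  then obtain c where c: "\<And>i r. r \<in> {0..1} \<Longrightarrow> \<bar>poly ((pderiv ^^ i) p) r\<bar> \<le> c i" by metis
  have c0: "0 \<le> c i" for i using c[of 0 i] by auto
  define C where "C = (\<Sum>k\<le>N. \<bar>a k\<bar> * (max 1 T ^ N * c k))"
  define e where "e k s = exp_op (s *\<^sub>R A) ((blinfun_apply A ^^ k) v)" for k s
  have e': "(e k has_vector_derivative e (Suc k) s) (at s within S)" for k s S
    unfolding e_def using exp_op_has_vector_derivative[of A "(blinfun_apply A ^^ k) v"] by simp
  have sum_e: "(\<Sum>k\<le>N. a k *\<^sub>R e k s) = 0" for s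
  proof -
    have "(\<Sum>k\<le>N. a k *\<^sub>R e k s) = exp_op (s *\<^sub>R A) (\<Sum>k\<le>N. a k *\<^sub>R (blinfun_apply A ^^ k) v)"
      by (simp add: e_def linear_sum[OF linear_exp_op] linear_cmul[OF linear_exp_op])
    then show ?thesis by (simp add: ann linear_0[OF linear_exp_op])
  qed
  show ?thesis
  proof (rule that)
    show "0 \<le> C" unfolding C_def using c0 by (intro sum_nonneg mult_nonneg_nonneg) auto
    fix t assume t: "t \<in> {0<..T}"
    then have t0: "0 < t" "t \<le> T" by auto
    \<comment> \<open>\<open>\<eta> i\<close> is the i-th derivative of t^(N-1) p(s/t). Its factor
      t^(N-1-i) is written as a quotient because the exponent is -1 for i = N.\<close>
    define \<eta> where "\<eta> i s = t ^ N / t ^ Suc i * poly ((pderiv ^^ i) p) (s / t)" for i s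
    define q where "q s = (\<Sum>k\<le>N. a k * ((-1) ^ k * \<eta> k s))" for s
    \<comment> \<open>These are the boundary terms of k integrations by parts, weighted by the
      coefficients of P. The derivative of the inner sum telescopes to \<eta> D^k e - (-D)^k \<eta>
      e; the first terms add up to \<eta> P(D) e = 0, so only - q e remains.\<close>
    define \<Psi> where "\<Psi> s = (\<Sum>k\<le>N. a k *\<^sub>R (\<Sum>j<k. ((-1) ^ (k - Suc j) * \<eta> (k - Suc j) s) *\<^sub>R e j s))" for s
    have \<eta>': "(\<eta> i has_real_derivative \<eta> (Suc i) s) (at s within S)" for i s S
      unfolding \<eta>_def using t0 by (auto intro!: derivative_eq_intros simp: field_simps)
    have step: "((\<lambda>s. ((-1) ^ (k - Suc j) * \<eta> (k - Suc j) s) *\<^sub>R e j s) has_vector_derivative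
        ((-1) ^ (k - Suc j) * \<eta> (k - Suc j) s) *\<^sub>R e (Suc j) s - ((-1) ^ (k - j) * \<eta> (k - j) s) *\<^sub>R e j s)
        (at s within S)" if "j < k" for k j s S
    proof -
      have "k - j = Suc (k - Suc j)" using that by simp
      then show ?thesis
        by (auto intro!: derivative_eq_intros \<eta>' e' has_vector_derivative_scaleR)
    qed
    have \<Psi>': "(\<Psi> has_vector_derivative - (q s *\<^sub>R e 0 s)) (at s within S)" for s S
    proof -
      have "(\<Psi> has_vector_derivative (\<Sum>k\<le>N. a k *\<^sub>R (\<Sum>j<k. ((-1) ^ (k - Suc j) * \<eta> (k - Suc j) s) *\<^sub>R e (Suc j) s
          - ((-1) ^ (k - j) * \<eta> (k - j) s) *\<^sub>R e j s))) (at s within S)"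
        unfolding \<Psi>_def
        by (intro has_vector_derivative_sum bounded_linear.has_vector_derivative[OF bounded_linear_scaleR_right] step) auto
      also have "(\<Sum>k\<le>N. a k *\<^sub>R (\<Sum>j<k. ((-1) ^ (k - Suc j) * \<eta> (k - Suc j) s) *\<^sub>R e (Suc j) s
          - ((-1) ^ (k - j) * \<eta> (k - j) s) *\<^sub>R e j s)) =
        (\<Sum>k\<le>N. a k *\<^sub>R (\<eta> 0 s *\<^sub>R e k s - ((-1) ^ k * \<eta> k s) *\<^sub>R e 0 s))"
        using sum_lessThan_telescope[of "\<lambda>j. ((-1) ^ (k - j) * \<eta> (k - j) s) *\<^sub>R e j s" for k]
        by (intro sum.cong refl arg_cong2[where f=scaleR]) simp
      also have "\<dots> = \<eta> 0 s *\<^sub>R (\<Sum>k\<le>N. a k *\<^sub>R e k s) - q s *\<^sub>R e 0 s"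
        by (simp add: q_def scaleR_right_diff_distrib sum_subtractf scaleR_sum_right scaleR_sum_left mult.commute)
      finally show ?thesis by (simp add: sum_e)
    qed
    have "((\<lambda>s. - (q s *\<^sub>R e 0 s)) has_integral (\<Psi> t - \<Psi> 0)) {0..t}"
      using t0 by (intro fundamental_theorem_of_calculus \<Psi>') auto
    moreover have "\<Psi> t = 0"
      unfolding \<Psi>_def using t0 by (intro sum.neutral) (auto simp: \<eta>_def p1 intro!: sum.neutral)
    moreover have "\<Psi> 0 = v"
    proof -
      \<comment> \<open>Derivatives of \<eta> of order below N-1 vanish at 0, and order N-1 occurs
        only for k = N and j = 0.\<close>
      have "(\<Sum>j<k. ((-1) ^ (k - Suc j) * \<eta> (k - Suc j) 0) *\<^sub>R e j 0) = (if k = N then v else 0)" if "k \<le> N" for k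
      proof -
        have "(\<Sum>j<k. ((-1) ^ (k - Suc j) * \<eta> (k - Suc j) 0) *\<^sub>R e j 0) = (\<Sum>j<k. if j = 0 \<and> k = N then v else 0)"
        proof (intro sum.cong refl)
          fix j assume j: "j \<in> {..<k}"
          show "((-1) ^ (k - Suc j) * \<eta> (k - Suc j) 0) *\<^sub>R e j 0 = (if j = 0 \<and> k = N then v else 0)"
          proof (cases "j = 0 \<and> k = N")
            case True
            moreover have "\<eta> (N - 1) 0 = (-1) ^ (N - 1)"
              using N t0 pN by (simp add: \<eta>_def)
            ultimately show ?thesis by (simp add: e_def power_mult_distrib[symmetric])
          next
            case False
            then have "Suc (k - Suc j) < N" using j that by auto
            then show ?thesis using False by (auto simp: \<eta>_def p0)
          qed
        qed
        also have "\<dots> = (if k = N then v else 0)" using N by auto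
        finally show ?thesis .
      qed
      then have "\<Psi> 0 = (\<Sum>k\<le>N. if k = N then a N *\<^sub>R v else 0)"
        unfolding \<Psi>_def by (intro sum.cong) auto
      then show ?thesis by (simp add: aN)
    qed
    ultimately have int: "((\<lambda>s. q s *\<^sub>R exp_op (s *\<^sub>R A) v) has_integral v) {0..t}"
      using has_integral_neg[of "\<lambda>s. - (q s *\<^sub>R e 0 s)" "- v" "{0..t}"] by (simp add: e_def)
    have bound: "\<bar>q s\<bar> \<le> C / t" if s: "s \<in> {0..t}" for s
    proof -
      have "\<bar>\<eta> k s\<bar> \<le> max 1 T ^ N * c k / t" if k: "k \<le> N" for k
      proof -
        \<comment> \<open>One factor 1/t is split off. What remains is a power of t with nonnegative
          exponent, and bounding it is what makes the constant depend on \<open>T\<close>.\<close>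
        have "t ^ N / t ^ Suc k = t ^ (N - k) / t"
          using t0 k by (simp add: power_diff)
        moreover have "t ^ (N - k) \<le> max 1 T ^ N"
        proof -
          have "t ^ (N - k) \<le> max 1 T ^ (N - k)" using t0 by (intro power_mono) auto
          also have "\<dots> \<le> max 1 T ^ N" by (intro power_increasing) auto
          finally show ?thesis .
        qed
        moreover have "\<bar>poly ((pderiv ^^ k) p) (s / t)\<bar> \<le> c k" using s t0 by (intro c) auto
        ultimately have "t ^ N / t ^ Suc k * \<bar>poly ((pderiv ^^ k) p) (s / t)\<bar> \<le> (max 1 T ^ N / t) * c k"
          using t0 by (intro mult_mono) (auto simp: divide_right_mono)
        then show ?thesis using t0 by (simp add: \<eta>_def abs_mult)
      qed
      then have "\<bar>a k * ((-1) ^ k * \<eta> k s)\<bar> \<le> \<bar>a k\<bar> * (max 1 T ^ N * c k / t)" if "k \<le> N" for k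
        unfolding abs_mult power_abs using that by (simp only: abs_minus_cancel abs_one power_one mult_1) (intro mult_left_mono, auto)
      then have "\<bar>q s\<bar> \<le> (\<Sum>k\<le>N. \<bar>a k\<bar> * (max 1 T ^ N * c k / t))"
        unfolding q_def by (intro order_trans[OF sum_abs] sum_mono) auto
      then show ?thesis by (simp add: C_def sum_divide_distrib)
    qed
    have "continuous_on {0..t} q"
      unfolding q_def
      by (intro continuous_intros DERIV_continuous_on[OF \<eta>'])
    with int bound show "\<exists>q. continuous_on {0..t} q \<and> (\<forall>s\<in>{0..t}. \<bar>q s\<bar> \<le> C / t) \<and>
      ((\<lambda>s. q s *\<^sub>R exp_op (s *\<^sub>R A) v) has_integral v) {0..t}" by blast
  qed
qed

section \<open>The controllability Gramian and its observation norm\<close>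

abbreviation delay_kernel :: "('n::euclidean_space \<Rightarrow>\<^sub>L 'n) \<Rightarrow> real \<Rightarrow> real \<Rightarrow> 'n \<Rightarrow> 'n" where
  "delay_kernel a0 t s v \<equiv> indicator {-t..0} s *\<^sub>R exp_op ((t + s) *\<^sub>R a0) v"

lemma linear_blinfun: "linear (blinfun_apply A)"
  by (rule bounded_linear.linear[OF blinfun.bounded_linear_right])

context
  fixes a0 :: "'n::euclidean_space \<Rightarrow>\<^sub>L 'n" and \<sigma> :: "'q::euclidean_space \<Rightarrow>\<^sub>L 'n"
begin

text \<open>The observation operator of the dual system; \<open>covar0\<close> is its Gramian over
  [0,t].\<close>

definition obs :: "real \<Rightarrow> 'n \<Rightarrow> 'q" where
  "obs s x = adjoint (blinfun_apply \<sigma>) (exp_op (\<lambda>y. s *\<^sub>R adjoint (blinfun_apply a0) y) x)"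

abbreviation sqrt_covar :: "real \<Rightarrow> 'n \<Rightarrow> 'n" where
  "sqrt_covar t \<equiv> psd_sqrt (covar0 a0 \<sigma> t)"

lemma obs_adjoint: "exp_op (s *\<^sub>R a0) (\<sigma> y) \<bullet> x = y \<bullet> obs s x"
  unfolding obs_def adjoint_works[OF linear_blinfun] by (rule exp_op_adjoint)

lemma linear_obs: "linear (obs s)"
  unfolding obs_def exp_op_adjoint_eq
  using linear_compose[OF linear_exp_op adjoint_linear[OF linear_blinfun]] by (simp add: o_def)

lemma continuous_on_obs [continuous_intros]:
  "continuous_on S f \<Longrightarrow> continuous_on S (\<lambda>s. obs (f s) x)"
  unfolding obs_def exp_op_adjoint_eq
  by (intro bounded_linear.continuous_on[OF linear_conv_bounded_linear[THEN iffD1, OF adjoint_linear[OF linear_blinfun]]]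
      continuous_intros)

text \<open>Operator and argument both depend on \<open>s\<close>, while
  \<open>continuous_on_exp_op\<close> fixes the argument; expansion in the basis separates
  them.\<close>

lemma covar0_integrand_continuous:
  "continuous_on S (\<lambda>s. exp_op (s *\<^sub>R a0) (\<sigma> (obs s x)))"
proof -
  have "(\<lambda>s. exp_op (s *\<^sub>R a0) (\<sigma> (obs s x))) =
    (\<lambda>s. \<Sum>i\<in>Basis. (\<sigma> (obs s x) \<bullet> i) *\<^sub>R exp_op (s *\<^sub>R a0) i)"
    by (subst euclidean_representation[symmetric, of "\<sigma> (obs s x)" for s])
       (simp add: linear_sum[OF linear_exp_op] linear_cmul[OF linear_exp_op] del: euclidean_representation)
  then show ?thesis by (simp only:) (intro continuous_intros)
qed

lemma covar0_has_integral:
  "((\<lambda>s. exp_op (s *\<^sub>R a0) (\<sigma> (obs s x))) has_integral covar0 a0 \<sigma> t x) {0..t}"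
  unfolding covar0_def obs_def[symmetric]
  by (intro integrable_integral integrable_continuous_interval covar0_integrand_continuous)

lemma covar0_inner_has_integral: "((\<lambda>s. obs s x \<bullet> obs s y) has_integral (covar0 a0 \<sigma> t x \<bullet> y)) {0..t}"
  using has_integral_linear[OF covar0_has_integral[of x t] bounded_linear_inner_left[of y]]
  by (simp add: o_def obs_adjoint)

lemma covar0_inner: "covar0 a0 \<sigma> t x \<bullet> y = (LINT s:{0..t}|lborel. obs s x \<bullet> obs s y)"
proof -
  have "set_integrable lborel {0..t} (\<lambda>s. obs s x \<bullet> obs s y)"
    by (intro borel_integrable_atLeastAtMost' continuous_intros)
  then show ?thesis
    using covar0_inner_has_integral[of x y t] by (simp add: set_borel_integral_eq_integral integral_unique)
qed

lemma covar0_eqI: "(\<And>y. covar0 a0 \<sigma> t x \<bullet> y = z \<bullet> y) \<Longrightarrow> covar0 a0 \<sigma> t x = z"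
  by (auto intro: euclidean_eqI)

lemma linear_covar0: "linear (covar0 a0 \<sigma> t)"
proof (rule linearI)
  show "covar0 a0 \<sigma> t (x + x') = covar0 a0 \<sigma> t x + covar0 a0 \<sigma> t x'" for x x'
  proof (rule covar0_eqI)
    fix y
    show "covar0 a0 \<sigma> t (x + x') \<bullet> y = (covar0 a0 \<sigma> t x + covar0 a0 \<sigma> t x') \<bullet> y"
      using has_integral_add[OF covar0_inner_has_integral[of x y t] covar0_inner_has_integral[of x' y t]]
        covar0_inner_has_integral[of "x + x'" y t]
      by (intro has_integral_unique[where f="\<lambda>s. obs s (x + x') \<bullet> obs s y"])
         (simp_all add: linear_add[OF linear_obs] inner_add_left)
  qed
  show "covar0 a0 \<sigma> t (c *\<^sub>R x) = c *\<^sub>R covar0 a0 \<sigma> t x" for c x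
  proof (rule covar0_eqI)
    fix y
    show "covar0 a0 \<sigma> t (c *\<^sub>R x) \<bullet> y = (c *\<^sub>R covar0 a0 \<sigma> t x) \<bullet> y"
      using has_integral_mult_right[OF covar0_inner_has_integral[of x y t], of c]
        covar0_inner_has_integral[of "c *\<^sub>R x" y t]
      by (intro has_integral_unique[where f="\<lambda>s. obs s (c *\<^sub>R x) \<bullet> obs s y"])
         (simp_all add: linear_cmul[OF linear_obs])
  qed
qed

lemma covar0_symmetric: "covar0 a0 \<sigma> t x \<bullet> y = x \<bullet> covar0 a0 \<sigma> t y"
  using covar0_inner[of t x y] covar0_inner[of t y x] by (simp add: inner_commute)

lemma covar0_psd: "0 \<le> covar0 a0 \<sigma> t x \<bullet> x"
  unfolding covar0_inner set_lebesgue_integral_def by (intro integral_nonneg_AE) auto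

lemmas psd_sqrt_covar0 = psd_sqrt_works[OF linear_covar0 covar0_symmetric covar0_psd]

lemma norm_psd_sqrt_covar0: "(norm (sqrt_covar t x))\<^sup>2 = (LINT s:{0..t}|lborel. (norm (obs s x))\<^sup>2)"
proof -
  have "(norm (sqrt_covar t x))\<^sup>2 = covar0 a0 \<sigma> t x \<bullet> x"
    using psd_sqrt_covar0(2)[of t "sqrt_covar t x" x]
    by (simp add: power2_norm_eq_inner psd_sqrt_covar0(3))
  then show ?thesis by (simp add: covar0_inner power2_norm_eq_inner)
qed

text \<open>Cauchy-Schwarz against the constant 1 on [0,t]. Its factor sqrt t, multiplied by the
  bound C/t on the scalar control, yields the rate t^(-1/2).\<close>

lemma integral_norm_obs_le:
  assumes "0 \<le> t"
  shows "(LINT s:{0..t}|lborel. norm (obs s x)) \<le> sqrt t * norm (sqrt_covar t x)"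
proof -
  have cont: "continuous_on UNIV (\<lambda>s. obs s x)" by (intro continuous_intros)
  then have [measurable]: "(\<lambda>s. obs s x) \<in> borel_measurable borel"
    by (rule borel_measurable_continuous_onI)
  let ?f = "\<lambda>s. indicator {0..t} s :: real" and ?g = "\<lambda>s. indicator {0..t} s * norm (obs s x)"
  have sq: "(\<lambda>s. (?f s)\<^sup>2) = indicator {0..t}" "(\<lambda>s. (?g s)\<^sup>2) = (\<lambda>s. indicator {0..t} s *\<^sub>R (norm (obs s x))\<^sup>2)"
    by (auto simp: indicator_def fun_eq_iff)
  have int: "set_integrable lborel {0..t} (\<lambda>s. (norm (obs s x))\<^sup>2)"
    by (intro borel_integrable_atLeastAtMost' continuous_intros)
  have "integrable lborel (indicator {0..t} :: real \<Rightarrow> real)" by (rule integrable_real_indicator) (auto simp: emeasure_lborel_Icc_eq)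
  then have "\<bar>LINT s|lborel. ?f s * ?g s\<bar> \<le> sqrt (LINT s|lborel. (?f s)\<^sup>2) * sqrt (LINT s|lborel. (?g s)\<^sup>2)"
    using int by (intro Cauchy_Schwarz_integral) (auto simp: sq set_integrable_def)
  also have "(LINT s|lborel. (?f s)\<^sup>2) = t" using assms by (simp add: sq)
  also have "sqrt (LINT s|lborel. (?g s)\<^sup>2) = norm (sqrt_covar t x)"
    by (simp add: sq set_lebesgue_integral_def[symmetric] norm_psd_sqrt_covar0[symmetric] del: real_scaleR_def)
  also have "(LINT s|lborel. ?f s * ?g s) = (LINT s:{0..t}|lborel. norm (obs s x))"
    unfolding set_lebesgue_integral_def by (intro Bochner_Integration.integral_cong) (auto simp: indicator_def)
  finally show ?thesis by simp
qed

text \<open>The scalar control depends on the vector to be steered. It is used for the finitely many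
  \<open>\<sigma> j\<close> with \<open>j\<close> in \<open>Basis\<close>, and the constants are
  summed into one that serves every \<open>y\<close>.\<close>

lemma range_cost:
  assumes "0 < T"
  obtains C where "0 \<le> C" "\<And>t x y. t \<in> {0<..T} \<Longrightarrow>
    \<bar>\<sigma> y \<bullet> x\<bar> \<le> C * t powr (-1/2) * norm y * norm (sqrt_covar t x)"
proof -
  define P where "P t c j q \<longleftrightarrow> continuous_on {0..t} q \<and> (\<forall>s\<in>{0..t}. \<bar>q s\<bar> \<le> c / t) \<and>
      ((\<lambda>s. q s *\<^sub>R exp_op (s *\<^sub>R a0) (\<sigma> j)) has_integral \<sigma> j) {0..t}" for t c j q
  have "\<exists>C\<ge>0. \<forall>t\<in>{0<..T}. \<exists>q. P t C j q" for j
    unfolding P_def by (rule scalar_control[OF assms, of a0 "\<sigma> j"]) blast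
  then obtain C where C0: "\<And>j. 0 \<le> C j" and C: "\<And>j t. t \<in> {0<..T} \<Longrightarrow> \<exists>q. P t (C j) j q"
    by metis
  have basis: "\<bar>\<sigma> j \<bullet> x\<bar> \<le> C j * t powr (-1/2) * norm (sqrt_covar t x)"
    if j: "j \<in> Basis" and t: "t \<in> {0<..T}" for j t x
  proof -
    from C[OF t, of j] obtain q where q: "continuous_on {0..t} q" "\<And>s. s \<in> {0..t} \<Longrightarrow> \<bar>q s\<bar> \<le> C j / t"
      and int: "((\<lambda>s. q s *\<^sub>R exp_op (s *\<^sub>R a0) (\<sigma> j)) has_integral \<sigma> j) {0..t}" unfolding P_def by blast
    have t0: "0 < t" using t by simp
    have "((\<lambda>s. q s * (j \<bullet> obs s x)) has_integral (\<sigma> j \<bullet> x)) {0..t}"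
      using has_integral_linear[OF int bounded_linear_inner_left[of x]] by (simp add: o_def obs_adjoint)
    moreover have "set_integrable lborel {0..t} (\<lambda>s. q s * (j \<bullet> obs s x))"
      using q(1) by (intro borel_integrable_atLeastAtMost' continuous_intros)
    ultimately have "\<sigma> j \<bullet> x = (LINT s:{0..t}|lborel. q s * (j \<bullet> obs s x))"
      by (simp add: set_borel_integral_eq_integral integral_unique)
    also have "\<bar>\<dots>\<bar> \<le> (LINT s:{0..t}|lborel. (C j / t) * norm (obs s x))"
      unfolding set_lebesgue_integral_def
    proof (rule order_trans[OF integral_abs_bound integral_mono])
      have "integrable lborel (\<lambda>s. indicator {0..t} s *\<^sub>R (q s * (j \<bullet> obs s x)))"
        unfolding set_integrable_def[symmetric]
        using q(1) by (intro borel_integrable_atLeastAtMost' continuous_intros)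
      then show "integrable lborel (\<lambda>s. \<bar>indicator {0..t} s *\<^sub>R (q s * (j \<bullet> obs s x))\<bar>)"
        by (rule integrable_abs)
      show "integrable lborel (\<lambda>s. indicator {0..t} s *\<^sub>R (C j / t * norm (obs s x)))"
        unfolding set_integrable_def[symmetric]
        by (intro borel_integrable_atLeastAtMost' continuous_intros)
      fix s
      have "\<bar>q s * (j \<bullet> obs s x)\<bar> \<le> C j / t * norm (obs s x)" if "s \<in> {0..t}"
        unfolding abs_mult using q(2)[OF that] Cauchy_Schwarz_ineq2[of j "obs s x"] j C0[of j] t0
        by (intro mult_mono) auto
      then show "\<bar>indicator {0..t} s *\<^sub>R (q s * (j \<bullet> obs s x))\<bar> \<le> indicator {0..t} s *\<^sub>R (C j / t * norm (obs s x))"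
        by (auto simp: indicator_def)
    qed
    also have "\<dots> = (C j / t) * (LINT s:{0..t}|lborel. norm (obs s x))" by (rule set_integral_mult_right)
    also have "\<dots> \<le> (C j / t) * (sqrt t * norm (sqrt_covar t x))"
      using C0[of j] t0 by (intro mult_left_mono integral_norm_obs_le) auto
    also have "\<dots> = C j * (sqrt t / t) * norm (sqrt_covar t x)" by simp
    also have "sqrt t / t = t powr (-1/2)"
      using t0 by (simp add: powr_minus powr_half_sqrt field_simps)
    finally show ?thesis .
  qed
  show ?thesis
  proof (rule that)
    show "0 \<le> (\<Sum>j\<in>Basis. C j)" by (intro sum_nonneg C0)
    fix t x y assume t: "t \<in> {0<..T}"
    let ?R = "t powr (-1/2) * norm (sqrt_covar t x)"
    have "\<sigma> y \<bullet> x = (\<Sum>j\<in>Basis. (y \<bullet> j) * (\<sigma> j \<bullet> x))"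
      by (subst euclidean_representation[symmetric, of y])
         (simp add: linear_sum[OF linear_blinfun] linear_cmul[OF linear_blinfun] inner_sum_left del: euclidean_representation)
    also have "\<bar>\<dots>\<bar> \<le> (\<Sum>j\<in>Basis. norm y * (C j * ?R))"
      using basis[OF _ t, of _ x]
      by (intro order_trans[OF sum_abs] sum_mono) (auto simp: abs_mult mult.assoc intro!: mult_mono Basis_le_norm)
    also have "\<dots> = (\<Sum>j\<in>Basis. C j) * t powr (-1/2) * norm y * norm (sqrt_covar t x)"
      by (simp add: sum_distrib_left sum_distrib_right mult_ac)
    finally show "\<bar>\<sigma> y \<bullet> x\<bar> \<le> (\<Sum>j\<in>Basis. C j) * t powr (-1/2) * norm y * norm (sqrt_covar t x)" .
  qed
qed

text \<open>A linear right inverse of \<sigma> on its range is bounded in finite dimension, which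
  gives one constant for all \<open>v\<close>.\<close>

lemma preimage_bound:
  obtains M where "0 \<le> M" "\<And>v. v \<in> range \<sigma> \<Longrightarrow> \<exists>y. \<sigma> y = v \<and> norm y \<le> M * norm v"
proof -
  obtain g where g: "linear g" "\<And>v. v \<in> range \<sigma> \<Longrightarrow> \<sigma> (g v) = v"
    using linear_exists_right_inverse_on[OF linear_blinfun[of \<sigma>] subspace_UNIV] by auto
  obtain M where "0 < M" "\<And>v. norm (g v) \<le> M * norm v"
    using linear_bounded_pos[OF g(1)] by auto
  then show ?thesis using g(2) that[of M] by (meson less_imp_le)
qed

text \<open>The integral superposes vectors \<open>g s\<close> of Im \<sigma>, each transported for
  the remaining time t + s. Pairing with \<open>x\<close> turns this into a preimage of
  \<open>g s\<close> against the observation of \<open>x\<close>; the preimages are bounded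
  pointwise under the integral. Keeping the observation factor on all of [-t,0] makes it the full
  Gramian norm, also when t > d.\<close>

lemma distributed_cost:
  fixes g :: "real \<Rightarrow> 'n"
  assumes t: "0 < t" and M: "0 \<le> M" "\<And>v. v \<in> range \<sigma> \<Longrightarrow> \<exists>y. \<sigma> y = v \<and> norm y \<le> M * norm v"
    and [measurable]: "g \<in> borel_measurable borel"
    and g2: "set_integrable lborel {-d..0} (\<lambda>s. (norm (g s))\<^sup>2)"
    and range: "AE s in lborel. s \<in> {-d..0} \<longrightarrow> g s \<in> range \<sigma>"
    and int: "set_integrable lborel {-d..0} (\<lambda>s. delay_kernel a0 t s (g s))"
  shows "\<bar>(LINT s:{-d..0}|lborel. delay_kernel a0 t s (g s)) \<bullet> x\<bar>
    \<le> M * sqrt (LINT s:{-d..0}|lborel. (norm (g s))\<^sup>2) * norm (sqrt_covar t x)"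
proof -
  have cont: "continuous_on UNIV (\<lambda>s. obs (t + s) x)" by (intro continuous_intros)
  then have [measurable]: "(\<lambda>s. obs (t + s) x) \<in> borel_measurable borel"
    by (rule borel_measurable_continuous_onI)
  let ?F = "\<lambda>s. indicator {-d..0} s *\<^sub>R delay_kernel a0 t s (g s)"
  let ?f = "\<lambda>s. indicator {-d..0} s * norm (g s)" and ?h = "\<lambda>s. indicator {-t..0} s * norm (obs (t + s) x)"
  have sq: "(\<lambda>s. (?f s)\<^sup>2) = (\<lambda>s. indicator {-d..0} s *\<^sub>R (norm (g s))\<^sup>2)"
     "(\<lambda>s. (?h s)\<^sup>2) = (\<lambda>s. indicator {-t..0} s *\<^sub>R (norm (obs (t + s) x))\<^sup>2)"
    by (auto simp: indicator_def fun_eq_iff)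
  have h2: "set_integrable lborel {-t..0} (\<lambda>s. (norm (obs (t + s) x))\<^sup>2)"
    by (intro borel_integrable_atLeastAtMost' continuous_intros)
  have f2: "integrable lborel (\<lambda>s. (?f s)\<^sup>2)" and h2': "integrable lborel (\<lambda>s. (?h s)\<^sup>2)"
    using g2 h2 by (simp_all only: sq set_integrable_def)
  have CS: "integrable lborel (\<lambda>s. ?f s * ?h s)"
    "\<bar>LINT s|lborel. ?f s * ?h s\<bar> \<le> sqrt (LINT s|lborel. (?f s)\<^sup>2) * sqrt (LINT s|lborel. (?h s)\<^sup>2)"
    by (rule Cauchy_Schwarz_integral[OF _ _ f2 h2']; measurable)+
  have Fx: "integrable lborel (\<lambda>s. ?F s \<bullet> x)"
    using int unfolding set_integrable_def by (intro integrable_inner_left)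
  have "(LINT s:{-d..0}|lborel. delay_kernel a0 t s (g s)) \<bullet> x
      = (LINT s|lborel. ?F s \<bullet> x)"
    using int unfolding set_lebesgue_integral_def set_integrable_def by (intro integral_inner_left[symmetric]) auto
  also have "\<bar>\<dots>\<bar> \<le> (LINT s|lborel. \<bar>?F s \<bullet> x\<bar>)" by (rule integral_abs_bound)
  also have "\<dots> \<le> (LINT s|lborel. M * (?f s * ?h s))"
  proof (rule integral_mono_AE)
    show "integrable lborel (\<lambda>s. \<bar>?F s \<bullet> x\<bar>)" using Fx by (rule integrable_abs)
    show "integrable lborel (\<lambda>s. M * (?f s * ?h s))" using CS(1) by simp
    show "AE s in lborel. \<bar>?F s \<bullet> x\<bar> \<le> M * (?f s * ?h s)"
      using range
    proof eventually_elim
      case (elim s)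
      show ?case
      proof (cases "s \<in> {-d..0} \<and> s \<in> {-t..0}")
        case True
        with elim M(2) obtain y where y: "\<sigma> y = g s" "norm y \<le> M * norm (g s)" by blast
        have "\<bar>exp_op ((t + s) *\<^sub>R a0) (g s) \<bullet> x\<bar> = \<bar>y \<bullet> obs (t + s) x\<bar>"
          by (simp add: y(1)[symmetric] obs_adjoint)
        also have "\<dots> \<le> norm y * norm (obs (t + s) x)" by (rule Cauchy_Schwarz_ineq2)
        also have "\<dots> \<le> M * norm (g s) * norm (obs (t + s) x)" using y(2) by (intro mult_right_mono) auto
        finally show ?thesis using True by (simp add: mult.assoc)
      qed (use M(1) in \<open>auto simp: indicator_def\<close>)
    qed
  qed
  also have "\<dots> = M * (LINT s|lborel. ?f s * ?h s)" by simp
  also have "\<dots> \<le> M * (sqrt (LINT s|lborel. (?f s)\<^sup>2) * sqrt (LINT s|lborel. (?h s)\<^sup>2))"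
    using CS(2) M(1) by (intro mult_left_mono) auto
  also have "(LINT s|lborel. (?h s)\<^sup>2) = (norm (sqrt_covar t x))\<^sup>2"
  proof -
    have "(LINT s|lborel. (?h s)\<^sup>2) = (LINT s|lborel. indicator {-t..0} (-t + 1 * s) *\<^sub>R (norm (obs (t + (-t + 1 * s)) x))\<^sup>2)"
      unfolding sq by (subst lborel_integral_real_affine[where c=1 and t="-t"]) auto
    also have "\<dots> = (LINT s:{0..t}|lborel. (norm (obs s x))\<^sup>2)"
      unfolding set_lebesgue_integral_def by (intro Bochner_Integration.integral_cong) (auto simp: indicator_def)
    finally show ?thesis by (simp add: norm_psd_sqrt_covar0)
  qed
  also have "(LINT s|lborel. (?f s)\<^sup>2) = (LINT s:{-d..0}|lborel. (norm (g s))\<^sup>2)"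
    unfolding sq set_lebesgue_integral_def ..
  finally show ?thesis by (simp add: mult.assoc)
qed

end

section \<open>Signed measures\<close>

lemma vector_measure_sums:
  fixes A :: "nat \<Rightarrow> real set"
  assumes "vector_measure S \<nu>" "\<And>i. A i \<in> sets borel" "\<And>i. A i \<subseteq> S" "disjoint_family A"
  shows "(\<lambda>i. \<nu> (A i)) sums \<nu> (\<Union>i. A i)"
  using assms unfolding vector_measure_def by meson

lemma vector_measure_Un:
  assumes \<nu>: "vector_measure S \<nu>" and "A \<in> sets borel" "B \<in> sets borel" "A \<subseteq> S" "B \<subseteq> S" "A \<inter> B = {}"
  shows "\<nu> (A \<union> B) = \<nu> A + \<nu> B"
proof -
  have 0: "\<nu> {} = 0" using \<nu> by (simp add: vector_measure_def)
  have "(\<lambda>i. \<nu> (binaryset A B i)) sums \<nu> (\<Union>i. binaryset A B i)"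
  proof (rule vector_measure_sums[OF \<nu>])
    show "binaryset A B i \<in> sets borel" "binaryset A B i \<subseteq> S" for i
      using assms by (auto simp: binaryset_def)
    show "disjoint_family (binaryset A B)"
      using assms(6) by (auto simp: binaryset_def disjoint_family_on_def)
  qed
  then have "(\<lambda>i. \<nu> (binaryset A B i)) sums \<nu> (A \<union> B)" by (simp add: UN_binaryset_eq)
  moreover have "(\<lambda>i. \<nu> (binaryset A B i)) sums (\<nu> A + \<nu> B)" by (rule binaryset_sums) (rule 0)
  ultimately show ?thesis by (rule sums_unique2)
qed

lemma vector_measure_bounded_linear:
  assumes "vector_measure S \<nu>" "bounded_linear f"
  shows "vector_measure S (\<lambda>E. f (\<nu> E))"
proof -
  have "f (\<nu> {}) = 0" using assms by (simp add: vector_measure_def linear_simps)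
  moreover have "(\<lambda>i. f (\<nu> (A i))) sums f (\<nu> (\<Union>i. A i))"
    if "\<And>i. A i \<in> sets borel \<and> A i \<subseteq> S" "disjoint_family A" for A :: "nat \<Rightarrow> real set"
    using that by (intro bounded_linear.sums[OF assms(2)] vector_measure_sums[OF assms(1)]) auto
  ultimately show ?thesis unfolding vector_measure_def by blast
qed

section \<open>Jordan decomposition of a signed measure\<close>

context
  fixes S :: "real set" and \<nu> :: "real set \<Rightarrow> real"
  assumes S: "S \<in> sets borel" and \<nu>: "vector_measure S \<nu>"
begin

lemma signed_measure_diff:
  assumes "F \<in> sets borel" "E \<in> sets borel" "F \<subseteq> E" "E \<subseteq> S"
  shows "\<nu> (E - F) = \<nu> E - \<nu> F"
proof -
  have "\<nu> (F \<union> (E - F)) = \<nu> F + \<nu> (E - F)"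
    using assms by (intro vector_measure_Un[OF \<nu>]) auto
  moreover have "F \<union> (E - F) = E" using assms by auto
  ultimately show ?thesis by simp
qed

text \<open>If \<open>\<bar>\<nu>\<bar>\<close> is unbounded on the subsets of \<open>E\<close>, split \<open>E\<close> into \<open>F\<close> and \<open>E - F\<close> with both
  \<open>\<bar>\<nu> F\<bar>\<close> and \<open>\<bar>\<nu> (E - F)\<bar>\<close> at least 1 and continue with a piece on which it is still unbounded: the
  pieces that are split off are disjoint, and their measures are not summable.\<close>
lemma signed_measure_bounded:
  obtains K where "\<And>F. F \<in> sets borel \<Longrightarrow> F \<subseteq> S \<Longrightarrow> \<bar>\<nu> F\<bar> \<le> K"
proof (rule ccontr)
  assume *: "\<not> thesis"
  define U where "U E \<longleftrightarrow> E \<in> sets borel \<and> E \<subseteq> S \<and> (\<forall>K. \<exists>F\<in>sets borel. F \<subseteq> E \<and> K < \<bar>\<nu> F\<bar>)" for E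
  have "U S" unfolding U_def using * S that by (meson not_le order_refl)
  have "\<exists>A\<in>sets borel. A \<subseteq> E \<and> 1 \<le> \<bar>\<nu> A\<bar> \<and> U (E - A)" if E: "U E" for E
  proof -
    from E obtain F where F: "F \<in> sets borel" "F \<subseteq> E" "\<bar>\<nu> E\<bar> + 1 < \<bar>\<nu> F\<bar>" unfolding U_def by blast
    have Eb: "E \<in> sets borel" "E \<subseteq> S" using E by (auto simp: U_def)
    have diff: "\<nu> (E - F) = \<nu> E - \<nu> F" using F Eb by (intro signed_measure_diff) auto
    have ge: "1 \<le> \<bar>\<nu> F\<bar>" "1 \<le> \<bar>\<nu> (E - F)\<bar>" using F(3) unfolding diff by linarith+
    show ?thesis
    proof (cases "U F")
      case True
      then have "U (E - (E - F))" using F(2) by (simp add: double_diff)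
      then show ?thesis using F Eb ge by (intro bexI[of _ "E - F"]) auto
    next
      case False
      then obtain K where K: "\<And>G. G \<in> sets borel \<Longrightarrow> G \<subseteq> F \<Longrightarrow> \<bar>\<nu> G\<bar> \<le> K"
        using F Eb unfolding U_def by (meson not_le order_trans)
      have "\<exists>G\<in>sets borel. G \<subseteq> E - F \<and> L < \<bar>\<nu> G\<bar>" for L
      proof -
        obtain G where G: "G \<in> sets borel" "G \<subseteq> E" "K + L < \<bar>\<nu> G\<bar>" using E unfolding U_def by blast
        have "\<nu> G = \<nu> (G \<inter> F) + \<nu> (G - F)"
          using vector_measure_Un[OF \<nu>, of "G \<inter> F" "G - F"] G F Eb by (auto simp: Int_Diff_Un)
        moreover have "\<bar>\<nu> (G \<inter> F)\<bar> \<le> K" using G F by (intro K) auto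
        ultimately have "L < \<bar>\<nu> (G - F)\<bar>" using G(3) by linarith
        then show ?thesis using G F by (intro bexI[of _ "G - F"]) auto
      qed
      then have "U (E - F)" using Eb F unfolding U_def by auto
      then show ?thesis using F ge by blast
    qed
  qed
  then obtain A where A: "\<And>E. U E \<Longrightarrow> A E \<in> sets borel \<and> A E \<subseteq> E \<and> 1 \<le> \<bar>\<nu> (A E)\<bar> \<and> U (E - A E)"
    by metis
  define D where "D = rec_nat S (\<lambda>_ E. E - A E)"
  have D: "D 0 = S" "D (Suc n) = D n - A (D n)" for n by (simp_all add: D_def)
  have UD: "U (D n)" for n by (induction n) (use \<open>U S\<close> A D in auto)
  have dec: "decseq D" by (rule decseq_SucI) (auto simp: D)
  have "disjoint_family (\<lambda>n. A (D n))"
  proof -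
    have "A (D m) \<inter> A (D n) = {}" if "m < n" for m n
    proof -
      have "A (D n) \<subseteq> D (Suc m)" using A[OF UD[of n]] decseqD[OF dec, of "Suc m" n] that by auto
      then show ?thesis by (auto simp: D)
    qed
    then show ?thesis unfolding disjoint_family_on_def by (metis Int_commute nat_neq_iff)
  qed
  moreover have "A (D n) \<in> sets borel \<and> A (D n) \<subseteq> S" for n
    using A[OF UD[of n]] UD[of n] unfolding U_def by blast
  ultimately have "(\<lambda>n. \<nu> (A (D n))) sums \<nu> (\<Union>n. A (D n))"
    by (intro vector_measure_sums[OF \<nu>]) auto
  then have "(\<lambda>n. \<bar>\<nu> (A (D n))\<bar>) \<longlonglongrightarrow> 0"
    using summable_LIMSEQ_zero sums_summable tendsto_rabs_zero by blast
  then have "(1::real) \<le> 0"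
    by (rule LIMSEQ_le_const) (use A[OF UD] in auto)
  then show False by simp
qed

text \<open>The set function inside \<open>pos_variation\<close>, kept separate because
  \<open>measure_of\<close> yields a measure with these values only after countable additivity is
  known.\<close>

definition upper_variation :: "real set \<Rightarrow> ennreal" where
  "upper_variation E = (SUP F\<in>{F \<in> sets borel. F \<subseteq> E}. ennreal (\<nu> F))"

lemma upper_variation_finite: "E \<subseteq> S \<Longrightarrow> upper_variation E < \<top>"
proof -
  assume E: "E \<subseteq> S"
  obtain K where K: "\<And>F. F \<in> sets borel \<Longrightarrow> F \<subseteq> S \<Longrightarrow> \<bar>\<nu> F\<bar> \<le> K" by (rule signed_measure_bounded) blast
  have "upper_variation E \<le> ennreal K"
    unfolding upper_variation_def
  proof (rule SUP_least)
    fix F assume "F \<in> {F \<in> sets borel. F \<subseteq> E}"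
    then have "\<bar>\<nu> F\<bar> \<le> K" using E by (intro K) auto
    then show "ennreal (\<nu> F) \<le> ennreal K" by (intro ennreal_leI) auto
  qed
  then show ?thesis by (simp add: order_le_less_trans)
qed

lemma upper_variation_upper:
  assumes "F \<in> sets borel" "F \<subseteq> E" "E \<subseteq> S"
  shows "\<nu> F \<le> enn2real (upper_variation E)"
proof -
  have "ennreal (\<nu> F) \<le> upper_variation E"
    unfolding upper_variation_def using assms by (intro SUP_upper) auto
  also have "\<dots> = ennreal (enn2real (upper_variation E))"
    using upper_variation_finite[OF assms(3)] by simp
  finally show ?thesis by (simp add: ennreal_le_iff2) (auto intro: order_trans)
qed

lemma upper_variation_least:
  assumes "\<And>F. F \<in> sets borel \<Longrightarrow> F \<subseteq> E \<Longrightarrow> \<nu> F \<le> c"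
  shows "enn2real (upper_variation E) \<le> c"
proof -
  have le: "upper_variation E \<le> ennreal c"
    unfolding upper_variation_def using assms by (intro SUP_least ennreal_leI) auto
  have "0 \<le> c" using assms[of "{}"] \<nu> by (simp add: vector_measure_def)
  then show "enn2real (upper_variation E) \<le> c" using enn2real_mono[OF le] by simp
qed

text \<open>Competitors inside disjoint sets unite to a competitor inside the union. The two suprema
  are taken one after the other in the reals, where finiteness permits subtraction.\<close>

lemma upper_variation_superadditive:
  assumes E: "E \<in> sets borel" "E \<subseteq> S" and E': "E' \<in> sets borel" "E' \<subseteq> S" and disj: "E \<inter> E' = {}"
  shows "upper_variation E + upper_variation E' \<le> upper_variation (E \<union> E')"
proof -
  let ?p = "\<lambda>E. enn2real (upper_variation E)"
  have "\<nu> F + \<nu> F' \<le> ?p (E \<union> E')" if F: "F \<in> sets borel" "F \<subseteq> E" "F' \<in> sets borel" "F' \<subseteq> E'" for F F'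
  proof -
    have "\<nu> F + \<nu> F' = \<nu> (F \<union> F')"
      using F E E' disj by (intro vector_measure_Un[OF \<nu>, symmetric]) auto
    also have "\<dots> \<le> ?p (E \<union> E')" using F E E' by (intro upper_variation_upper) auto
    finally show ?thesis .
  qed
  then have "?p E \<le> ?p (E \<union> E') - \<nu> F'" if "F' \<in> sets borel" "F' \<subseteq> E'" for F'
    using that by (intro upper_variation_least) (simp add: le_diff_eq)
  then have "?p E' \<le> ?p (E \<union> E') - ?p E"
    by (intro upper_variation_least) (simp add: le_diff_eq add.commute)
  then have "ennreal (?p E + ?p E') \<le> ennreal (?p (E \<union> E'))" by (intro ennreal_leI) simp
  then show ?thesis
    using upper_variation_finite[of E] upper_variation_finite[of E'] upper_variation_finite[of "E \<union> E'"] E E'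
    by simp
qed

text \<open>Equality fails in general because \<open>ennreal\<close> truncates negative summands to
  0.\<close>

lemma ennreal_sum_le: "ennreal (\<Sum>i\<in>I. f i) \<le> (\<Sum>i\<in>I. ennreal (f i))"
proof (induction I rule: infinite_finite_induct)
  case (insert x I)
  have "ennreal (f x + sum f I) \<le> ennreal (max 0 (f x) + max 0 (sum f I))" by (intro ennreal_leI) auto
  also have "\<dots> = ennreal (f x) + ennreal (sum f I)" by (simp add: ennreal_max_0)
  finally show ?case using insert by (simp add: add_left_mono order_trans)
qed auto

text \<open>One inequality is the limit of finite superadditivity. For the other, a competitor for
  the union is cut along the sets \<open>A i\<close>, and countable additivity of \<nu> reassembles
  it.\<close>

lemma upper_variation_countably_additive:
  "countably_additive (sets (restrict_space borel S)) upper_variation"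
  unfolding countably_additive_def
proof (intro allI impI)
  fix A :: "nat \<Rightarrow> real set"
  assume r: "range A \<subseteq> sets (restrict_space borel S)" and disj: "disjoint_family A"
  have "A i \<in> sets (restrict_space borel S)" for i using r by auto
  then have A: "A i \<in> sets borel" "A i \<subseteq> S" for i
    using S by (simp_all add: sets_restrict_space_iff)
  show "(\<Sum>i. upper_variation (A i)) = upper_variation (\<Union>i. A i)"
  proof (rule antisym)
    have "(\<Sum>i<n. upper_variation (A i)) \<le> upper_variation (\<Union>i<n. A i)" for n
    proof (induction n)
      case (Suc n)
      have d: "(\<Union>i<n. A i) \<inter> A n = {}"
      proof -
        have "A i \<inter> A n = {}" if "i < n" for i using disjoint_family_onD[OF disj, of i n] that by simp
        then show ?thesis by blast
      qed
      have "(\<Sum>i<Suc n. upper_variation (A i)) \<le> upper_variation (\<Union>i<n. A i) + upper_variation (A n)"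
        using Suc by (simp add: add_right_mono)
      also have "\<dots> \<le> upper_variation ((\<Union>i<n. A i) \<union> A n)"
        using A d by (intro upper_variation_superadditive) auto
      finally show ?case by (simp add: lessThan_Suc Un_commute)
    qed simp
    moreover have "upper_variation (\<Union>i<n. A i) \<le> upper_variation (\<Union>i. A i)" for n
      unfolding upper_variation_def by (intro SUP_subset_mono) auto
    ultimately show "(\<Sum>i. upper_variation (A i)) \<le> upper_variation (\<Union>i. A i)"
      by (intro suminf_le_const summableI) (meson order_trans)
    show "upper_variation (\<Union>i. A i) \<le> (\<Sum>i. upper_variation (A i))"
      unfolding upper_variation_def[of "\<Union>i. A i"]
    proof (rule SUP_least)
      fix F assume F: "F \<in> {F \<in> sets borel. F \<subseteq> (\<Union>i. A i)}"
      have "(\<lambda>i. \<nu> (F \<inter> A i)) sums \<nu> (\<Union>i. F \<inter> A i)"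
      proof (rule vector_measure_sums[OF \<nu>])
        show "disjoint_family (\<lambda>i. F \<inter> A i)"
          unfolding disjoint_family_on_def using disjoint_family_onD[OF disj] by blast
      qed (use A F in auto)
      also have "(\<Union>i. F \<inter> A i) = F" using F by auto
      finally have "(\<lambda>n. ennreal (\<Sum>i<n. \<nu> (F \<inter> A i))) \<longlonglongrightarrow> ennreal (\<nu> F)"
        unfolding sums_def by (rule tendsto_ennrealI)
      moreover have "ennreal (\<Sum>i<n. \<nu> (F \<inter> A i)) \<le> (\<Sum>i. upper_variation (A i))" for n
      proof -
        have "ennreal (\<Sum>i<n. \<nu> (F \<inter> A i)) \<le> (\<Sum>i<n. ennreal (\<nu> (F \<inter> A i)))" by (rule ennreal_sum_le)
        also have "\<dots> \<le> (\<Sum>i<n. upper_variation (A i))"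
          unfolding upper_variation_def using A F by (intro sum_mono SUP_upper) auto
        also have "\<dots> \<le> (\<Sum>i. upper_variation (A i))" by (intro sum_le_suminf summableI) auto
        finally show ?thesis .
      qed
      ultimately show "ennreal (\<nu> F) \<le> (\<Sum>i. upper_variation (A i))" by (intro LIMSEQ_le_const2) auto
    qed
  qed
qed

lemma pos_variation:
  shows "sets (pos_variation S \<nu>) = sets (restrict_space borel S)" "space (pos_variation S \<nu>) = S"
    and emeasure_pos_variation: "E \<in> sets borel \<Longrightarrow> E \<subseteq> S \<Longrightarrow> emeasure (pos_variation S \<nu>) E = upper_variation E"
    and finite_measure_pos_variation: "finite_measure (pos_variation S \<nu>)"
proof -
  have sub: "sets (restrict_space borel S) \<subseteq> Pow S"
    using S by (auto simp: sets_restrict_space)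
  have "sigma_algebra (space (restrict_space borel S)) (sets (restrict_space borel S))" by (rule sets.sigma_algebra_axioms)
  then have sig: "sigma_algebra S (sets (restrict_space borel S))" by (simp add: space_restrict_space)
  have pv: "pos_variation S \<nu> = measure_of S (sets (restrict_space borel S)) upper_variation"
    unfolding pos_variation_def upper_variation_def ..
  show s: "sets (pos_variation S \<nu>) = sets (restrict_space borel S)"
    unfolding pv using sig sub by (simp add: sigma_algebra.sigma_sets_eq)
  show sp: "space (pos_variation S \<nu>) = S" unfolding pv using sub by (simp add: space_measure_of)
  have pos: "positive (sets (restrict_space borel S)) upper_variation"
    using \<nu> by (simp add: positive_def upper_variation_def vector_measure_def)
  show e: "emeasure (pos_variation S \<nu>) E = upper_variation E" if "E \<in> sets borel" "E \<subseteq> S" for E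
  proof (rule emeasure_measure_of[OF pv])
    show "sets (restrict_space borel S) \<subseteq> Pow S" by (rule sub)
    show "E \<in> sets (pos_variation S \<nu>)" using that S by (simp add: s sets_restrict_space_iff)
  qed (unfold s, fact pos, fact upper_variation_countably_additive)
  show "finite_measure (pos_variation S \<nu>)"
    using e[OF S] upper_variation_finite[of S] by (intro finite_measureI) (simp add: sp)
qed

lemma measure_pos_variation: "E \<in> sets borel \<Longrightarrow> E \<subseteq> S \<Longrightarrow> measure (pos_variation S \<nu>) E = enn2real (upper_variation E)"
  by (simp add: measure_def emeasure_pos_variation)

end

lemma vector_measure_uminus: "vector_measure S \<nu> \<Longrightarrow> vector_measure S (\<lambda>E. - \<nu> E)"
  by (rule vector_measure_bounded_linear[of S \<nu> uminus]) (auto intro: bounded_linear_minus bounded_linear_ident)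

text \<open>For F inside E, \<nu> F = \<nu> E - \<nu> (E - F) is at most \<nu> E plus the negative
  variation of E. The supremum over F gives one inequality; exchanging \<nu> and -\<nu> gives the
  other.\<close>

lemma Jordan_decomposition:
  assumes S: "S \<in> sets borel" and \<nu>: "vector_measure S \<nu>" and E: "E \<in> sets borel" "E \<subseteq> S"
  shows "\<nu> E = measure (pos_variation S \<nu>) E - measure (pos_variation S (\<lambda>E. - \<nu> E)) E"
proof -
  note \<nu>' = vector_measure_uminus[OF \<nu>]
  let ?p = "enn2real (upper_variation \<nu> E)" and ?n = "enn2real (upper_variation (\<lambda>E. - \<nu> E) E)"
  have "?p \<le> \<nu> E + ?n"
  proof (rule upper_variation_least[OF S \<nu>])
    fix F assume F: "F \<in> sets borel" "F \<subseteq> E"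
    have "- \<nu> (E - F) \<le> ?n" using F E by (intro upper_variation_upper[OF S \<nu>']) auto
    then show "\<nu> F \<le> \<nu> E + ?n" using signed_measure_diff[OF S \<nu> F(1) E(1) F(2) E(2)] by simp
  qed
  moreover have "?n \<le> - \<nu> E + ?p"
  proof (rule upper_variation_least[OF S \<nu>'])
    fix F assume F: "F \<in> sets borel" "F \<subseteq> E"
    have "\<nu> (E - F) \<le> ?p" using F E by (intro upper_variation_upper[OF S \<nu>]) auto
    then show "- \<nu> F \<le> - \<nu> E + ?p" using signed_measure_diff[OF S \<nu> F(1) E(1) F(2) E(2)] by simp
  qed
  ultimately show ?thesis
    using E by (simp add: measure_pos_variation[OF S \<nu>] measure_pos_variation[OF S \<nu>'])
qed

text \<open>The simple functions are chosen independently of the measure, so that identities between finite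
  measures pass to integrals of bounded functions.\<close>
lemma bounded_measurable_simple_approx:
  fixes f :: "'a \<Rightarrow> 'b::euclidean_space"
  assumes f: "f \<in> borel_measurable N" and K: "\<And>x. x \<in> space N \<Longrightarrow> norm (f x) \<le> K"
  obtains Y A where "\<And>n. finite (Y n)" "\<And>n y. A n y \<in> sets N"
    "\<And>M. finite_measure M \<Longrightarrow> sets M = sets N \<Longrightarrow>
      (\<lambda>n :: nat. \<Sum>y\<in>Y n. measure M (A n y) *\<^sub>R y) \<longlonglongrightarrow> (LINT x|M. f x)"
proof -
  obtain s where s: "\<And>i. simple_function N (s i)" "\<And>x. x \<in> space N \<Longrightarrow> (\<lambda>i. s i x) \<longlonglongrightarrow> f x"
    "\<And>i x. x \<in> space N \<Longrightarrow> dist (s i x) 0 \<le> 2 * dist (f x) 0"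
    using borel_measurable_implies_sequence_metric[OF f, of 0] by blast
  define Y where "Y n = s n ` space N" for n
  define A where "A n y = s n -` {y} \<inter> space N" for n y
  have Y: "finite (Y n)" and A: "A n y \<in> sets N" for n y
    unfolding Y_def A_def using simple_functionD[OF s(1)] by auto
  have lim: "(\<lambda>n. \<Sum>y\<in>Y n. measure M (A n y) *\<^sub>R y) \<longlonglongrightarrow> (LINT x|M. f x)"
    if M: "finite_measure M" "sets M = sets N" for M
  proof -
    interpret finite_measure M by fact
    have sp: "space M = space N" by (rule sets_eq_imp_space_eq[OF M(2)])
    have "(LINT x|M. s n x) = (\<Sum>y\<in>Y n. measure M (A n y) *\<^sub>R y)" for n
    proof -
      have "(LINT x|M. s n x) = (LINT x|M. (\<Sum>y\<in>Y n. indicator (A n y) x *\<^sub>R y))"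
      proof (rule Bochner_Integration.integral_cong[OF refl])
        fix x assume x: "x \<in> space M"
        have "(\<Sum>y\<in>Y n. indicator (A n y) x *\<^sub>R y) = (\<Sum>y\<in>Y n. if y = s n x then y else 0)"
          using x by (intro sum.cong) (auto simp: A_def indicator_def sp)
        then show "s n x = (\<Sum>y\<in>Y n. indicator (A n y) x *\<^sub>R y)"
          using x Y[of n] by (simp add: Y_def sp)
      qed
      also have "\<dots> = (\<Sum>y\<in>Y n. measure M (A n y) *\<^sub>R y)"
      proof -
        have AM: "A n y \<in> sets M" for y using A M(2) by simp
        then have "integrable M (indicator (A n y) :: _ \<Rightarrow> real)" "A n y \<inter> space M = A n y" for y
          using sets.sets_into_space[OF AM] by (auto simp: less_top[symmetric] intro!: integrable_real_indicator)
        then show ?thesis by (subst Bochner_Integration.integral_sum) simp_all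
      qed
      finally show ?thesis .
    qed
    moreover have "(\<lambda>n. LINT x|M. s n x) \<longlonglongrightarrow> (LINT x|M. f x)"
    proof (rule integral_dominated_convergence[where w="\<lambda>_. 2 * K"])
      show "f \<in> borel_measurable M" using f by (simp add: measurable_cong_sets[OF M(2) refl])
      show "s i \<in> borel_measurable M" for i
        using borel_measurable_simple_function[OF s(1)] by (simp add: measurable_cong_sets[OF M(2) refl])
      show "AE x in M. (\<lambda>i. s i x) \<longlonglongrightarrow> f x" using s(2) by (intro AE_I2) (simp add: sp)
      show "AE x in M. norm (s i x) \<le> 2 * K" for i
      proof (rule AE_I2)
        fix x assume "x \<in> space M"
        then show "norm (s i x) \<le> 2 * K" using s(3)[of x i] K[of x] by (simp add: sp)
      qed
    qed simp
    ultimately show ?thesis by simp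
  qed
  from Y A lim show ?thesis by (rule that)
qed

text \<open>Only the combination of the measures has a density; the individual
  \<open>\<nu> i\<close> may be singular. The integrals are therefore compared through one sequence
  of simple functions, on which the combination can be formed before the limit is taken.\<close>

lemma signed_integral_combination:
  fixes f :: "real \<Rightarrow> 'b::euclidean_space" and \<nu> :: "'i \<Rightarrow> real set \<Rightarrow> real"
  assumes S: "S \<in> sets borel" and \<nu>: "\<And>i. i \<in> I \<Longrightarrow> vector_measure S (\<nu> i)"
    and h: "set_integrable lborel S h"
    and eq: "\<And>E. E \<in> sets borel \<Longrightarrow> E \<subseteq> S \<Longrightarrow> (\<Sum>i\<in>I. c i * \<nu> i E) = (LINT s:E|lborel. h s)"
    and f: "f \<in> borel_measurable (restrict_space borel S)" and K: "\<And>x. x \<in> S \<Longrightarrow> norm (f x) \<le> K"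
  shows "(\<Sum>i\<in>I. c i *\<^sub>R signed_integral S (\<nu> i) f) = (LINT s:S|lborel. h s *\<^sub>R f s)"
proof -
  let ?N = "restrict_space borel S" and ?L = "restrict_space lborel S"
  obtain Y A where Y: "\<And>n. finite (Y n)" and A: "\<And>n y. A n y \<in> sets ?N"
    and lim: "\<And>M. finite_measure M \<Longrightarrow> sets M = sets ?N \<Longrightarrow>
      (\<lambda>n :: nat. \<Sum>y\<in>Y n. measure M (A n y) *\<^sub>R y) \<longlonglongrightarrow> (LINT x|M. f x)"
    by (rule bounded_measurable_simple_approx[OF f, where K=K]) (use K in \<open>simp add: space_restrict_space\<close>, blast)
  have A': "A n y \<in> sets borel" "A n y \<subseteq> S" for n y
    using A[of n y] S by (simp_all add: sets_restrict_space_iff)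
  have SL: "S \<inter> space lborel \<in> sets lborel" using S by simp
  have setsL: "sets ?L = sets ?N" by (rule sets_restrict_space_cong) simp
  have "(\<lambda>n. \<Sum>y\<in>Y n. \<nu> i (A n y) *\<^sub>R y) \<longlonglongrightarrow> signed_integral S (\<nu> i) f" if i: "i \<in> I" for i
    unfolding signed_integral_def Jordan_decomposition[OF S \<nu>[OF i] A'] scaleR_diff_left sum_subtractf
    by (intro tendsto_diff lim pos_variation finite_measure_pos_variation S \<nu> vector_measure_uminus i)
  then have 1: "(\<lambda>n. \<Sum>i\<in>I. c i *\<^sub>R (\<Sum>y\<in>Y n. \<nu> i (A n y) *\<^sub>R y)) \<longlonglongrightarrow> (\<Sum>i\<in>I. c i *\<^sub>R signed_integral S (\<nu> i) f)"
    by (intro tendsto_intros)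
  have "(\<Sum>i\<in>I. c i *\<^sub>R (\<Sum>y\<in>Y n. \<nu> i (A n y) *\<^sub>R y)) = (\<Sum>y\<in>Y n. (LINT s:A n y|lborel. h s) *\<^sub>R y)" for n
    by (simp add: eq[OF A', symmetric] scaleR_sum_right scaleR_sum_left sum.swap[of _ I])
  with 1 have 1: "(\<lambda>n. \<Sum>y\<in>Y n. (LINT s:A n y|lborel. h s) *\<^sub>R y) \<longlonglongrightarrow> (\<Sum>i\<in>I. c i *\<^sub>R signed_integral S (\<nu> i) f)"
    by simp
  have dens: "(\<lambda>n. \<Sum>y\<in>Y n. (LINT s:A n y|lborel. g s) *\<^sub>R y) \<longlonglongrightarrow> (LINT s:S|lborel. g s *\<^sub>R f s)"
    "set_integrable lborel S (\<lambda>s. g s *\<^sub>R f s)"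
    if g: "set_integrable lborel S g" "\<And>s. 0 \<le> g s" for g :: "real \<Rightarrow> real"
  proof -
    have intg: "integrable ?L g" using g(1) by (simp add: integrable_restrict_space[OF SL] set_integrable_def)
    then have [measurable]: "g \<in> borel_measurable ?L" by simp
    have [measurable]: "f \<in> borel_measurable ?L" using f by (simp add: measurable_cong_sets[OF setsL refl])
    let ?M = "density ?L (\<lambda>s. ennreal (g s))"
    have fin: "finite_measure ?M"
    proof (rule finite_measureI)
      have "emeasure ?M (space ?M) = (\<integral>\<^sup>+s. ennreal (g s) \<partial>?L)"
        by (subst emeasure_density) (auto intro!: nn_integral_cong)
      also have "\<dots> = ennreal (LINT s|?L. g s)" using intg g(2) by (intro nn_integral_eq_integral) auto
      finally show "emeasure ?M (space ?M) \<noteq> \<infinity>" by simp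
    qed
    interpret finite_measure ?M by fact
    have setsM: "sets ?M = sets ?N" by (simp add: setsL)
    have sp: "space ?L = S" by (simp add: space_restrict_space)
    have meas: "measure ?M E = (LINT s:E|lborel. g s)" if E: "E \<in> sets borel" "E \<subseteq> S" for E
    proof -
      have EL: "E \<in> sets ?L" using E S by (simp add: sets_restrict_space_iff)
      then have "measure ?M E = (LINT s|?M. indicator E s)" using E by (simp add: sp Int_absorb2)
      also have "\<dots> = (LINT s|?L. g s *\<^sub>R indicator E s)"
        using g(2) EL by (intro integral_density) auto
      also have "\<dots> = (LINT s|lborel. indicator S s *\<^sub>R (g s *\<^sub>R indicator E s))"
        by (simp add: integral_restrict_space[OF SL] set_lebesgue_integral_def)
      also have "\<dots> = (LINT s:E|lborel. g s)"
        unfolding set_lebesgue_integral_def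
        using E(2) by (intro Bochner_Integration.integral_cong) (auto simp: indicator_def)
      finally show ?thesis .
    qed
    have "(LINT s|?M. f s) = (LINT s|?L. g s *\<^sub>R f s)" using g(2) by (intro integral_density) auto
    also have "\<dots> = (LINT s:S|lborel. g s *\<^sub>R f s)"
      by (simp add: integral_restrict_space[OF SL] set_lebesgue_integral_def)
    finally show "(\<lambda>n. \<Sum>y\<in>Y n. (LINT s:A n y|lborel. g s) *\<^sub>R y) \<longlonglongrightarrow> (LINT s:S|lborel. g s *\<^sub>R f s)"
      using lim[OF fin setsM] by (simp add: meas A')
    have "integrable ?M f"
      using K by (intro integrable_const_bound[where B=K] AE_I2) (auto simp: sp)
    then have "integrable ?L (\<lambda>s. g s *\<^sub>R f s)" using g(2) by (subst (asm) integrable_density) auto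
    then show "set_integrable lborel S (\<lambda>s. g s *\<^sub>R f s)"
      by (simp add: integrable_restrict_space[OF SL] set_integrable_def)
  qed
  \<comment> \<open>Positive and negative parts of the density define finite positive measures, to
    which the approximation applies.\<close>
  define hp hn where "hp s = max 0 (h s)" and "hn s = max 0 (- h s)" for s
  have h_eq: "h = (\<lambda>s. hp s - hn s)" by (auto simp: hp_def hn_def)
  have hpn: "set_integrable lborel S hp" "set_integrable lborel S hn"
  proof -
    have "integrable lborel (\<lambda>s. max 0 (indicator S s *\<^sub>R h s))" "integrable lborel (\<lambda>s. max 0 (- (indicator S s *\<^sub>R h s)))"
      using h unfolding set_integrable_def by (auto intro!: integrable_max)
    moreover have "(\<lambda>s. max 0 (indicator S s *\<^sub>R h s)) = (\<lambda>s. indicator S s *\<^sub>R hp s)"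
        "(\<lambda>s. max 0 (- (indicator S s *\<^sub>R h s))) = (\<lambda>s. indicator S s *\<^sub>R hn s)"
      by (auto simp: hp_def hn_def indicator_def fun_eq_iff)
    ultimately show "set_integrable lborel S hp" "set_integrable lborel S hn"
      unfolding set_integrable_def by simp_all
  qed
  have split: "(LINT s:E|lborel. h s) = (LINT s:E|lborel. hp s) - (LINT s:E|lborel. hn s)"
    if "E \<in> sets borel" "E \<subseteq> S" for E
    unfolding h_eq
    by (rule set_integral_diff(2); rule set_integrable_subset[of lborel S]) (use that hpn in auto)
  have "(\<lambda>n. \<Sum>y\<in>Y n. (LINT s:A n y|lborel. h s) *\<^sub>R y) \<longlonglongrightarrow>
      (LINT s:S|lborel. hp s *\<^sub>R f s) - (LINT s:S|lborel. hn s *\<^sub>R f s)"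
    unfolding split[OF A'] scaleR_diff_left sum_subtractf
    by (intro tendsto_diff dens hpn) (auto simp: hp_def hn_def)
  also have "(LINT s:S|lborel. hp s *\<^sub>R f s) - (LINT s:S|lborel. hn s *\<^sub>R f s) = (LINT s:S|lborel. h s *\<^sub>R f s)"
    unfolding h_eq scaleR_diff_left
    by (intro set_integral_diff(2)[symmetric] dens hpn) (auto simp: hp_def hn_def)
  finally show ?thesis by (rule LIMSEQ_unique[OF 1])
qed

section \<open>Gaussian measures\<close>

definition gauss_density :: "'n::euclidean_space \<Rightarrow> real" where
  "gauss_density x = (\<Prod>b\<in>Basis. std_normal_density (x \<bullet> b))"

definition std_gaussian :: "'n::euclidean_space measure" where
  "std_gaussian = density lborel (\<lambda>x. ennreal (gauss_density x))"

lemma gauss_density_nonneg: "0 \<le> gauss_density x"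
  by (simp add: gauss_density_def prod_nonneg)

lemma gauss_density_measurable [measurable]: "gauss_density \<in> borel_measurable borel"
  unfolding gauss_density_def by measurable

lemma norm_power2_Basis: "(norm x)\<^sup>2 = (\<Sum>b\<in>Basis. (x \<bullet> b)\<^sup>2)"
  by (subst power2_norm_eq_inner, subst euclidean_inner) (simp add: power2_eq_square)

text \<open>The normalizing constant is carried along as the density at 0, so that only the
  exponential is ever manipulated.\<close>

lemma gauss_density_eq:
  "gauss_density x = gauss_density (0 :: 'n) * exp (- (norm x)\<^sup>2 / 2)" for x :: "'n::euclidean_space"
proof -
  have "gauss_density x = (\<Prod>b\<in>(Basis :: 'n set). 1 / sqrt (2 * pi)) * (\<Prod>b\<in>Basis. exp (- (x \<bullet> b)\<^sup>2 / 2))"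
    by (simp only: gauss_density_def std_normal_density_def prod.distrib)
  also have "(\<Prod>b\<in>Basis. exp (- (x \<bullet> b)\<^sup>2 / 2)) = exp (- (norm x)\<^sup>2 / 2)"
    by (simp only: norm_power2_Basis exp_sum[OF finite_Basis, symmetric] sum_negf sum_divide_distrib[symmetric])
  finally show ?thesis by (simp add: gauss_density_def std_normal_density_def)
qed

lemma sets_std_gaussian [simp, measurable_cong]: "sets std_gaussian = sets borel"
  and space_std_gaussian [simp]: "space std_gaussian = UNIV"
  by (simp_all add: std_gaussian_def)

lemma integral_lborel_prod:
  fixes g :: "'n::euclidean_space \<Rightarrow> real \<Rightarrow> 'a::{real_normed_field, banach, second_countable_topology}"
  assumes "\<And>b. b \<in> Basis \<Longrightarrow> integrable lborel (g b)"
  shows "(LINT x|lborel. (\<Prod>b\<in>Basis. g b (x \<bullet> b))) = (\<Prod>b\<in>Basis. LINT u|lborel. g b u)"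
proof -
  interpret product_sigma_finite "\<lambda>_ :: 'n. lborel :: real measure" ..
  have [measurable]: "g b \<in> borel_measurable borel" if "b \<in> Basis" for b
    using borel_measurable_integrable[OF assms[OF that]] by simp
  have "(LINT x|lborel. (\<Prod>b\<in>Basis. g b (x \<bullet> b))) =
      (LINT f|(\<Pi>\<^sub>M b\<in>(Basis :: 'n set). lborel). (\<Prod>b\<in>Basis. g b ((\<Sum>b\<in>Basis. f b *\<^sub>R b) \<bullet> b)))"
    by (subst lborel_eq, subst integral_distr) auto
  also have "\<dots> = (LINT f|(\<Pi>\<^sub>M b\<in>(Basis :: 'n set). lborel). (\<Prod>b\<in>Basis. g b (f b)))"
    by (intro Bochner_Integration.integral_cong prod.cong) auto
  also have "\<dots> = (\<Prod>b\<in>Basis. LINT u|lborel. g b u)"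
    by (rule product_integral_prod) (auto intro: assms)
  finally show ?thesis .
qed

lemma prob_space_std_gaussian: "prob_space std_gaussian"
proof
  have std: "(\<integral>\<^sup>+ u. ennreal (std_normal_density u) \<partial>lborel) = 1"
    using prob_space.emeasure_space_1[OF prob_space_normal_density[of 1 0]] by (simp add: emeasure_density)
  have "emeasure (std_gaussian :: 'a measure) (space std_gaussian) = (\<integral>\<^sup>+ x. (\<Prod>b\<in>Basis. ennreal (std_normal_density (x \<bullet> b))) \<partial>(lborel :: 'a measure))"
    by (simp add: std_gaussian_def emeasure_density gauss_density_def prod_ennreal)
  also have "\<dots> = 1" by (subst nn_integral_lborel_prod) (simp_all add: std)
  finally show "emeasure (std_gaussian :: 'a measure) (space std_gaussian) = 1" .
qed

interpretation std_gaussian: prob_space "std_gaussian :: 'n::euclidean_space measure"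
  by (rule prob_space_std_gaussian)

lemma measure_std_gaussian_UNIV [simp]: "measure (std_gaussian :: 'n::euclidean_space measure) UNIV = 1"
  using prob_space.prob_space[OF prob_space_std_gaussian[where 'a='n]] by simp

lemma char_std_gaussian:
  "(CLINT x|std_gaussian. iexp (h \<bullet> x)) = of_real (exp (- (norm h)\<^sup>2 / 2))" for h :: "'n::euclidean_space"
proof -
  have int: "integrable lborel (\<lambda>u. std_normal_density u *\<^sub>R iexp (t * u))" for t
  proof (rule Bochner_Integration.integrable_bound)
    show "integrable lborel std_normal_density" by (rule integrable_normal_density) simp
  qed auto
  have std: "(LINT u|lborel. std_normal_density u *\<^sub>R iexp (t * u)) = of_real (exp (- t\<^sup>2 / 2))" for t
  proof -
    have "(LINT u|lborel. std_normal_density u *\<^sub>R iexp (t * u)) = char std_normal_distribution t"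
      unfolding char_def by (subst integral_density) auto
    then show ?thesis by (simp add: char_std_normal_distribution)
  qed
  have "(CLINT x|std_gaussian. iexp (h \<bullet> x)) = (CLINT x|lborel. gauss_density x *\<^sub>R iexp (h \<bullet> x))"
    unfolding std_gaussian_def by (subst integral_density) (auto simp: gauss_density_nonneg)
  also have "\<dots> = (CLINT x|lborel. (\<Prod>b\<in>Basis. std_normal_density (x \<bullet> b) *\<^sub>R iexp ((h \<bullet> b) * (x \<bullet> b))))"
  proof (intro Bochner_Integration.integral_cong refl)
    fix x :: 'n
    have "iexp (h \<bullet> x) = (\<Prod>b\<in>Basis. iexp ((h \<bullet> b) * (x \<bullet> b)))"
      by (subst euclidean_inner[of h x]) (simp add: exp_sum[symmetric] sum_distrib_left)
    then show "gauss_density x *\<^sub>R iexp (h \<bullet> x) = (\<Prod>b\<in>Basis. std_normal_density (x \<bullet> b) *\<^sub>R iexp ((h \<bullet> b) * (x \<bullet> b)))"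
      by (simp add: gauss_density_def scaleR_conv_of_real prod.distrib)
  qed
  also have "\<dots> = (\<Prod>b\<in>Basis. of_real (exp (- (h \<bullet> b)\<^sup>2 / 2)))"
    by (subst integral_lborel_prod[where g="\<lambda>b u. std_normal_density u *\<^sub>R iexp ((h \<bullet> b) * u)"]) (simp_all only: int std)
  also have "\<dots> = of_real (exp (\<Sum>b\<in>Basis. - (h \<bullet> b)\<^sup>2 / 2))"
    by (simp only: of_real_prod[symmetric] exp_sum finite_Basis)
  also have "(\<Sum>b\<in>Basis. - (h \<bullet> b)\<^sup>2 / 2) = - (norm h)\<^sup>2 / 2"
    by (simp only: norm_power2_Basis sum_negf sum_divide_distrib[symmetric])
  finally show ?thesis .
qed

text \<open>The Cameron-Martin formula for the standard Gaussian: Lebesgue measure is translation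
  invariant, and completing the square gives the ratio of the densities.\<close>

lemma std_gaussian_shift:
  fixes F :: "'n::euclidean_space \<Rightarrow> real"
  assumes [measurable]: "F \<in> borel_measurable borel"
  shows "(LINT x|std_gaussian. F (x + w)) = (LINT x|std_gaussian. exp (w \<bullet> x - (norm w)\<^sup>2 / 2) * F x)"
proof -
  have dens: "gauss_density (x - w) = gauss_density x * exp (w \<bullet> x - (norm w)\<^sup>2 / 2)" for x
  proof -
    have "- (norm (x - w))\<^sup>2 / 2 = - (norm x)\<^sup>2 / 2 + (w \<bullet> x - (norm w)\<^sup>2 / 2)"
      by (simp add: power2_norm_eq_inner inner_diff_left inner_diff_right inner_commute field_simps)
    then show ?thesis
      by (simp only: gauss_density_eq[of "x - w"] gauss_density_eq[of x] exp_add mult.assoc)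
  qed
  have "(LINT x|std_gaussian. F (x + w)) = (LINT x|lborel. gauss_density x * F (x + w))"
    unfolding std_gaussian_def by (subst integral_density) (auto simp: gauss_density_nonneg)
  also have "\<dots> = (LINT x|lborel. gauss_density ((w + x) - w) * F (w + x))"
    by (simp add: add.commute)
  also have "\<dots> = (LINT x|distr lborel borel ((+) w). gauss_density (x - w) * F x)"
    by (subst integral_distr) auto
  also have "\<dots> = (LINT x|lborel. gauss_density (x - w) * F x)" by (simp only: lborel_distr_plus)
  also have "\<dots> = (LINT x|std_gaussian. exp (w \<bullet> x - (norm w)\<^sup>2 / 2) * F x)"
    unfolding std_gaussian_def by (subst integral_density) (auto simp: gauss_density_nonneg dens mult.assoc)
  finally show ?thesis .
qed

lemma std_gaussian_marginal:
  fixes e :: "'n::euclidean_space"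
  assumes e: "norm e = 1"
  shows "distr std_gaussian borel (\<lambda>x. e \<bullet> x) = std_normal_distribution"
proof (rule Levy_uniqueness)
  show "real_distribution (distr std_gaussian borel (\<lambda>x. e \<bullet> x))"
    by (intro std_gaussian.real_distribution_distr) simp
  show "real_distribution std_normal_distribution" by (rule real_dist_normal_dist)
  show "char (distr std_gaussian borel (\<lambda>x. e \<bullet> x)) = char std_normal_distribution"
  proof
    fix t
    have "char (distr std_gaussian borel (\<lambda>x. e \<bullet> x)) t = (CLINT x|std_gaussian. iexp ((t *\<^sub>R e) \<bullet> x))"
      unfolding char_def by (subst integral_distr) auto
    then show "char (distr std_gaussian borel (\<lambda>x. e \<bullet> x)) t = char std_normal_distribution t"
      unfolding char_std_gaussian by (simp add: e char_std_normal_distribution)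
  qed
qed

lemma std_gaussian_integral_inner:
  fixes w :: "'n::euclidean_space" and G :: "real \<Rightarrow> real"
  assumes [measurable]: "G \<in> borel_measurable borel"
  shows "(LINT x|std_gaussian. G (w \<bullet> x)) = (LINT u|std_normal_distribution. G (norm w * u))"
    "integrable std_normal_distribution (\<lambda>u. G (norm w * u)) \<Longrightarrow> integrable std_gaussian (\<lambda>x. G (w \<bullet> x))"
proof -
  obtain e :: 'n where e: "norm e = 1" "w = norm w *\<^sub>R e"
  proof (cases "w = 0")
    case True
    obtain b :: 'n where "b \<in> Basis" using nonempty_Basis by blast
    then show ?thesis using True that[of b] by simp
  next
    case False then show ?thesis using that[of "(1 / norm w) *\<^sub>R w"] by simp
  qed
  have eq: "w \<bullet> x = norm w * (e \<bullet> x)" for x by (subst e(2)) simp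
  show "(LINT x|std_gaussian. G (w \<bullet> x)) = (LINT u|std_normal_distribution. G (norm w * u))"
    unfolding eq std_gaussian_marginal[OF e(1), symmetric] by (subst integral_distr) auto
  show "integrable std_gaussian (\<lambda>x. G (w \<bullet> x))" if "integrable std_normal_distribution (\<lambda>u. G (norm w * u))"
    using that unfolding eq std_gaussian_marginal[OF e(1), symmetric] by (subst (asm) integrable_distr_eq) auto
qed

text \<open>The second moment of \<open>e\<^bsup>aU - a\<^sup>2/2\<^esup> - 1 - aU\<close> for a standard normal \<open>U\<close> is
  \<open>e\<^bsup>a\<^sup>2\<^esup> - 1 - a\<^sup>2\<close>.\<close>
lemma std_normal_exponential_remainder:
  fixes a :: real
  assumes a: "\<bar>a\<bar> \<le> 1"
  shows "integrable std_normal_distribution (\<lambda>u. \<bar>exp (a * u - a\<^sup>2 / 2) - 1 - a * u\<bar>)"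
    "(LINT u|std_normal_distribution. \<bar>exp (a * u - a\<^sup>2 / 2) - 1 - a * u\<bar>) \<le> a\<^sup>2"
proof -
  interpret prob_space std_normal_distribution by (rule prob_space_normal_density) simp
  let ?f = "\<lambda>u. exp (a * u - a\<^sup>2 / 2) - 1 - a * u"
  \<comment> \<open>Multiplied by the density, the exponentials become normal densities with means a
    and 2a, so the square of the remainder expands into known moments.\<close>
  have d1: "std_normal_density u * exp (a * u - a\<^sup>2 / 2) = normal_density a 1 u"
    and d2: "std_normal_density u * exp (2 * a * u - a\<^sup>2) = exp (a\<^sup>2) * normal_density (2 * a) 1 u" for u
    by (simp_all add: normal_density_def exp_add[symmetric] power2_eq_square field_simps)
  have e: "(exp (a * u - a\<^sup>2 / 2))\<^sup>2 = exp (2 * a * u - a\<^sup>2)" for u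
    by (simp add: power2_eq_square exp_add[symmetric])
  have "has_bochner_integral lborel (\<lambda>u. exp (a\<^sup>2) * normal_density (2 * a) 1 u + std_normal_density u
      + a\<^sup>2 * (std_normal_density u * (u - 0) ^ (2 * 1)) - 2 * normal_density a 1 u - (2 * a) * (normal_density a 1 u * u)
      + (2 * a) * (normal_density 0 1 u * u))
      (exp (a\<^sup>2) * 1 + 1 + a\<^sup>2 * (fact (2 * 1) / ((2 / 1\<^sup>2) ^ 1 * fact 1)) - 2 * 1 - (2 * a) * a + (2 * a) * 0)"
    by (intro has_bochner_integral_add has_bochner_integral_diff has_bochner_integral_mult_right normal_moment_even normal_moment_nz_1)
       (simp_all add: has_bochner_integral_iff integrable_normal_density integral_normal_density)
  also have "(\<lambda>u. exp (a\<^sup>2) * normal_density (2 * a) 1 u + std_normal_density u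
      + a\<^sup>2 * (std_normal_density u * (u - 0) ^ (2 * 1)) - 2 * normal_density a 1 u - (2 * a) * (normal_density a 1 u * u)
      + (2 * a) * (normal_density 0 1 u * u)) = (\<lambda>u. std_normal_density u * (?f u)\<^sup>2)"
    unfolding d1[symmetric] d2[symmetric] e[symmetric]
    by (auto simp: power2_eq_square algebra_simps)
  also have "exp (a\<^sup>2) * 1 + 1 + a\<^sup>2 * (fact (2 * 1) / ((2 / 1\<^sup>2) ^ 1 * fact 1)) - 2 * 1 - (2 * a) * a + (2 * a) * 0
      = exp (a\<^sup>2) - 1 - a\<^sup>2"
    by (simp add: power2_eq_square)
  finally have f2: "has_bochner_integral std_normal_distribution (\<lambda>u. (?f u)\<^sup>2) (exp (a\<^sup>2) - 1 - a\<^sup>2)"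
    by (subst has_bochner_integral_density) simp_all
  \<comment> \<open>For x = a^2 in [0,1], exp x is at most 1 + x + x^2.\<close>
  have le: "exp (a\<^sup>2) - 1 - a\<^sup>2 \<le> (a\<^sup>2)\<^sup>2"
    using exp_bound[of "a\<^sup>2"] a by (simp add: abs_square_le_1)
  have intf: "integrable std_normal_distribution ?f"
    by (rule square_integrable_imp_integrable) (simp, rule f2[unfolded has_bochner_integral_iff, THEN conjunct1])
  then show absf: "integrable std_normal_distribution (\<lambda>u. \<bar>?f u\<bar>)" by (rule integrable_abs)
  \<comment> \<open>Nonnegativity of the variance passes from the second moment to the L^1
    norm.\<close>
  have "(LINT u|std_normal_distribution. \<bar>?f u\<bar>)\<^sup>2 \<le> (LINT u|std_normal_distribution. (\<bar>?f u\<bar>)\<^sup>2)"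
    using variance_positive[of "\<lambda>u. \<bar>?f u\<bar>"] variance_eq[OF absf]
      f2[unfolded has_bochner_integral_iff, THEN conjunct1] by (simp only: power2_abs)
  also have "\<dots> \<le> (a\<^sup>2)\<^sup>2" using f2 le by (simp add: has_bochner_integral_iff)
  finally show "(LINT u|std_normal_distribution. \<bar>?f u\<bar>) \<le> a\<^sup>2" by (rule power2_le_imp_le) simp
qed

lemma std_gaussian_exponential_remainder:
  fixes w :: "'n::euclidean_space"
  assumes "norm w \<le> 1"
  shows "integrable std_gaussian (\<lambda>x. \<bar>exp (w \<bullet> x - (norm w)\<^sup>2 / 2) - 1 - w \<bullet> x\<bar>)"
    "(LINT x|std_gaussian. \<bar>exp (w \<bullet> x - (norm w)\<^sup>2 / 2) - 1 - w \<bullet> x\<bar>) \<le> (norm w)\<^sup>2"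
  using std_normal_exponential_remainder[of "norm w"] assms
    std_gaussian_integral_inner[of "\<lambda>u. \<bar>exp (u - (norm w)\<^sup>2 / 2) - 1 - u\<bar>" w]
  by auto

lemma std_gaussian_abs_inner:
  fixes w :: "'n::euclidean_space"
  shows "integrable std_gaussian (\<lambda>x. w \<bullet> x)" "(LINT x|std_gaussian. \<bar>w \<bullet> x\<bar>) \<le> norm w"
proof -
  interpret prob_space std_normal_distribution by (rule prob_space_normal_density) simp
  have int: "integrable std_normal_distribution (\<lambda>u. u)"
    using integrable_std_normal_distribution_moment[of 1] by simp
  have sq: "integrable std_normal_distribution (\<lambda>u. u\<^sup>2)" "expectation (\<lambda>u. u\<^sup>2) = 1"
    using integrable_std_normal_distribution_moment[of 2] std_normal_distribution_even_moments[of 1]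
    by simp_all
  have "integrable std_normal_distribution (\<lambda>u. norm w * u)" by (intro integrable_mult_right int)
  moreover have "(\<lambda>u :: real. u) \<in> borel_measurable borel" by measurable
  ultimately show "integrable std_gaussian (\<lambda>x. w \<bullet> x)"
    by (rule std_gaussian_integral_inner(2)[where G="\<lambda>u. u", rotated])
  have "0 \<le> 1 - (expectation (\<lambda>u. \<bar>u\<bar>))\<^sup>2"
    using variance_positive[of "\<lambda>u. \<bar>u\<bar>"] variance_eq[OF integrable_abs[OF int]] sq
    by (simp only: power2_abs)
  then have "(expectation (\<lambda>u. \<bar>u\<bar>))\<^sup>2 \<le> 1\<^sup>2" by (simp only: one_power2 diff_ge_0_iff_ge)
  then have "expectation (\<lambda>u. \<bar>u\<bar>) \<le> 1" by (rule power2_le_imp_le) simp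
  then have "norm w * expectation (\<lambda>u. \<bar>u\<bar>) \<le> norm w * 1" by (intro mult_left_mono) auto
  then show "(LINT x|std_gaussian. \<bar>w \<bullet> x\<bar>) \<le> norm w"
    using std_gaussian_integral_inner(1)[of abs w] by (simp add: abs_mult)
qed

text \<open>A Gaussian bump is itself a Gaussian average of characters, so by Fubini its integral
  against \<mu> depends only on the characteristic function of \<mu>.\<close>

lemma gaussian_kernel_char:
  fixes \<mu> :: "'n::euclidean_space measure"
  assumes \<mu>: "prob_space \<mu>" "sets \<mu> = sets borel"
  shows "(CLINT z|\<mu>. of_real (exp (- (norm (c *\<^sub>R (z - a)))\<^sup>2 / 2))) =
    (CLINT \<xi>|std_gaussian. iexp (- (c * (a \<bullet> \<xi>))) * (CLINT z|\<mu>. iexp ((c *\<^sub>R \<xi>) \<bullet> z)))"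
proof -
  interpret \<mu>: prob_space \<mu> by fact
  interpret P: pair_prob_space \<mu> "std_gaussian :: 'n measure" ..
  have [measurable_cong]: "sets \<mu> = sets borel" by fact
  have "(CLINT z|\<mu>. of_real (exp (- (norm (c *\<^sub>R (z - a)))\<^sup>2 / 2))) =
      (CLINT z|\<mu>. (CLINT \<xi>|std_gaussian. iexp ((c *\<^sub>R (z - a)) \<bullet> \<xi>)))"
    by (simp only: char_std_gaussian)
  also have "\<dots> = (CLINT \<xi>|std_gaussian. (CLINT z|\<mu>. iexp ((c *\<^sub>R (z - a)) \<bullet> \<xi>)))"
    by (rule P.Fubini_integral[symmetric]) (auto intro!: P.P.integrable_const_bound[where B=1])
  also have "\<dots> = (CLINT \<xi>|std_gaussian. iexp (- (c * (a \<bullet> \<xi>))) * (CLINT z|\<mu>. iexp ((c *\<^sub>R \<xi>) \<bullet> z)))"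
    by (simp add: inner_diff_left algebra_simps exp_add[symmetric] exp_diff inner_commute
        flip: integral_mult_right_zero)
  finally show ?thesis .
qed

text \<open>After an independent Gaussian perturbation of size \<open>e\<close>, \<mu> acquires a
  Lebesgue density at \<open>a\<close> given by the integral of a Gaussian bump centred there. The
  characteristic function thus determines the smoothed measure.\<close>

lemma integral_gaussian_convolution:
  fixes f :: "'n::euclidean_space \<Rightarrow> real"
  assumes \<mu>: "prob_space \<mu>" "sets \<mu> = sets borel" and e: "0 < e"
    and [measurable]: "f \<in> borel_measurable borel" and f: "\<And>x. 0 \<le> f x"
  shows "(\<integral>\<^sup>+z. (\<integral>\<^sup>+\<eta>. ennreal (f (z + e *\<^sub>R \<eta>)) \<partial>std_gaussian) \<partial>\<mu>) =
    (\<integral>\<^sup>+a. ennreal (f a) * (ennreal (gauss_density (0 :: 'n) / e ^ DIM('n)) *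
       ennreal (LINT z|\<mu>. exp (- (norm ((1 / e) *\<^sub>R (z - a)))\<^sup>2 / 2))) \<partial>lborel)"
proof -
  interpret \<mu>: prob_space \<mu> by fact
  interpret P: pair_sigma_finite \<mu> "lborel :: 'n measure" ..
  have [measurable_cong]: "sets \<mu> = sets borel" by fact
  let ?k = "\<lambda>z a. gauss_density (0 :: 'n) / e ^ DIM('n) * exp (- (norm ((1 / e) *\<^sub>R (z - a)))\<^sup>2 / 2)"
  have gk: "0 \<le> gauss_density (0 :: 'n) / e ^ DIM('n)" using e by (simp add: gauss_density_nonneg)
  have inner: "(\<integral>\<^sup>+\<eta>. ennreal (f (z + e *\<^sub>R \<eta>)) \<partial>std_gaussian) = (\<integral>\<^sup>+a. ennreal (f a * ?k z a) \<partial>lborel)" for z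
  proof -
    have "(\<integral>\<^sup>+a. ennreal (f a * ?k z a) \<partial>lborel) =
        (\<integral>\<^sup>+a. ennreal (f a * ?k z a) \<partial>density (distr lborel borel (\<lambda>x. z + e *\<^sub>R x)) (\<lambda>_. ennreal (\<bar>e\<bar> ^ DIM('n))))"
      using e by (subst lborel_affine[of e z]) auto
    also have "\<dots> = (\<integral>\<^sup>+\<eta>. ennreal (e ^ DIM('n)) * ennreal (f (z + e *\<^sub>R \<eta>) * ?k z (z + e *\<^sub>R \<eta>)) \<partial>lborel)"
      using e by (subst nn_integral_density) (auto simp: nn_integral_distr)
    also have "\<dots> = (\<integral>\<^sup>+\<eta>. ennreal (gauss_density \<eta>) * ennreal (f (z + e *\<^sub>R \<eta>)) \<partial>lborel)"
    proof (intro nn_integral_cong)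
      fix \<eta> :: 'n
      have "e ^ DIM('n) * (f (z + e *\<^sub>R \<eta>) * ?k z (z + e *\<^sub>R \<eta>)) = gauss_density \<eta> * f (z + e *\<^sub>R \<eta>)"
        using e by (subst gauss_density_eq[of \<eta>]) simp
      then show "ennreal (e ^ DIM('n)) * ennreal (f (z + e *\<^sub>R \<eta>) * ?k z (z + e *\<^sub>R \<eta>)) =
          ennreal (gauss_density \<eta>) * ennreal (f (z + e *\<^sub>R \<eta>))"
        using e f by (simp only: ennreal_mult'[symmetric] gauss_density_nonneg zero_le_power less_imp_le)
    qed
    finally show ?thesis by (simp add: std_gaussian_def nn_integral_density)
  qed
  have "(\<integral>\<^sup>+z. (\<integral>\<^sup>+\<eta>. ennreal (f (z + e *\<^sub>R \<eta>)) \<partial>std_gaussian) \<partial>\<mu>) = (\<integral>\<^sup>+z. (\<integral>\<^sup>+a. ennreal (f a * ?k z a) \<partial>lborel) \<partial>\<mu>)"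
    by (simp only: inner)
  also have "\<dots> = (\<integral>\<^sup>+a. (\<integral>\<^sup>+z. ennreal (f a * ?k z a) \<partial>\<mu>) \<partial>lborel)"
    by (rule P.Fubini'[symmetric]) measurable
  also have "\<dots> = (\<integral>\<^sup>+a. ennreal (f a) * (ennreal (gauss_density (0 :: 'n) / e ^ DIM('n)) *
       ennreal (LINT z|\<mu>. exp (- (norm ((1 / e) *\<^sub>R (z - a)))\<^sup>2 / 2))) \<partial>lborel)"
  proof (intro nn_integral_cong)
    fix a
    have "(\<integral>\<^sup>+z. ennreal (f a * ?k z a) \<partial>\<mu>) = (\<integral>\<^sup>+z. ennreal (f a) * (ennreal (gauss_density (0 :: 'n) / e ^ DIM('n)) *
        ennreal (exp (- (norm ((1 / e) *\<^sub>R (z - a)))\<^sup>2 / 2))) \<partial>\<mu>)"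
      using f gk by (intro nn_integral_cong) (simp only: ennreal_mult' mult_nonneg_nonneg exp_ge_zero)
    also have "\<dots> = ennreal (f a) * (ennreal (gauss_density (0 :: 'n) / e ^ DIM('n)) *
        (\<integral>\<^sup>+z. ennreal (exp (- (norm ((1 / e) *\<^sub>R (z - a)))\<^sup>2 / 2)) \<partial>\<mu>))"
      by (subst nn_integral_cmult, measurable)+
    also have "(\<integral>\<^sup>+z. ennreal (exp (- (norm ((1 / e) *\<^sub>R (z - a)))\<^sup>2 / 2)) \<partial>\<mu>) =
        ennreal (LINT z|\<mu>. exp (- (norm ((1 / e) *\<^sub>R (z - a)))\<^sup>2 / 2))"
      by (intro nn_integral_eq_integral \<mu>.integrable_const_bound[where B=1]) auto
    finally show "(\<integral>\<^sup>+z. ennreal (f a * ?k z a) \<partial>\<mu>) = ennreal (f a) * (ennreal (gauss_density (0 :: 'n) / e ^ DIM('n)) *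
       ennreal (LINT z|\<mu>. exp (- (norm ((1 / e) *\<^sub>R (z - a)))\<^sup>2 / 2)))" .
  qed
  finally show ?thesis .
qed

text \<open>Dominated convergence in the noise variable, followed by dominated convergence in
  \<open>z\<close>.\<close>

lemma integral_gaussian_mollification_tendsto:
  fixes f :: "'n::euclidean_space \<Rightarrow> real"
  assumes \<mu>: "prob_space \<mu>" "sets \<mu> = sets borel"
    and cont: "continuous_on UNIV f" and f: "\<And>x. 0 \<le> f x" "\<And>x. f x \<le> 1"
  shows "(\<lambda>k. \<integral>\<^sup>+z. (\<integral>\<^sup>+\<eta>. ennreal (f (z + (1 / real (Suc k)) *\<^sub>R \<eta>)) \<partial>std_gaussian) \<partial>\<mu>) \<longlonglongrightarrow>
    ennreal (LINT z|\<mu>. f z)"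
proof -
  interpret \<mu>: prob_space \<mu> by fact
  have [measurable_cong]: "sets \<mu> = sets borel" by fact
  have [measurable]: "f \<in> borel_measurable borel" using cont by (rule borel_measurable_continuous_onI)
  let ?F = "\<lambda>k z. LINT \<eta>|std_gaussian. f (z + (1 / real (Suc k)) *\<^sub>R \<eta>)"
  have nn1: "(\<integral>\<^sup>+\<eta>. ennreal (f (z + (1 / real (Suc k)) *\<^sub>R \<eta>)) \<partial>std_gaussian) = ennreal (?F k z)" for k z
    using f by (intro nn_integral_eq_integral std_gaussian.integrable_const_bound[where B=1]) auto
  have F: "0 \<le> ?F k z" "?F k z \<le> 1" for k z
  proof -
    show "0 \<le> ?F k z" using f by (intro integral_nonneg_AE) auto
    have "?F k z \<le> (LINT \<eta>|(std_gaussian :: 'n measure). 1)"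
      using f by (intro integral_mono std_gaussian.integrable_const_bound[where B=1]) auto
    then show "?F k z \<le> 1" by simp
  qed
  have lim1: "(\<lambda>k. ?F k z) \<longlonglongrightarrow> f z" for z
  proof -
    have "(\<lambda>k. ?F k z) \<longlonglongrightarrow> (LINT \<eta>|(std_gaussian :: 'n measure). f z)"
    proof (rule integral_dominated_convergence[where w="\<lambda>_. 1"])
      have "(\<lambda>k. f (z + (1 / real (Suc k)) *\<^sub>R \<eta>)) \<longlonglongrightarrow> f (z + 0 *\<^sub>R \<eta>)" for \<eta>
      proof (rule continuous_on_tendsto_compose[OF cont])
        have "(\<lambda>k. 1 / real (Suc k)) \<longlonglongrightarrow> 0" using LIMSEQ_inverse_real_of_nat by (simp add: inverse_eq_divide)
        then show "(\<lambda>k. z + (1 / real (Suc k)) *\<^sub>R \<eta>) \<longlonglongrightarrow> z + 0 *\<^sub>R \<eta>" by (intro tendsto_intros)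
      qed auto
      then show "AE \<eta> in std_gaussian. (\<lambda>k. f (z + (1 / real (Suc k)) *\<^sub>R \<eta>)) \<longlonglongrightarrow> f z" by simp
    qed (use f in auto)
    then show ?thesis by simp
  qed
  have meas: "?F k \<in> borel_measurable borel" for k
    by (intro std_gaussian.borel_measurable_lebesgue_integral) measurable
  then have [measurable]: "?F k \<in> borel_measurable \<mu>" for k by (simp add: measurable_cong_sets[OF \<mu>(2) refl])
  have nn2: "(\<integral>\<^sup>+z. ennreal (?F k z) \<partial>\<mu>) = ennreal (LINT z|\<mu>. ?F k z)" for k
    using F by (intro nn_integral_eq_integral \<mu>.integrable_const_bound[where B=1]) auto
  have "(\<lambda>k. LINT z|\<mu>. ?F k z) \<longlonglongrightarrow> (LINT z|\<mu>. f z)"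
    using lim1 F by (intro integral_dominated_convergence[where w="\<lambda>_. 1"]) auto
  then show ?thesis unfolding nn1 nn2 by (rule tendsto_ennrealI)
qed

text \<open>Gaussian smoothing of both measures gives equal densities. Letting the noise tend to 0
  identifies integrals of continuous functions, and these determine the measures on the generator of
  open sets.\<close>

lemma char_determines_measure:
  fixes \<mu> \<nu> :: "'n::euclidean_space measure"
  assumes \<mu>: "prob_space \<mu>" "sets \<mu> = sets borel" and \<nu>: "prob_space \<nu>" "sets \<nu> = sets borel"
    and eq: "\<And>h. (CLINT z|\<mu>. iexp (h \<bullet> z)) = (CLINT z|\<nu>. iexp (h \<bullet> z))"
  shows "\<mu> = \<nu>"
proof -
  interpret \<mu>: prob_space \<mu> by fact
  interpret \<nu>: prob_space \<nu> by fact
  have kernel: "(LINT z|\<mu>. exp (- (norm (c *\<^sub>R (z - a)))\<^sup>2 / 2)) = (LINT z|\<nu>. exp (- (norm (c *\<^sub>R (z - a)))\<^sup>2 / 2))" for c a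
  proof -
    have "(CLINT z|\<mu>. of_real (exp (- (norm (c *\<^sub>R (z - a)))\<^sup>2 / 2))) =
        (CLINT z|\<nu>. of_real (exp (- (norm (c *\<^sub>R (z - a)))\<^sup>2 / 2)))"
      unfolding gaussian_kernel_char[OF \<mu>] gaussian_kernel_char[OF \<nu>] by (simp only: eq)
    then show ?thesis unfolding integral_complex_of_real of_real_eq_iff .
  qed
  have cont: "(LINT z|\<mu>. f z) = (LINT z|\<nu>. f z)"
    if f: "continuous_on UNIV f" "\<And>x. 0 \<le> f x" "\<And>x. f x \<le> 1" for f :: "'n \<Rightarrow> real"
  proof -
    have [measurable]: "f \<in> borel_measurable borel" using f(1) by (rule borel_measurable_continuous_onI)
    have "ennreal (LINT z|\<mu>. f z) = ennreal (LINT z|\<nu>. f z)"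
    proof (rule LIMSEQ_unique[OF integral_gaussian_mollification_tendsto[OF \<mu> f]])
      show "(\<lambda>k. \<integral>\<^sup>+z. (\<integral>\<^sup>+\<eta>. ennreal (f (z + (1 / real (Suc k)) *\<^sub>R \<eta>)) \<partial>std_gaussian) \<partial>\<mu>) \<longlonglongrightarrow> ennreal (LINT z|\<nu>. f z)"
        using integral_gaussian_mollification_tendsto[OF \<nu> f] f(2)
        by (simp only: integral_gaussian_convolution[OF \<mu>] integral_gaussian_convolution[OF \<nu>] kernel
            of_nat_0_less_iff zero_less_Suc zero_less_divide_1_iff \<open>f \<in> borel_measurable borel\<close>)
    qed
    moreover have "0 \<le> (LINT z|\<mu>. f z)" "0 \<le> (LINT z|\<nu>. f z)"
      using f(2) by (auto intro!: integral_nonneg_AE)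
    ultimately show ?thesis by simp
  qed
  \<comment> \<open>The indicator of \<open>U\<close> is the limit of truncated multiples of the
    distance to the complement. The whole space is treated apart because \<open>infdist\<close> to
    the empty set is 0.\<close>
  have open_eq: "measure \<mu> U = measure \<nu> U" if U: "open U" for U
  proof (cases "U = UNIV")
    case True
    then show ?thesis using \<mu>.prob_space \<nu>.prob_space \<mu>(2) \<nu>(2) sets_eq_imp_space_eq[OF \<mu>(2)] sets_eq_imp_space_eq[OF \<nu>(2)] by simp
  next
    case False
    define f where "f k x = min 1 (real k * infdist x (- U))" for k x
    have f: "continuous_on UNIV (f k)" "\<And>x. 0 \<le> f k x" "\<And>x. f k x \<le> 1" for k
      by (auto simp: f_def intro!: continuous_intros mult_nonneg_nonneg infdist_nonneg)
    then have [measurable]: "f k \<in> borel_measurable borel" for k by (intro borel_measurable_continuous_onI)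
    have lim: "(\<lambda>k. f k x) \<longlonglongrightarrow> indicator U x" for x
    proof (cases "x \<in> U")
      case True
      then have "infdist x (- U) \<noteq> 0"
        using U False in_closed_iff_infdist_zero[of "- U" x] by (auto simp: closed_def)
      then have pos: "infdist x (- U) > 0" using infdist_nonneg[of x "- U"] by simp
      obtain m :: nat where m: "1 / infdist x (- U) \<le> real m" using real_arch_simple by blast
      have "f k x = 1" if "m \<le> k" for k
      proof -
        have "1 / infdist x (- U) \<le> real k" using m that by simp
        then show ?thesis using pos by (simp add: f_def field_simps)
      qed
      then have "eventually (\<lambda>k. f k x = indicator U x) sequentially"
        using True by (auto simp: eventually_sequentially)
      then show ?thesis by (rule tendsto_eventually)
    next
      case False
      then show ?thesis by (simp add: f_def)
    qed
    have "(\<lambda>k. LINT z|M. f k z) \<longlonglongrightarrow> measure M U" if M: "prob_space M" "sets M = sets borel" for M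
    proof -
      interpret M: prob_space M by fact
      have [measurable_cong]: "sets M = sets borel" by fact
      have "(\<lambda>k. LINT z|M. f k z) \<longlonglongrightarrow> (LINT z|M. indicator U z)"
        using lim f(2,3) borel_open[OF U] by (intro integral_dominated_convergence[where w="\<lambda>_. 1"]) auto
      then show ?thesis using sets_eq_imp_space_eq[OF M(2)] by simp
    qed
    from this[OF \<mu>] this[OF \<nu>] show ?thesis using cont[OF f] LIMSEQ_unique by simp
  qed
  show ?thesis
  proof (rule measure_eqI_generator_eq[where E="{S. open S}" and \<Omega>=UNIV and A="\<lambda>_. UNIV"])
    show "Int_stable {S :: 'n set. open S}" by (auto simp: Int_stable_def)
    show "sets \<mu> = sigma_sets UNIV {S. open S}" "sets \<nu> = sigma_sets UNIV {S. open S}"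
      unfolding \<mu>(2) \<nu>(2) by (simp_all add: borel_def)
    show "emeasure \<mu> U = emeasure \<nu> U" if "U \<in> {S. open S}" for U
      using open_eq[of U] that by (simp add: \<mu>.emeasure_eq_measure \<nu>.emeasure_eq_measure)
  qed auto
qed

section \<open>The delay semigroup\<close>

text \<open>The image measure has the required characteristic function, so the choice in
  \<open>gaussian\<close> succeeds; by \<open>char_determines_measure\<close> it can only return
  this measure.\<close>

lemma distr_psd_sqrt_gaussian:
  fixes C :: "'n::euclidean_space \<Rightarrow> 'n"
  assumes C: "linear C" "\<And>x y. C x \<bullet> y = x \<bullet> C y" "\<And>x. 0 \<le> C x \<bullet> x"
  shows "gaussian UNIV C = distr std_gaussian borel (psd_sqrt C)"
proof -
  note R = psd_sqrt_works[OF C]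
  let ?G = "distr std_gaussian borel (psd_sqrt C)"
  have [measurable]: "psd_sqrt C \<in> borel_measurable borel" by (rule borel_measurable_linear[OF R(1)])
  have char: "(CLINT z|?G. iexp (h \<bullet> z)) = of_real (exp (- (C h \<bullet> h) / 2))" for h
  proof -
    have "(CLINT z|?G. iexp (h \<bullet> z)) = (CLINT x|std_gaussian. iexp (psd_sqrt C h \<bullet> x))"
      by (subst integral_distr) (auto simp: R(2))
    also have "\<dots> = of_real (exp (- (norm (psd_sqrt C h))\<^sup>2 / 2))" by (rule char_std_gaussian)
    also have "(norm (psd_sqrt C h))\<^sup>2 = C h \<bullet> h"
      using R(2)[of "psd_sqrt C h" h] by (simp add: power2_norm_eq_inner R(3))
    finally show ?thesis .
  qed
  have prob: "prob_space ?G" by (intro prob_space.prob_space_distr prob_space_std_gaussian) simp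
  have "centered_gaussian UNIV C ?G"
    using prob char by (simp add: centered_gaussian_def)
  then have "centered_gaussian UNIV C (gaussian UNIV C)" unfolding gaussian_def by (rule someI)
  then show ?thesis
    unfolding centered_gaussian_def
    by (intro char_determines_measure prob) (auto simp: char)
qed

section \<open>Representatives of L^2 classes and square integrable functions\<close>

lemma L2_eq_rep_L2: "L2_eq (rep_L2 h) (rep_L2 h)"
  by (rule Quotient3_rep_reflp[OF Quotient3_L2])

lemma square_integrable_rep_L2: "square_integrable (rep_L2 h)"
  using L2_eq_rep_L2[of h] by (simp add: L2_eq_def)

lemma rep_L2_measurable [measurable]: "rep_L2 h \<in> borel_measurable borel"
  using square_integrable_rep_L2[of h] by (simp add: square_integrable_def)

lemma rep_abs_L2_AE:
  assumes "square_integrable f" shows "AE s in lborel. rep_L2 (abs_L2 f) s = f s"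
  using Quotient3_rep_abs[OF Quotient3_L2, of f] assms by (simp add: L2_eq_def)

lemma abs_L2_eqI: "L2_eq f g \<Longrightarrow> abs_L2 f = abs_L2 g"
  by (rule Quotient3_rel_abs[OF Quotient3_L2])

lemma abs_rep_L2: "abs_L2 (rep_L2 h) = h"
  by (rule Quotient3_abs_rep[OF Quotient3_L2])

lemma rep_L2_zero_AE: "AE s in lborel. rep_L2 (0 :: 'a::euclidean_space L2) s = 0"
  unfolding zero_L2_def by (rule rep_abs_L2_AE[OF square_integrable_0])

lemma rep_L2_add_AE: "AE s in lborel. rep_L2 (x + y) s = rep_L2 x s + rep_L2 y s"
proof -
  have "x + y = abs_L2 (\<lambda>s. rep_L2 x s + rep_L2 y s)" by (simp add: plus_L2_def)
  then show ?thesis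
    using rep_abs_L2_AE[OF square_integrable_add[OF square_integrable_rep_L2[of x] square_integrable_rep_L2[of y]]] by simp
qed

lemma rep_L2_scaleR_AE: "AE s in lborel. rep_L2 (c *\<^sub>R x) s = c *\<^sub>R rep_L2 x s"
proof -
  have "c *\<^sub>R x = abs_L2 (\<lambda>s. c *\<^sub>R rep_L2 x s)" by (simp add: scaleR_L2_def)
  then show ?thesis
    using rep_abs_L2_AE[OF square_integrable_scaleR[OF square_integrable_rep_L2[of x]]] by simp
qed

lemma inner_L2_rep: "x \<bullet> y = (LINT s|lborel. rep_L2 x s \<bullet> rep_L2 y s)" for x y :: "'a::euclidean_space L2"
  by (simp add: inner_L2_def)

lemma L2_on_zero: "0 \<in> L2_on d"
  using rep_L2_zero_AE unfolding L2_on_def by (auto elim: eventually_mono)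

lemma state_space_Pair_zero: "(v, 0) \<in> state_space d"
  by (simp add: state_space_def L2_on_zero)

lemma square_integrable_indicator:
  assumes f: "square_integrable f" and I [measurable]: "I \<in> sets borel"
  shows "square_integrable (\<lambda>s. indicator I s *\<^sub>R f s)"
proof -
  have [measurable]: "f \<in> borel_measurable borel" using f by (simp add: square_integrable_def)
  have "integrable lborel (\<lambda>s. indicator I s *\<^sub>R (norm (f s))\<^sup>2)"
    using f I by (intro integrable_mult_indicator) (auto simp: square_integrable_def)
  also have "(\<lambda>s. indicator I s *\<^sub>R (norm (f s))\<^sup>2) = (\<lambda>s. (norm (indicator I s *\<^sub>R f s))\<^sup>2)"
    by (auto simp: indicator_def)
  finally show ?thesis by (simp add: square_integrable_def)
qed

lemma square_integrable_translate:
  assumes f: "square_integrable f" shows "square_integrable (\<lambda>s. f (s + t))"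
proof -
  have [measurable]: "f \<in> borel_measurable borel" using f by (simp add: square_integrable_def)
  have "integrable lborel (\<lambda>s. (norm (f (t + 1 * s)))\<^sup>2)"
    using f lborel_integrable_real_affine_iff[of 1 "\<lambda>s. (norm (f s))\<^sup>2" t] by (simp add: square_integrable_def)
  then show ?thesis by (simp add: square_integrable_def add.commute)
qed

lemma square_integrable_bounded:
  fixes f :: "real \<Rightarrow> 'a::euclidean_space"
  assumes [measurable]: "f \<in> borel_measurable borel" and "\<And>s. norm (f s) \<le> K" "\<And>s. s \<notin> {a..b} \<Longrightarrow> f s = 0"
  shows "square_integrable f"
proof -
  have "integrable lborel (\<lambda>s. (norm (f s))\<^sup>2)"
  proof (rule Bochner_Integration.integrable_bound)
    show "integrable lborel (\<lambda>s. K\<^sup>2 * indicator {a..b} s)"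
      by (intro integrable_mult_right integrable_real_indicator) (auto simp: emeasure_lborel_Icc_eq)
    show "AE s in lborel. norm ((norm (f s))\<^sup>2) \<le> norm (K\<^sup>2 * indicator {a..b} s)"
      using assms by (intro AE_I2) (auto simp: indicator_def power_mono)
  qed measurable
  then show ?thesis by (simp add: square_integrable_def)
qed

lemma square_integrable_imp_set_integrable:
  fixes f :: "real \<Rightarrow> 'a::euclidean_space"
  assumes [measurable]: "f \<in> borel_measurable borel" and f: "set_integrable lborel {a..b} (\<lambda>s. (norm (f s))\<^sup>2)"
  shows "set_integrable lborel {a..b} f"
  unfolding set_integrable_def
proof (rule Bochner_Integration.integrable_bound)
  show "integrable lborel (\<lambda>s. indicator {a..b} s * 1 + indicator {a..b} s *\<^sub>R (norm (f s))\<^sup>2)"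
    using f unfolding set_integrable_def
    by (intro Bochner_Integration.integrable_add integrable_mult_left integrable_real_indicator) (auto simp: emeasure_lborel_Icc_eq)
  have "x \<le> 1 + x\<^sup>2" for x :: real
  proof -
    have "2 * x \<le> x\<^sup>2 + 1" "0 \<le> x\<^sup>2" using sum_squares_bound[of x 1] by auto
    then show ?thesis by linarith
  qed
  then show "AE s in lborel. norm (indicator {a..b} s *\<^sub>R f s) \<le> norm (indicator {a..b} s * 1 + indicator {a..b} s *\<^sub>R (norm (f s))\<^sup>2)"
    by (intro AE_I2) (auto simp: indicator_def)
qed measurable

lemma set_integrable_rep_L2: "set_integrable lborel {a..b} (rep_L2 h)"
proof (rule square_integrable_imp_set_integrable)
  have "integrable lborel (\<lambda>s. (norm (rep_L2 h s))\<^sup>2)"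
    using square_integrable_rep_L2[of h] by (simp add: square_integrable_def)
  then show "set_integrable lborel {a..b} (\<lambda>s. (norm (rep_L2 h s))\<^sup>2)"
    unfolding set_integrable_def by (rule integrable_mult_indicator[rotated]) simp
qed measurable

section \<open>The first component of the delay semigroup\<close>

lemma exp_op_Basis:
  fixes A :: "'n::euclidean_space \<Rightarrow>\<^sub>L 'n"
  shows "exp_op A v = (\<Sum>i\<in>Basis. (v \<bullet> i) *\<^sub>R exp_op A i)"
  by (subst euclidean_representation[symmetric, of v])
     (simp only: linear_sum[OF linear_exp_op] linear_cmul[OF linear_exp_op])

lemma exp_op_compose_measurable:
  fixes A :: "'n::euclidean_space \<Rightarrow>\<^sub>L 'n"
  assumes [measurable]: "g \<in> borel_measurable borel"
  shows "(\<lambda>s. exp_op ((t + s) *\<^sub>R A) (g s)) \<in> borel_measurable borel"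
proof -
  have "continuous_on UNIV (\<lambda>s. exp_op ((t + s) *\<^sub>R A) i)" for i
    by (intro continuous_intros)
  then have [measurable]: "(\<lambda>s. exp_op ((t + s) *\<^sub>R A) i) \<in> borel_measurable borel" for i
    by (rule borel_measurable_continuous_onI)
  show ?thesis by (subst exp_op_Basis) measurable
qed

lemma norm_exp_op_window:
  fixes A :: "'n::euclidean_space \<Rightarrow>\<^sub>L 'n"
  shows "norm (delay_kernel A t s v) \<le> exp (t * norm A) * norm v"
proof (cases "s \<in> {-t..0}")
  case True
  have "norm (exp_op ((t + s) *\<^sub>R A) v) \<le> exp (norm ((t + s) *\<^sub>R A)) * norm v" by (rule exp_op_norm)
  also have "\<dots> \<le> exp (t * norm A) * norm v" using True by (intro mult_right_mono) (auto intro: mult_right_mono)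
  finally show ?thesis using True by simp
qed simp

text \<open>Takes a function instead of an L^2 class, so that it serves both the history of a state
  and the density of \<open>b1\<close>.\<close>

definition drift :: "real \<Rightarrow> ('n::euclidean_space \<Rightarrow>\<^sub>L 'n) \<Rightarrow> real \<Rightarrow> (real \<Rightarrow> 'n) \<Rightarrow> 'n" where
  "drift d a0 t g = (LINT s:{-d..0}|lborel. delay_kernel a0 t s (g s))"

lemma fst_delay_semigroup:
  "fst (delay_semigroup d a0 t y) = exp_op (t *\<^sub>R a0) (fst y) + drift d a0 t (rep_L2 (snd y))"
  by (simp add: delay_semigroup_def drift_def)

lemma drift_integrable:
  assumes [measurable]: "g \<in> borel_measurable borel" and g: "set_integrable lborel {-d..0} g"
  shows "set_integrable lborel {-d..0} (\<lambda>s. delay_kernel a0 t s (g s))"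
proof -
  have [measurable]: "(\<lambda>s. exp_op ((t + s) *\<^sub>R a0) (g s)) \<in> borel_measurable borel"
    by (rule exp_op_compose_measurable) measurable
  show ?thesis
    unfolding set_integrable_def
  proof (rule Bochner_Integration.integrable_bound)
    show "integrable lborel (\<lambda>s. exp (t * norm a0) *\<^sub>R (indicator {-d..0} s *\<^sub>R g s))"
      using g unfolding set_integrable_def by (rule integrable_scaleR_right)
    show "AE s in lborel. norm (indicator {-d..0} s *\<^sub>R delay_kernel a0 t s (g s))
        \<le> norm (exp (t * norm a0) *\<^sub>R (indicator {-d..0} s *\<^sub>R g s))"
    proof (rule AE_I2)
      fix s
      show "norm (indicator {-d..0} s *\<^sub>R delay_kernel a0 t s (g s))
        \<le> norm (exp (t * norm a0) *\<^sub>R (indicator {-d..0} s *\<^sub>R g s))"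
        using norm_exp_op_window[of t s a0 "g s"] by (cases "s \<in> {-d..0}") simp_all
    qed
  qed measurable
qed

lemma drift_cong_AE:
  assumes "AE s in lborel. g s = g' s" and [measurable]: "g \<in> borel_measurable borel" "g' \<in> borel_measurable borel"
  shows "drift d a0 t g = drift d a0 t g'"
proof -
  have [measurable]: "(\<lambda>s. exp_op ((t + s) *\<^sub>R a0) (g s)) \<in> borel_measurable borel"
    "(\<lambda>s. exp_op ((t + s) *\<^sub>R a0) (g' s)) \<in> borel_measurable borel"
    by (intro exp_op_compose_measurable; measurable)+
  show ?thesis
    unfolding drift_def set_lebesgue_integral_def
  proof (rule integral_cong_AE)
    show "AE s in lborel. indicator {-d..0} s *\<^sub>R delay_kernel a0 t s (g s)
       = indicator {-d..0} s *\<^sub>R delay_kernel a0 t s (g' s)"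
      using assms(1) by eventually_elim simp
  qed measurable
qed

lemma drift_zero [simp]: "drift d a0 t (\<lambda>s. 0) = 0"
  by (simp add: drift_def linear_0[OF linear_exp_op] set_lebesgue_integral_def)

lemma drift_rep_zero [simp]: "drift d a0 t (rep_L2 0) = 0"
  using drift_cong_AE[OF rep_L2_zero_AE, of d a0 t] by simp

lemma drift_rep_linear: "drift d a0 t (rep_L2 (x + c *\<^sub>R y)) = drift d a0 t (rep_L2 x) + c *\<^sub>R drift d a0 t (rep_L2 y)"
proof -
  have "AE s in lborel. rep_L2 (x + c *\<^sub>R y) s = rep_L2 x s + c *\<^sub>R rep_L2 y s"
    using rep_L2_add_AE[of x "c *\<^sub>R y"] rep_L2_scaleR_AE[of c y] by eventually_elim simp
  then have "drift d a0 t (rep_L2 (x + c *\<^sub>R y)) = drift d a0 t (\<lambda>s. rep_L2 x s + c *\<^sub>R rep_L2 y s)"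
    by (rule drift_cong_AE) measurable
  also have "\<dots> = drift d a0 t (rep_L2 x) + (LINT s:{-d..0}|lborel. c *\<^sub>R (delay_kernel a0 t s (rep_L2 y s)))"
    unfolding drift_def linear_add[OF linear_exp_op] linear_cmul[OF linear_exp_op] scaleR_add_right
      scaleR_left_commute[of _ c]
    by (intro set_integral_add(2) drift_integrable set_integrable_scaleR_right rep_L2_measurable set_integrable_rep_L2)
  also have "\<dots> = drift d a0 t (rep_L2 x) + c *\<^sub>R drift d a0 t (rep_L2 y)"
    unfolding drift_def by (simp only: set_integral_scaleR_right)
  finally show ?thesis .
qed

lemma fst_delay_semigroup_linear:
  "fst (delay_semigroup d a0 t (x + c *\<^sub>R y)) = fst (delay_semigroup d a0 t x) + c *\<^sub>R fst (delay_semigroup d a0 t y)"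
  by (simp add: fst_delay_semigroup drift_rep_linear linear_add[OF linear_exp_op] linear_cmul[OF linear_exp_op] scaleR_add_right)

text \<open>States with zero history already reach every vector. This makes the function
  \<open>g\<close> in \<open>B_shift\<close> unique.\<close>

lemma fst_delay_semigroup_surj:
  assumes "0 \<le> t" obtains y where "y \<in> state_space d" "fst (delay_semigroup d a0 t y) = v"
proof -
  obtain y0 where "exp_op (t *\<^sub>R a0) y0 = v" using exp_op_surj[OF assms, of a0] by (metis surjD)
  then show ?thesis using that[of "(y0, 0)"] by (simp add: fst_delay_semigroup state_space_Pair_zero)
qed

text \<open>\<open>rep_L2 0\<close> is a chosen representative that vanishes only almost everywhere;
  translation preserves null sets.\<close>

lemma delay_semigroup_Pair_zero: "delay_semigroup d a0 t (v, 0) = (exp_op (t *\<^sub>R a0) v, 0)"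
proof -
  have "AE r in lborel. rep_L2 (0 :: 'a L2) (- t + 1 * r) = 0"
    by (rule AE_borel_affine) (use rep_L2_zero_AE in auto)
  then have "AE r in lborel. indicator {-d + t..0} r *\<^sub>R rep_L2 (0 :: 'a L2) (r - t) = 0"
    by eventually_elim simp
  moreover have "square_integrable (\<lambda>r. indicator {-d + t..0} r *\<^sub>R rep_L2 (0 :: 'a L2) (r - t))"
    using square_integrable_translate[OF square_integrable_rep_L2, of 0 "- t"]
    by (intro square_integrable_indicator) auto
  ultimately have "abs_L2 (\<lambda>r. indicator {-d + t..0} r *\<^sub>R rep_L2 (0 :: 'a L2) (r - t)) = 0"
    unfolding zero_L2_def by (intro abs_L2_eqI) (simp add: L2_eq_def square_integrable_0)
  then show ?thesis
    by (simp add: delay_semigroup_def drift_def[symmetric])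
qed

section \<open>Adjoints and the covariance on the state space\<close>

lemma adjoint_noise_op: "adjoint (noise_op \<sigma>) = (\<lambda>z. adjoint (blinfun_apply \<sigma>) (fst z))"
  by (rule adjoint_unique) (simp add: noise_op_def inner_prod_def adjoint_works[OF linear_blinfun])

text \<open>\<open>adjoint\<close> is a choice operator, so a complete candidate is verified on the
  ambient space. The covariance sees its first component, because
  \<open>adjoint (noise_op \<sigma>)\<close> discards the second.\<close>

lemma fst_adjoint_delay_semigroup:
  fixes a0 :: "'n::euclidean_space \<Rightarrow>\<^sub>L 'n"
  shows "fst (adjoint (delay_semigroup d a0 t) z) = exp_op (\<lambda>y. t *\<^sub>R adjoint (blinfun_apply a0) y) (fst z)"
proof -
  let ?E = "\<lambda>r v. exp_op (\<lambda>y. (t + r) *\<^sub>R adjoint (blinfun_apply a0) y) v"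
  \<comment> \<open>\<open>W\<close> is the adjoint of the drift integral and \<open>S\<close> the
    adjoint of the truncated right shift; their sum is the second component of the adjoint.\<close>
  define W where "W z0 r = indicator {-d..0} r *\<^sub>R indicator {-t..0} r *\<^sub>R ?E r z0" for z0 :: 'n and r
  define S where "S h r = indicator {-d + t..0} (r + t) *\<^sub>R rep_L2 h (r + t)" for h :: "'n L2" and r
  have W: "square_integrable (W z0)" for z0
  proof (rule square_integrable_bounded)
    show "W z0 \<in> borel_measurable borel"
      unfolding W_def exp_op_adjoint_eq
      by (intro borel_measurable_scaleR borel_measurable_indicator exp_op_compose_measurable) auto
    show "norm (W z0 s) \<le> exp (t * norm (Blinfun (adjoint (blinfun_apply a0)))) * norm z0" for s
      using norm_exp_op_window[of t s "Blinfun (adjoint (blinfun_apply a0))" z0]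
      unfolding W_def exp_op_adjoint_eq by (cases "s \<in> {-d..0}") auto
    show "W z0 s = 0" if "s \<notin> {-d..0}" for s using that by (simp add: W_def)
  qed
  have S: "square_integrable (S h)" for h
    unfolding S_def
    by (rule square_integrable_translate[of "\<lambda>r. indicator {-d + t..0} r *\<^sub>R rep_L2 h r"])
       (intro square_integrable_indicator square_integrable_rep_L2, simp)
  have [measurable]: "W z0 \<in> borel_measurable borel" "S h \<in> borel_measurable borel" for z0 h
    using W[of z0] S[of h] by (simp_all add: square_integrable_def)
  have adj: "adjoint (delay_semigroup d a0 t) = (\<lambda>z. (?E 0 (fst z), abs_L2 (\<lambda>r. W (fst z) r + S (snd z) r)))"
  proof (rule adjoint_unique, intro allI)
    fix y z :: "'n \<times> 'n L2"
    let ?y = "rep_L2 (snd y)" and ?z = "rep_L2 (snd z)"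
    have "drift d a0 t ?y \<bullet> fst z = (LINT r|lborel. (indicator {-d..0} r *\<^sub>R delay_kernel a0 t r (?y r)) \<bullet> fst z)"
      unfolding drift_def set_lebesgue_integral_def
      using drift_integrable[OF rep_L2_measurable set_integrable_rep_L2, of d t a0 "snd y"]
      by (intro integral_inner_left[symmetric]) (simp add: set_integrable_def)
    also have "\<dots> = (LINT r|lborel. ?y r \<bullet> W (fst z) r)"
      by (intro Bochner_Integration.integral_cong refl) (simp add: W_def exp_op_adjoint)
    finally have 1: "drift d a0 t ?y \<bullet> fst z = (LINT r|lborel. ?y r \<bullet> W (fst z) r)" .
    let ?s = "\<lambda>r. indicator {-d + t..0} r *\<^sub>R ?y (r - t)"
    have "square_integrable ?s"
      using square_integrable_translate[OF square_integrable_rep_L2, of "snd y" "- t"]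
      by (intro square_integrable_indicator) auto
    from rep_abs_L2_AE[OF this] have "AE r in lborel. rep_L2 (abs_L2 ?s) r \<bullet> ?z r = ?s r \<bullet> ?z r"
      by eventually_elim simp
    then have "abs_L2 ?s \<bullet> snd z = (LINT r|lborel. ?s r \<bullet> ?z r)"
      unfolding inner_L2_rep by (intro integral_cong_AE) measurable
    also have "\<dots> = (LINT r|lborel. ?s (t + 1 * r) \<bullet> ?z (t + 1 * r))"
      by (subst lborel_integral_real_affine[where c=1 and t=t]) auto
    also have "\<dots> = (LINT r|lborel. ?y r \<bullet> S (snd z) r)"
      by (intro Bochner_Integration.integral_cong refl) (simp add: S_def add.commute)
    finally have 2: "abs_L2 ?s \<bullet> snd z = (LINT r|lborel. ?y r \<bullet> S (snd z) r)" .
    have "AE r in lborel. ?y r \<bullet> rep_L2 (abs_L2 (\<lambda>r. W (fst z) r + S (snd z) r)) r = ?y r \<bullet> (W (fst z) r + S (snd z) r)"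
      using rep_abs_L2_AE[OF square_integrable_add[OF W[of "fst z"] S[of "snd z"]]] by eventually_elim simp
    then have "snd y \<bullet> abs_L2 (\<lambda>r. W (fst z) r + S (snd z) r) = (LINT r|lborel. ?y r \<bullet> (W (fst z) r + S (snd z) r))"
      unfolding inner_L2_rep by (intro integral_cong_AE) measurable
    also have "\<dots> = (LINT r|lborel. ?y r \<bullet> W (fst z) r) + (LINT r|lborel. ?y r \<bullet> S (snd z) r)"
      unfolding inner_add_right
      by (intro Bochner_Integration.integral_add square_integrable_inner square_integrable_rep_L2 W S)
    finally show "delay_semigroup d a0 t y \<bullet> z = y \<bullet> (?E 0 (fst z), abs_L2 (\<lambda>r. W (fst z) r + S (snd z) r))"
      using 1 2 fst_delay_semigroup[of d a0 t y] exp_op_adjoint[of t a0 "fst y" "fst z"]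
      by (simp add: inner_prod_def inner_add_left delay_semigroup_def)
  qed
  show ?thesis by (simp add: adj)
qed

text \<open>The noise enters only the first component, and on \<open>\<real>\<^sup>n \<times> {0}\<close> the semigroup is \<open>e\<^bsup>t a\<^sub>0\<^esup>\<close>.\<close>
lemma covar_eq: "covar d a0 \<sigma> t x = (covar0 a0 \<sigma> t (fst x), 0)"
proof -
  have "bounded_linear (\<lambda>v :: 'a. (v, 0 :: 'a L2))"
    by (intro bounded_linear_Pair bounded_linear_ident bounded_linear_zero)
  from has_integral_linear[OF covar0_has_integral[of a0 \<sigma> "fst x" t] this]
  show ?thesis
    unfolding covar_def adjoint_noise_op fst_adjoint_delay_semigroup obs_def[symmetric] noise_op_def delay_semigroup_Pair_zero
    by (simp add: o_def integral_unique)
qed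

text \<open>The covariance acts on the first component only, so the image of the standard Gaussian
  under \<xi> -> (R \<xi>, 0) is a witness for the choice in \<open>gaussian\<close>.\<close>

lemma centered_gaussian_state_space:
  fixes a0 :: "'n::euclidean_space \<Rightarrow>\<^sub>L 'n"
  shows "centered_gaussian (state_space d) (covar d a0 \<sigma> t) (gaussian (state_space d) (covar d a0 \<sigma> t))"
proof -
  let ?S = "state_space d :: ('n \<times> 'n L2) set" and ?R = "psd_sqrt (covar0 a0 \<sigma> t)"
  note R = psd_sqrt_covar0[of a0 \<sigma> t]
  let ?j = "\<lambda>\<xi>. (?R \<xi>, 0 :: 'n L2)"
  let ?G = "distr std_gaussian (restrict_space borel ?S) ?j"
  have blR: "bounded_linear ?R" using R(1) by (simp add: linear_conv_bounded_linear)
  then have "continuous_on UNIV ?j"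
    by (intro linear_continuous_on bounded_linear_Pair bounded_linear_zero)
  then have "?j \<in> borel_measurable borel" by (rule borel_measurable_continuous_onI)
  then have j: "?j \<in> measurable borel (restrict_space borel ?S)"
    by (intro measurable_restrict_space2) (auto simp: state_space_Pair_zero)
  have "(CLINT z|?G. iexp (h \<bullet> z)) = of_real (exp (- (covar d a0 \<sigma> t h \<bullet> h) / 2))" for h
  proof -
    have "continuous_on UNIV (\<lambda>z :: 'n \<times> 'n L2. iexp (h \<bullet> z))" by (intro continuous_intros)
    then have "(\<lambda>z. iexp (h \<bullet> z)) \<in> borel_measurable (restrict_space borel ?S)"
      by (intro measurable_restrict_space1 borel_measurable_continuous_onI)
    then have "(CLINT z|?G. iexp (h \<bullet> z)) = (CLINT \<xi>|std_gaussian. iexp (?R (fst h) \<bullet> \<xi>))"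
      using j by (subst integral_distr) (auto simp: inner_prod_def R(2))
    also have "\<dots> = of_real (exp (- (norm (?R (fst h)))\<^sup>2 / 2))" by (rule char_std_gaussian)
    also have "(norm (?R (fst h)))\<^sup>2 = covar d a0 \<sigma> t h \<bullet> h"
      using R(2)[of "?R (fst h)" "fst h"] by (simp add: power2_norm_eq_inner R(3) covar_eq inner_prod_def)
    finally show ?thesis .
  qed
  moreover have "prob_space ?G"
    using j by (intro prob_space.prob_space_distr prob_space_std_gaussian) simp
  ultimately have "centered_gaussian ?S (covar d a0 \<sigma> t) ?G"
    by (simp add: centered_gaussian_def space_restrict_space)
  then show ?thesis unfolding gaussian_def by (rule someI)
qed

text \<open>The characteristic function of the chosen measure, evaluated at \<open>(h, 0)\<close>,
  is that of its first marginal, which is thereby identified as N(0, Q) on R^n.\<close>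

lemma OU_eq:
  fixes a0 :: "'n::euclidean_space \<Rightarrow>\<^sub>L 'n"
  assumes [measurable]: "\<phi> \<in> borel_measurable borel"
  shows "OU d a0 \<sigma> t (\<lambda>y. \<phi> (fst y)) x =
    (LINT z|gaussian UNIV (covar0 a0 \<sigma> t). \<phi> (z + fst (delay_semigroup d a0 t x)))"
proof -
  let ?S = "state_space d :: ('n \<times> 'n L2) set"
  let ?\<mu> = "gaussian ?S (covar d a0 \<sigma> t)" and ?R = "psd_sqrt (covar0 a0 \<sigma> t)"
  note R = psd_sqrt_covar0[of a0 \<sigma> t]
  have \<mu>: "prob_space ?\<mu>" "sets ?\<mu> = sets (restrict_space borel ?S)"
    "\<And>h. h \<in> ?S \<Longrightarrow> (CLINT z|?\<mu>. iexp (h \<bullet> z)) = of_real (exp (- (covar d a0 \<sigma> t h \<bullet> h) / 2))"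
    using centered_gaussian_state_space[of d a0 \<sigma> t] by (auto simp: centered_gaussian_def)
  have "continuous_on UNIV (fst :: 'n \<times> 'n L2 \<Rightarrow> 'n)" by (intro continuous_intros)
  then have "fst \<in> borel_measurable (restrict_space borel ?S)"
    by (intro measurable_restrict_space1 borel_measurable_continuous_onI)
  then have [measurable]: "fst \<in> borel_measurable ?\<mu>" by (simp add: measurable_cong_sets[OF \<mu>(2) refl])
  have G: "gaussian UNIV (covar0 a0 \<sigma> t) = distr std_gaussian borel ?R"
    by (rule distr_psd_sqrt_gaussian[OF linear_covar0 covar0_symmetric covar0_psd])
  have [measurable]: "?R \<in> borel_measurable borel" by (rule borel_measurable_linear[OF R(1)])
  have "distr ?\<mu> borel fst = gaussian UNIV (covar0 a0 \<sigma> t)"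
  proof (rule char_determines_measure)
    show "prob_space (distr ?\<mu> borel fst)" by (intro prob_space.prob_space_distr \<mu>) simp
    show "prob_space (gaussian UNIV (covar0 a0 \<sigma> t))"
      unfolding G by (intro prob_space.prob_space_distr prob_space_std_gaussian) simp
    show "sets (gaussian UNIV (covar0 a0 \<sigma> t)) = sets borel" by (simp add: G)
    fix h
    have "(CLINT z|distr ?\<mu> borel fst. iexp (h \<bullet> z)) = (CLINT z|?\<mu>. iexp ((h, 0) \<bullet> z))"
      by (subst integral_distr) (auto simp: inner_prod_def)
    also have "\<dots> = of_real (exp (- (covar0 a0 \<sigma> t h \<bullet> h) / 2))"
      by (subst \<mu>(3)) (auto simp: state_space_Pair_zero covar_eq inner_prod_def)
    also have "covar0 a0 \<sigma> t h \<bullet> h = (norm (?R h))\<^sup>2"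
      using R(2)[of "?R h" h] by (simp add: power2_norm_eq_inner R(3))
    also have "of_real (exp (- (norm (?R h))\<^sup>2 / 2)) = (CLINT x|std_gaussian. iexp (?R h \<bullet> x))"
      by (rule char_std_gaussian[symmetric])
    also have "\<dots> = (CLINT z|gaussian UNIV (covar0 a0 \<sigma> t). iexp (h \<bullet> z))"
      unfolding G by (subst integral_distr) (auto simp: R(2))
    finally show "(CLINT z|distr ?\<mu> borel fst. iexp (h \<bullet> z)) = (CLINT z|gaussian UNIV (covar0 a0 \<sigma> t). iexp (h \<bullet> z))" .
  qed simp
  then have "(LINT z|gaussian UNIV (covar0 a0 \<sigma> t). \<phi> (z + fst (delay_semigroup d a0 t x)))
      = (LINT z|distr ?\<mu> borel fst. \<phi> (z + fst (delay_semigroup d a0 t x)))" by simp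
  also have "\<dots> = (LINT z|?\<mu>. \<phi> (fst z + fst (delay_semigroup d a0 t x)))"
    by (subst integral_distr) auto
  finally show ?thesis by (simp add: OU_def)
qed

section \<open>The smoothed control operator\<close>

lemma vector_measure_entry:
  "vector_measure S b \<Longrightarrow> vector_measure S (\<lambda>E. blinfun_apply (b E) j \<bullet> i)"
  by (rule vector_measure_bounded_linear[where f="\<lambda>A. blinfun_apply A j \<bullet> i"])
     (auto intro: bounded_linear_inner_left_comp blinfun.bounded_linear_left)

text \<open>For fixed \<open>k\<close> the density belongs to b1(dr) k, a combination of the
  columns, whereas \<open>matrix_integral\<close> integrates the entries separately. Exchanging the
  two sums groups the entries by row, where the combination has density
  \<open>g s \<bullet> i\<close>.\<close>

lemma etAB0_density:
  fixes b1 :: "real set \<Rightarrow> 'm::euclidean_space \<Rightarrow>\<^sub>L 'n::euclidean_space"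
  assumes b1: "vector_measure {-d..0} b1"
    and [measurable]: "g \<in> borel_measurable borel" and g: "set_integrable lborel {-d..0} g"
    and eq: "\<And>E. E \<in> sets borel \<Longrightarrow> E \<subseteq> {-d..0} \<Longrightarrow> b1 E k = (LINT s:E|lborel. g s)"
  shows "etAB0 d a0 b0 b1 t k = exp_op (t *\<^sub>R a0) (b0 k) + drift d a0 t g"
proof -
  let ?S = "{-d..0::real}"
  define M where "M r y = delay_kernel a0 t r y" for r :: real and y
  have linM: "linear (M r)" for r
    unfolding M_def by (intro linear_compose_scale_right linear_exp_op)
  have Mmeas: "(\<lambda>r. M r i) \<in> borel_measurable borel" for i
    unfolding M_def by (intro borel_measurable_scaleR borel_measurable_indicator exp_op_compose_measurable) auto
  have gi: "set_integrable lborel E (\<lambda>s. g s \<bullet> i)" if "E \<in> sets borel" "E \<subseteq> ?S" for E i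
  proof -
    have "set_integrable lborel E g" by (rule set_integrable_subset[OF g]) (use that in auto)
    then have "integrable lborel (\<lambda>s. (indicator E s *\<^sub>R g s) \<bullet> i)" unfolding set_integrable_def by (intro integrable_inner_left)
    then show ?thesis by (simp add: set_integrable_def)
  qed
  have comp: "(\<Sum>j\<in>Basis. (k \<bullet> j) *\<^sub>R signed_integral ?S (\<lambda>E. b1 E j \<bullet> i) (\<lambda>r. M r i)) = (LINT s:?S|lborel. (g s \<bullet> i) *\<^sub>R M s i)" for i
  proof (rule signed_integral_combination)
    show "vector_measure ?S (\<lambda>E. b1 E j \<bullet> i)" for j
      by (rule vector_measure_entry[OF b1])
    show "set_integrable lborel ?S (\<lambda>s. g s \<bullet> i)" by (rule gi) auto
    show "(\<Sum>j\<in>Basis. k \<bullet> j * (b1 E j \<bullet> i)) = (LINT s:E|lborel. g s \<bullet> i)" if E: "E \<in> sets borel" "E \<subseteq> ?S" for E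
    proof -
      have "(\<Sum>j\<in>Basis. k \<bullet> j * (b1 E j \<bullet> i)) = b1 E (\<Sum>j\<in>Basis. (k \<bullet> j) *\<^sub>R j) \<bullet> i"
        by (simp only: linear_sum[OF linear_blinfun] linear_cmul[OF linear_blinfun] inner_sum_left inner_scaleR_left)
      also have "\<dots> = (LINT s:E|lborel. g s) \<bullet> i" by (simp only: euclidean_representation eq[OF E])
      also have "\<dots> = (LINT s|lborel. (indicator E s *\<^sub>R g s) \<bullet> i)"
        unfolding set_lebesgue_integral_def using set_integrable_subset[OF g _ E(2)] E(1)
        by (intro integral_inner_left[symmetric]) (simp add: set_integrable_def)
      finally show ?thesis by (simp add: set_lebesgue_integral_def)
    qed
    show "(\<lambda>r. M r i) \<in> borel_measurable (restrict_space borel ?S)" by (rule measurable_restrict_space1[OF Mmeas])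
    show "norm (M r i) \<le> exp (t * norm a0) * norm i" for r unfolding M_def by (rule norm_exp_op_window)
  qed simp
  have intM: "set_integrable lborel ?S (\<lambda>s. (g s \<bullet> i) *\<^sub>R M s i)" for i
  proof -
    have "(\<lambda>s. (g s \<bullet> i) *\<^sub>R M s i) = (\<lambda>s. delay_kernel a0 t s ((g s \<bullet> i) *\<^sub>R i))"
      by (simp add: M_def linear_cmul[OF linear_exp_op] mult.commute)
    moreover have "set_integrable lborel ?S (\<lambda>s. (g s \<bullet> i) *\<^sub>R i)"
    proof -
      have "integrable lborel (\<lambda>s. (indicator ?S s *\<^sub>R (g s \<bullet> i)) *\<^sub>R i)"
        using gi[of ?S i] unfolding set_integrable_def by (intro integrable_scaleR_left) auto
      then show ?thesis by (simp add: set_integrable_def)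
    qed
    ultimately show ?thesis by (simp only:) (intro drift_integrable, measurable)
  qed
  have "matrix_integral ?S b1 M k = (\<Sum>j\<in>Basis. \<Sum>i\<in>Basis. (k \<bullet> j) *\<^sub>R signed_integral ?S (\<lambda>E. b1 E j \<bullet> i) (\<lambda>r. M r i))"
    by (simp only: matrix_integral_def scaleR_sum_right)
  also have "\<dots> = (\<Sum>i\<in>Basis. \<Sum>j\<in>Basis. (k \<bullet> j) *\<^sub>R signed_integral ?S (\<lambda>E. b1 E j \<bullet> i) (\<lambda>r. M r i))"
    by (rule sum.swap)
  also have "\<dots> = (\<Sum>i\<in>Basis. LINT s:?S|lborel. (g s \<bullet> i) *\<^sub>R M s i)" by (simp only: comp)
  also have "\<dots> = (LINT s:?S|lborel. (\<Sum>i\<in>Basis. (g s \<bullet> i) *\<^sub>R M s i))"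
    using intM unfolding set_lebesgue_integral_def set_integrable_def scaleR_sum_right
    by (intro Bochner_Integration.integral_sum[symmetric])
  also have "(\<lambda>s. \<Sum>i\<in>Basis. (g s \<bullet> i) *\<^sub>R M s i) = (\<lambda>s. M s (g s))"
  proof
    fix s
    have "M s (g s) = M s (\<Sum>i\<in>Basis. (g s \<bullet> i) *\<^sub>R i)" by (simp only: euclidean_representation)
    then show "(\<Sum>i\<in>Basis. (g s \<bullet> i) *\<^sub>R M s i) = M s (g s)"
      by (simp only: linear_sum[OF linM] linear_cmul[OF linM])
  qed
  finally show ?thesis by (simp add: etAB0_def M_def[abs_def] drift_def)
qed

lemma linear_etAB0: "linear (etAB0 d a0 b0 b1 t)"
  unfolding etAB0_def matrix_integral_def
  by (intro linearI)
     (simp_all add: linear_add[OF linear_blinfun] linear_cmul[OF linear_blinfun] linear_add[OF linear_exp_op]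
        linear_cmul[OF linear_exp_op] inner_add_left scaleR_add_left sum.distrib scaleR_add_right scaleR_sum_right)

lemma norm_signed_integral_le:
  fixes f :: "real \<Rightarrow> 'a::euclidean_space"
  assumes S: "S \<in> sets borel" and \<nu>: "vector_measure S \<nu>" and K: "\<And>s. norm (f s) \<le> K"
  shows "norm (signed_integral S \<nu> f) \<le> K * (measure (pos_variation S \<nu>) S + measure (pos_variation S (\<lambda>E. - \<nu> E)) S)"
proof -
  have K0: "0 \<le> K" using K[of 0] norm_ge_zero[of "f 0"] by linarith
  have "norm (LINT r|M. f r) \<le> K * measure M S" if "finite_measure M" "space M = S" for M
  proof -
    interpret finite_measure M by fact
    show ?thesis
    proof (cases "integrable M f")
      case True
      then have "norm (LINT r|M. f r) \<le> (LINT r|M. norm (f r))" by (intro integral_norm_bound)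
      also have "\<dots> \<le> (LINT r|M. K)" using True K by (intro integral_mono) auto
      finally show ?thesis using that(2) by (simp add: mult.commute)
    qed (use K0 in \<open>simp add: not_integrable_integral_eq\<close>)
  qed
  from this[OF finite_measure_pos_variation[OF S \<nu>] pos_variation(2)[OF S \<nu>]]
    this[OF finite_measure_pos_variation[OF S vector_measure_uminus[OF \<nu>]] pos_variation(2)[OF S vector_measure_uminus[OF \<nu>]]]
  show ?thesis unfolding signed_integral_def distrib_left
    by (intro order_trans[OF norm_triangle_ineq4] add_mono)
qed

text \<open>The total variations of the entries and exp (T |a0|) give a constant independent of t.
  In the second alternative it bounds the vectors that have to be steered.\<close>

lemma etAB0_bound:
  fixes b1 :: "real set \<Rightarrow> 'm::euclidean_space \<Rightarrow>\<^sub>L 'n::euclidean_space"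
  assumes b1: "vector_measure {-d..0} b1"
  obtains C where "0 \<le> C" "\<And>t k. t \<in> {0<..T} \<Longrightarrow> norm (etAB0 d a0 b0 b1 t k) \<le> C * norm k"
proof -
  let ?S = "{-d..0::real}"
  let ?m = "\<lambda>j i. measure (pos_variation ?S (\<lambda>E. b1 E j \<bullet> i)) ?S + measure (pos_variation ?S (\<lambda>E. - (b1 E j \<bullet> i))) ?S"
  define e where "e = exp (T * norm a0)"
  have vm: "vector_measure ?S (\<lambda>E. b1 E j \<bullet> i)" for j i
    by (rule vector_measure_entry[OF b1])
  define C where "C = e * norm b0 + (\<Sum>j\<in>Basis. \<Sum>i\<in>Basis. e * ?m j i)"
  show ?thesis
  proof (rule that)
    show "0 \<le> C" by (auto simp: C_def e_def intro!: add_nonneg_nonneg sum_nonneg mult_nonneg_nonneg)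
    fix t k assume t: "t \<in> {0<..T}"
    have et: "exp (t * norm a0) \<le> e" using t by (auto simp: e_def intro: mult_right_mono)
    define M where "M r y = delay_kernel a0 t r y" for r :: real and y
    have M: "norm (M r i) \<le> e" if "i \<in> Basis" for r i
    proof -
      have "norm (M r i) \<le> exp (t * norm a0) * norm i" unfolding M_def by (rule norm_exp_op_window)
      then show ?thesis using that et by simp
    qed
    have 1: "norm (exp_op (t *\<^sub>R a0) (b0 k)) \<le> e * norm b0 * norm k"
    proof -
      have "norm (exp_op (t *\<^sub>R a0) (b0 k)) \<le> exp (norm (t *\<^sub>R a0)) * norm (b0 k)" by (rule exp_op_norm)
      also have "\<dots> \<le> e * (norm b0 * norm k)" using t et by (intro mult_mono norm_blinfun) (auto simp: e_def)
      finally show ?thesis by (simp add: mult.assoc)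
    qed
    have "norm (matrix_integral ?S b1 M k) \<le> (\<Sum>j\<in>Basis. norm ((k \<bullet> j) *\<^sub>R (\<Sum>i\<in>Basis. signed_integral ?S (\<lambda>E. b1 E j \<bullet> i) (\<lambda>r. M r i))))"
      unfolding matrix_integral_def by (rule norm_sum)
    also have "\<dots> \<le> (\<Sum>j\<in>Basis. norm k * (\<Sum>i\<in>Basis. e * ?m j i))"
    proof (rule sum_mono)
      fix j :: 'm assume j: "j \<in> Basis"
      have "norm (\<Sum>i\<in>Basis. signed_integral ?S (\<lambda>E. b1 E j \<bullet> i) (\<lambda>r. M r i)) \<le> (\<Sum>i\<in>Basis. e * ?m j i)"
        using M by (intro sum_norm_le norm_signed_integral_le vm) auto
      then show "norm ((k \<bullet> j) *\<^sub>R (\<Sum>i\<in>Basis. signed_integral ?S (\<lambda>E. b1 E j \<bullet> i) (\<lambda>r. M r i))) \<le> norm k * (\<Sum>i\<in>Basis. e * ?m j i)"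
        unfolding norm_scaleR using Basis_le_norm[OF j, of k] by (intro mult_mono) auto
    qed
    also have "\<dots> = (\<Sum>j\<in>Basis. \<Sum>i\<in>Basis. e * ?m j i) * norm k" by (simp add: sum_distrib_left[symmetric] mult.commute)
    finally have 2: "norm (matrix_integral ?S b1 M k) \<le> (\<Sum>j\<in>Basis. \<Sum>i\<in>Basis. e * ?m j i) * norm k" .
    have "etAB0 d a0 b0 b1 t k = exp_op (t *\<^sub>R a0) (b0 k) + matrix_integral ?S b1 M k"
      by (simp add: etAB0_def M_def[abs_def])
    then show "norm (etAB0 d a0 b0 b1 t k) \<le> C * norm k"
      unfolding C_def distrib_right using norm_triangle_le[OF add_mono[OF 1 2]] by simp
  qed
qed

text \<open>Resolves the \<open>THE\<close> in \<open>B_shift\<close>: two densities agree almost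
  everywhere on the window, and membership in \<open>L2_on d\<close> makes both vanish
  outside.\<close>

lemma L2_density_unique:
  assumes h: "has_L2_density d \<nu> h" and h': "has_L2_density d \<nu> h'"
  shows "h = h'"
proof -
  let ?S = "{-d..0::real}"
  have int: "integrable lborel (\<lambda>s. indicator ?S s *\<^sub>R rep_L2 h s \<bullet> i)" for h :: "'a L2" and i
    using set_integrable_rep_L2[of "-d" 0 h] unfolding set_integrable_def by (intro integrable_inner_left)
  have sint: "(LINT s:A|lborel. indicator ?S s *\<^sub>R rep_L2 h s \<bullet> i) = \<nu> (A \<inter> ?S) \<bullet> i"
    if h: "has_L2_density d \<nu> h" and A: "A \<in> sets borel" for h :: "'a L2" and A i
  proof -
    have "set_integrable lborel (A \<inter> ?S) (rep_L2 h)"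
      by (rule set_integrable_subset[OF set_integrable_rep_L2[of "-d" 0 h]]) (use A in auto)
    then have "(LINT s|lborel. (indicator (A \<inter> ?S) s *\<^sub>R rep_L2 h s) \<bullet> i) = (LINT s:A \<inter> ?S|lborel. rep_L2 h s) \<bullet> i"
      unfolding set_lebesgue_integral_def set_integrable_def by (intro integral_inner_left)
    also have "(LINT s:A \<inter> ?S|lborel. rep_L2 h s) = \<nu> (A \<inter> ?S)"
      using h A by (auto simp: has_L2_density_def)
    finally show ?thesis by (simp add: set_lebesgue_integral_def indicator_inter_arith mult_ac)
  qed
  have "AE s in lborel. indicator ?S s *\<^sub>R rep_L2 h s \<bullet> i = indicator ?S s *\<^sub>R rep_L2 h' s \<bullet> i" for i
    by (rule density_unique_real[OF int int]) (simp only: sint[OF h] sint[OF h'] sets_lborel)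
  then have "AE s in lborel. \<forall>i\<in>Basis. indicator ?S s *\<^sub>R rep_L2 h s \<bullet> i = indicator ?S s *\<^sub>R rep_L2 h' s \<bullet> i"
    by (intro AE_finite_allI) auto
  moreover have "AE s in lborel. s \<notin> ?S \<longrightarrow> rep_L2 h s = 0" "AE s in lborel. s \<notin> ?S \<longrightarrow> rep_L2 h' s = 0"
    using h h' by (auto simp: has_L2_density_def L2_on_def)
  ultimately have "AE s in lborel. rep_L2 h s = rep_L2 h' s"
    by eventually_elim (auto intro: euclidean_eqI)
  then have "abs_L2 (rep_L2 h) = abs_L2 (rep_L2 h')"
    by (intro abs_L2_eqI) (simp add: L2_eq_def square_integrable_rep_L2)
  then show ?thesis by (simp add: abs_rep_L2)
qed

text \<open>Both branches of \<open>B_shift\<close> give the same value. If B k lies in the state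
  space, linearity of the first component and \<open>etAB0_density\<close> identify the
  displacement; otherwise surjectivity of the first component pins down \<open>g\<close>.\<close>

lemma B_shift_eq:
  fixes b1 :: "real set \<Rightarrow> 'm::euclidean_space \<Rightarrow>\<^sub>L 'n::euclidean_space"
  assumes b1: "vector_measure {-d..0} b1" and t: "0 < t"
    and f: "\<And>y. f y = g (fst (delay_semigroup d a0 t y))"
  shows "B_shift d a0 b0 b1 t f x s k = g (fst (delay_semigroup d a0 t x) + s *\<^sub>R etAB0 d a0 b0 b1 t k)"
proof (cases "\<exists>h. has_L2_density d (\<lambda>E. b1 E k) h")
  case True
  then obtain h where h: "has_L2_density d (\<lambda>E. b1 E k) h" by blast
  then have the: "(THE h. has_L2_density d (\<lambda>E. b1 E k) h) = h" using L2_density_unique by blast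
  have "etAB0 d a0 b0 b1 t k = fst (delay_semigroup d a0 t (b0 k, h))"
    using h by (subst etAB0_density[OF b1 rep_L2_measurable set_integrable_rep_L2])
      (auto simp: has_L2_density_def fst_delay_semigroup)
  then show ?thesis using True by (simp add: B_shift_def the f fst_delay_semigroup_linear del: scaleR_Pair)
next
  case False
  have "(THE g'. \<forall>y\<in>state_space d. f y = g' (fst (delay_semigroup d a0 t y))) = g"
  proof (rule the_equality)
    show "\<forall>y\<in>state_space d. f y = g (fst (delay_semigroup d a0 t y))" using f by simp
    fix g' assume g': "\<forall>y\<in>state_space d. f y = g' (fst (delay_semigroup d a0 t y))"
    show "g' = g"
    proof
      fix v
      obtain y where "y \<in> state_space d" "fst (delay_semigroup d a0 t y) = v"
        by (rule fst_delay_semigroup_surj[of t d a0 v]) (use t in auto)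
      then show "g' v = g v" using g' f[of y] by auto
    qed
  qed
  then show ?thesis using False by (simp add: B_shift_def)
qed

text \<open>In the second alternative the whole vector lies in Im \<sigma> and is steered at the
  rate t^(-1/2). In the first this applies to the undelayed part, while the distributed part is
  estimated by \<open>distributed_cost\<close> through the L^2 norm of the density.\<close>

lemma etAB0_cost:
  fixes a0 :: "'n::euclidean_space \<Rightarrow>\<^sub>L 'n" and \<sigma> :: "'q::euclidean_space \<Rightarrow>\<^sub>L 'n"
    and b0 :: "'m::euclidean_space \<Rightarrow>\<^sub>L 'n" and b1 :: "real set \<Rightarrow> 'm \<Rightarrow>\<^sub>L 'n"
  assumes b1: "vector_measure {-d..0} b1"
    and alt: "((\<forall>t>0. range (\<lambda>k. exp_op (t *\<^sub>R a0) (b0 k)) \<subseteq> range \<sigma>) \<and>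
          (\<exists>\<beta>. has_L2_operator_density d b1 \<beta> \<and>
               (AE s in lborel. s \<in> {-d..0} \<longrightarrow> range (\<beta> s) \<subseteq> range \<sigma>)))
       \<or> (\<forall>t>0. range (etAB0 d a0 b0 b1 t) \<subseteq> range \<sigma>)"
    and T: "0 < T"
  obtains C where "0 \<le> C" "\<And>t k x. t \<in> {0<..T} \<Longrightarrow>
    \<bar>etAB0 d a0 b0 b1 t k \<bullet> x\<bar> \<le> C * t powr (-1/2) * norm k * norm (psd_sqrt (covar0 a0 \<sigma> t) x)"
proof -
  obtain C1 where C1: "0 \<le> C1" "\<And>t x y. t \<in> {0<..T} \<Longrightarrow>
    \<bar>\<sigma> y \<bullet> x\<bar> \<le> C1 * t powr (-1/2) * norm y * norm (psd_sqrt (covar0 a0 \<sigma> t) x)"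
    by (rule range_cost[OF T, of \<sigma> a0]) blast
  obtain M where M: "0 \<le> M" "\<And>v. v \<in> range \<sigma> \<Longrightarrow> \<exists>y. \<sigma> y = v \<and> norm y \<le> M * norm v"
    by (rule preimage_bound[of \<sigma>]) blast
  have cost: "\<bar>v \<bullet> x\<bar> \<le> C1 * M * c * t powr (-1/2) * norm k * norm (psd_sqrt (covar0 a0 \<sigma> t) x)"
    if t: "t \<in> {0<..T}" and v: "v \<in> range \<sigma>" "norm v \<le> c * norm k" for t v c x and k :: 'm
  proof -
    obtain y where y: "\<sigma> y = v" "norm y \<le> M * norm v" using M(2)[OF v(1)] by blast
    have "norm y \<le> M * (c * norm k)" using y(2) mult_left_mono[OF v(2) M(1)] by linarith
    then have "C1 * t powr (-1/2) * norm y * norm (psd_sqrt (covar0 a0 \<sigma> t) x)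
        \<le> C1 * t powr (-1/2) * (M * (c * norm k)) * norm (psd_sqrt (covar0 a0 \<sigma> t) x)"
      using C1(1) by (intro mult_right_mono mult_left_mono) auto
    with C1(2)[OF t, of y x] show ?thesis by (simp add: y(1) mult_ac)
  qed
  from alt show ?thesis
  proof
    assume "\<forall>t>0. range (etAB0 d a0 b0 b1 t) \<subseteq> range \<sigma>"
    then have r: "etAB0 d a0 b0 b1 t k \<in> range \<sigma>" if "0 < t" for t k using that by blast
    obtain c where c: "0 \<le> c" "\<And>t k. t \<in> {0<..T} \<Longrightarrow> norm (etAB0 d a0 b0 b1 t k) \<le> c * norm k"
      by (rule etAB0_bound[OF b1, of T a0 b0]) blast
    show ?thesis using M(1) C1(1) c by (intro that[of "C1 * M * c"] cost r) auto
  next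
    assume "(\<forall>t>0. range (\<lambda>k. exp_op (t *\<^sub>R a0) (b0 k)) \<subseteq> range \<sigma>) \<and>
          (\<exists>\<beta>. has_L2_operator_density d b1 \<beta> \<and> (AE s in lborel. s \<in> {-d..0} \<longrightarrow> range (\<beta> s) \<subseteq> range \<sigma>))"
    then obtain \<beta> where r0: "\<And>t k. 0 < t \<Longrightarrow> exp_op (t *\<^sub>R a0) (b0 k) \<in> range \<sigma>"
      and dens: "has_L2_operator_density d b1 \<beta>" and r1: "AE s in lborel. s \<in> {-d..0} \<longrightarrow> range (\<beta> s) \<subseteq> range \<sigma>" by blast
    define N where "N = sqrt (LINT s:{-d..0}|lborel. (norm (\<beta> s))\<^sup>2)"
    have [measurable]: "\<beta> \<in> borel_measurable borel" and int2: "set_integrable lborel {-d..0} (\<lambda>s. (norm (\<beta> s))\<^sup>2)"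
      using dens by (auto simp: has_L2_operator_density_def)
    define e where "e = exp (T * norm a0) * norm b0"
    define C where "C = C1 * M * e + M * N * sqrt T"
    have N0: "0 \<le> N" by (simp add: N_def set_lebesgue_integral_def)
    show ?thesis
    proof (rule that)
      show "0 \<le> C" using C1(1) M(1) N0 T by (simp add: C_def e_def)
      fix t k x assume t: "t \<in> {0<..T}"
      let ?R = "norm (psd_sqrt (covar0 a0 \<sigma> t) x)" and ?g = "\<lambda>s. \<beta> s k"
      have [measurable]: "?g \<in> borel_measurable borel"
        by (rule borel_measurable_continuous_on[OF _ \<open>\<beta> \<in> borel_measurable borel\<close>]) (intro continuous_intros)
      have gle: "(norm (?g s))\<^sup>2 \<le> (norm k)\<^sup>2 * (norm (\<beta> s))\<^sup>2" for s
        using power_mono[OF norm_blinfun[of "\<beta> s" k], of 2] by (simp add: power_mult_distrib mult.commute)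
      have int_k: "integrable lborel (\<lambda>s. (norm k)\<^sup>2 * (indicator {-d..0} s *\<^sub>R (norm (\<beta> s))\<^sup>2))"
        using int2 unfolding set_integrable_def by (rule integrable_mult_right)
      have g2: "set_integrable lborel {-d..0} (\<lambda>s. (norm (?g s))\<^sup>2)"
        unfolding set_integrable_def
      proof (rule Bochner_Integration.integrable_bound[OF int_k])
        show "AE s in lborel. norm (indicator {-d..0} s *\<^sub>R (norm (?g s))\<^sup>2) \<le> norm ((norm k)\<^sup>2 * (indicator {-d..0} s *\<^sub>R (norm (\<beta> s))\<^sup>2))"
          using gle by (intro AE_I2) (auto simp: indicator_def)
      qed measurable
      have gint: "set_integrable lborel {-d..0} ?g" by (rule square_integrable_imp_set_integrable[OF _ g2]) measurable
      have etA: "etAB0 d a0 b0 b1 t k = exp_op (t *\<^sub>R a0) (b0 k) + drift d a0 t ?g"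
        using dens by (intro etAB0_density[OF b1 _ gint]) (auto simp: has_L2_operator_density_def)
      have "\<bar>drift d a0 t ?g \<bullet> x\<bar> \<le> M * sqrt (LINT s:{-d..0}|lborel. (norm (?g s))\<^sup>2) * ?R"
        unfolding drift_def
      proof (rule distributed_cost[OF _ M])
        show "AE s in lborel. s \<in> {-d..0} \<longrightarrow> ?g s \<in> range \<sigma>" using r1 by eventually_elim auto
      qed (use t in \<open>auto intro: g2 drift_integrable[OF _ gint]\<close>)
      also have "sqrt (LINT s:{-d..0}|lborel. (norm (?g s))\<^sup>2) \<le> norm k * N"
      proof -
        have "(LINT s:{-d..0}|lborel. (norm (?g s))\<^sup>2) \<le> (LINT s|lborel. (norm k)\<^sup>2 * (indicator {-d..0} s *\<^sub>R (norm (\<beta> s))\<^sup>2))"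
          unfolding set_lebesgue_integral_def using g2 gle
          by (intro integral_mono int_k) (auto simp: set_integrable_def indicator_def)
        also have "\<dots> = (norm k)\<^sup>2 * (LINT s:{-d..0}|lborel. (norm (\<beta> s))\<^sup>2)"
          unfolding set_lebesgue_integral_def by (rule integral_mult_right_zero)
        finally have "sqrt (LINT s:{-d..0}|lborel. (norm (?g s))\<^sup>2) \<le> sqrt ((norm k)\<^sup>2 * (LINT s:{-d..0}|lborel. (norm (\<beta> s))\<^sup>2))"
          by (rule real_sqrt_le_mono)
        then show ?thesis by (simp add: real_sqrt_mult N_def)
      qed
      finally have "\<bar>drift d a0 t ?g \<bullet> x\<bar> \<le> M * (norm k * N) * ?R"
        using M(1) by (simp add: mult_left_mono mult_right_mono)
      \<comment> \<open>The distributed part has constant cost; sqrt T times t^(-1/2) is at least 1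
        on (0,T], so it can be put under the common rate.\<close>
      also have "\<dots> \<le> M * (norm k * N) * ?R * (sqrt T * t powr (-1/2))"
      proof -
        have "1 \<le> sqrt T * t powr (-1/2)"
          using t by (simp add: powr_minus powr_half_sqrt field_simps)
        moreover have "0 \<le> M * (norm k * N) * ?R" using M(1) N0 by simp
        ultimately show ?thesis using mult_left_mono[of 1 "sqrt T * t powr (-1/2)" "M * (norm k * N) * ?R"] by simp
      qed
      finally have 2: "\<bar>drift d a0 t ?g \<bullet> x\<bar> \<le> M * N * sqrt T * t powr (-1/2) * norm k * ?R"
        by (simp add: mult_ac)
      have "norm (exp_op (t *\<^sub>R a0) (b0 k)) \<le> e * norm k"
      proof -
        have "norm (exp_op (t *\<^sub>R a0) (b0 k)) \<le> exp (norm (t *\<^sub>R a0)) * norm (b0 k)" by (rule exp_op_norm)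
        also have "\<dots> \<le> exp (T * norm a0) * (norm b0 * norm k)"
          using t by (intro mult_mono norm_blinfun) (auto intro: mult_right_mono)
        finally show ?thesis by (simp add: e_def mult.assoc)
      qed
      then have 1: "\<bar>exp_op (t *\<^sub>R a0) (b0 k) \<bullet> x\<bar> \<le> C1 * M * e * t powr (-1/2) * norm k * ?R"
        using t by (intro cost r0) auto
      show "\<bar>etAB0 d a0 b0 b1 t k \<bullet> x\<bar> \<le> C * t powr (-1/2) * norm k * ?R"
        using abs_triangle_ineq[of "exp_op (t *\<^sub>R a0) (b0 k) \<bullet> x" "drift d a0 t ?g \<bullet> x"] 1 2
        unfolding etA inner_add_left C_def distrib_right by linarith
    qed
  qed
qed

section \<open>Differentiability\<close>

text \<open>On the closed subspace \<open>range R\<close> the map is linear. Elsewhere the predicate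
  under \<open>THE\<close> has no solution, so \<open>THE\<close> returns one fixed value.\<close>

lemma pseudoinverse_measurable:
  fixes R :: "'n::euclidean_space \<Rightarrow> 'n"
  assumes R: "linear R" and sym: "\<And>x y. R x \<bullet> y = x \<bullet> R y"
  shows "pseudoinverse R \<in> borel_measurable borel"
proof -
  obtain g where g: "linear g" "\<And>v. v \<in> range R \<Longrightarrow> R (g v) = v"
    using linear_exists_right_inverse_on[OF R subspace_UNIV] by auto
  let ?P = "\<lambda>z. pseudoinverse R (R z)"
  have P: "linear ?P"
    by (intro linearI)
       (simp_all add: linear_add[OF R] linear_cmul[OF R] pseudoinverse_add[OF R sym rangeI rangeI] pseudoinverse_scaleR[OF R sym rangeI])
  have "linear (?P \<circ> g)" by (rule linear_compose[OF g(1) P])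
  then have [measurable]: "?P \<circ> g \<in> borel_measurable borel" by (rule borel_measurable_linear)
  have [measurable]: "range R \<in> sets borel"
    using linear_subspace_image[OF R subspace_UNIV] by (intro borel_closed closed_subspace)
  have "pseudoinverse R = (\<lambda>z. if z \<in> range R then (?P \<circ> g) z else (THE x. False))"
  proof
    fix z
    show "pseudoinverse R z = (if z \<in> range R then (?P \<circ> g) z else (THE x. False))"
    proof (cases "z \<in> range R")
      case True then show ?thesis by (simp add: g(2))
    next
      case False
      then have "(\<lambda>x. R x = z \<and> (\<forall>x'. R x' = z \<longrightarrow> norm x \<le> norm x')) = (\<lambda>x. False)" by auto
      then show ?thesis using False by (simp only: pseudoinverse_def if_False)
    qed
  qed
  also have "\<dots> \<in> borel_measurable borel" by measurable
  finally show ?thesis .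
qed

text \<open>Displacing the argument by s R w is the same as shifting \<xi> by s w. The Gaussian
  density of this shift differs from its linear part by at most |s w|^2 in L^1, and the bound
  \<open>K\<close> on \<phi> carries over.\<close>

lemma Cameron_Martin_remainder:
  fixes R :: "'n::euclidean_space \<Rightarrow> 'n"
  assumes R: "linear R" and [measurable]: "\<phi> \<in> borel_measurable borel" and K: "\<And>y. \<bar>\<phi> y\<bar> \<le> K"
    and w: "norm (s *\<^sub>R w) \<le> 1"
  shows "integrable std_gaussian (\<lambda>\<xi>. \<phi> (R \<xi> + m) * (w \<bullet> \<xi>))"
    "\<bar>LINT \<xi>|std_gaussian. \<phi> (R \<xi> + m) * (w \<bullet> \<xi>)\<bar> \<le> K * norm w"
    "\<bar>(LINT \<xi>|std_gaussian. \<phi> (R \<xi> + (m + s *\<^sub>R R w))) - (LINT \<xi>|std_gaussian. \<phi> (R \<xi> + m))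
       - s * (LINT \<xi>|std_gaussian. \<phi> (R \<xi> + m) * (w \<bullet> \<xi>))\<bar> \<le> K * (s\<^sup>2 * (norm w)\<^sup>2)"
proof -
  have K0: "0 \<le> K" using K[of 0] by linarith
  have [measurable]: "R \<in> borel_measurable borel" by (rule borel_measurable_linear[OF R])
  let ?F = "\<lambda>\<xi>. \<phi> (R \<xi> + m)"
  let ?X = "\<lambda>\<xi>. exp ((s *\<^sub>R w) \<bullet> \<xi> - (norm (s *\<^sub>R w))\<^sup>2 / 2) - 1 - (s *\<^sub>R w) \<bullet> \<xi>"
  have bound_int: "integrable std_gaussian (\<lambda>\<xi>. ?F \<xi> * G \<xi>)" "\<bar>LINT \<xi>|std_gaussian. ?F \<xi> * G \<xi>\<bar> \<le> K * (LINT \<xi>|std_gaussian. \<bar>G \<xi>\<bar>)"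
    if G: "integrable std_gaussian G" for G
  proof -
    have [measurable]: "G \<in> borel_measurable borel" using borel_measurable_integrable[OF G] by simp
    have le: "\<bar>?F \<xi> * G \<xi>\<bar> \<le> K * \<bar>G \<xi>\<bar>" for \<xi> unfolding abs_mult using K by (intro mult_right_mono) auto
    have KG: "integrable std_gaussian (\<lambda>\<xi>. K * \<bar>G \<xi>\<bar>)" using G by simp
    show int: "integrable std_gaussian (\<lambda>\<xi>. ?F \<xi> * G \<xi>)"
    proof (rule Bochner_Integration.integrable_bound[OF KG])
      show "AE \<xi> in std_gaussian. norm (?F \<xi> * G \<xi>) \<le> norm (K * \<bar>G \<xi>\<bar>)"
        using le K0 by (intro AE_I2) (auto intro: order_trans)
    qed measurable
    have "\<bar>LINT \<xi>|std_gaussian. ?F \<xi> * G \<xi>\<bar> \<le> (LINT \<xi>|std_gaussian. \<bar>?F \<xi> * G \<xi>\<bar>)" by (rule integral_abs_bound)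
    also have "\<dots> \<le> (LINT \<xi>|std_gaussian. K * \<bar>G \<xi>\<bar>)" by (intro integral_mono KG le integrable_abs int)
    finally show "\<bar>LINT \<xi>|std_gaussian. ?F \<xi> * G \<xi>\<bar> \<le> K * (LINT \<xi>|std_gaussian. \<bar>G \<xi>\<bar>)" by simp
  qed
  show 1: "integrable std_gaussian (\<lambda>\<xi>. ?F \<xi> * (w \<bullet> \<xi>))"
    by (rule bound_int(1)) (rule std_gaussian_abs_inner(1))
  show "\<bar>LINT \<xi>|std_gaussian. ?F \<xi> * (w \<bullet> \<xi>)\<bar> \<le> K * norm w"
    using bound_int(2)[OF std_gaussian_abs_inner(1)[of w]] mult_left_mono[OF std_gaussian_abs_inner(2)[of w] K0]
    by linarith
  have X: "integrable std_gaussian ?X"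
    using std_gaussian_exponential_remainder(1)[OF w] by (subst integrable_abs_iff[symmetric]) auto
  have FX: "integrable std_gaussian (\<lambda>\<xi>. ?F \<xi> * ?X \<xi>)" by (rule bound_int(1)[OF X])
  have F: "integrable std_gaussian ?F"
    using bound_int(1)[of "\<lambda>_. 1"] by simp
  have "(LINT \<xi>|std_gaussian. \<phi> (R \<xi> + (m + s *\<^sub>R R w))) = (LINT \<xi>|std_gaussian. ?F (\<xi> + s *\<^sub>R w))"
    by (simp add: linear_add[OF R] linear_cmul[OF R] algebra_simps)
  also have "\<dots> = (LINT \<xi>|std_gaussian. exp ((s *\<^sub>R w) \<bullet> \<xi> - (norm (s *\<^sub>R w))\<^sup>2 / 2) * ?F \<xi>)"
    by (rule std_gaussian_shift) measurable
  also have "\<dots> = (LINT \<xi>|std_gaussian. ?F \<xi> * ?X \<xi> + ?F \<xi> + s * (?F \<xi> * (w \<bullet> \<xi>)))"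
    by (intro Bochner_Integration.integral_cong) (auto simp: algebra_simps)
  also have "\<dots> = (LINT \<xi>|std_gaussian. ?F \<xi> * ?X \<xi>) + (LINT \<xi>|std_gaussian. ?F \<xi>) + s * (LINT \<xi>|std_gaussian. ?F \<xi> * (w \<bullet> \<xi>))"
    using FX F 1 by simp
  finally have "(LINT \<xi>|std_gaussian. \<phi> (R \<xi> + (m + s *\<^sub>R R w))) - (LINT \<xi>|std_gaussian. ?F \<xi>) - s * (LINT \<xi>|std_gaussian. ?F \<xi> * (w \<bullet> \<xi>))
      = (LINT \<xi>|std_gaussian. ?F \<xi> * ?X \<xi>)" by simp
  also have "\<bar>\<dots>\<bar> \<le> K * (LINT \<xi>|std_gaussian. \<bar>?X \<xi>\<bar>)" by (rule bound_int(2)[OF X])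
  also have "\<dots> \<le> K * (norm (s *\<^sub>R w))\<^sup>2" by (intro mult_left_mono std_gaussian_exponential_remainder(2) w K0)
  finally show "\<bar>(LINT \<xi>|std_gaussian. \<phi> (R \<xi> + (m + s *\<^sub>R R w))) - (LINT \<xi>|std_gaussian. ?F \<xi>)
       - s * (LINT \<xi>|std_gaussian. ?F \<xi> * (w \<bullet> \<xi>))\<bar> \<le> K * (s\<^sup>2 * (norm w)\<^sup>2)"
    by (simp add: power_mult_distrib)
qed

text \<open>The cost bound makes \<open>W\<close> a bounded linear choice of preimages for the
  displacements. The quadratic remainder then bounds the error of the difference quotient by K (c
  |k|)^2 |s|, which gives both the limit and its uniformity on bounded sets of k.\<close>

lemma OU_B_derivative:
  fixes a0 :: "'n::euclidean_space \<Rightarrow>\<^sub>L 'n" and \<sigma> :: "'q::euclidean_space \<Rightarrow>\<^sub>L 'n"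
    and b0 :: "'m::euclidean_space \<Rightarrow>\<^sub>L 'n" and b1 :: "real set \<Rightarrow> 'm \<Rightarrow>\<^sub>L 'n"
  assumes b1: "vector_measure {-d..0} b1" and t: "0 < t"
    and c: "0 \<le> c" and cost: "\<And>k x. \<bar>etAB0 d a0 b0 b1 t k \<bullet> x\<bar> \<le> c * norm k * norm (psd_sqrt (covar0 a0 \<sigma> t) x)"
    and \<phi> [measurable]: "\<phi> \<in> borel_measurable borel" and bdd: "bounded (range \<phi>)"
  defines "R \<equiv> psd_sqrt (covar0 a0 \<sigma> t)"
    and "W \<equiv> \<lambda>k. pseudoinverse (psd_sqrt (covar0 a0 \<sigma> t)) (etAB0 d a0 b0 b1 t k)"
  shows "range (etAB0 d a0 b0 b1 t) \<subseteq> range R"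
    and "bounded_linear W" and "norm (W k) \<le> c * norm k"
    and "B_Frechet_differentiable d a0 b0 b1 t (OU d a0 \<sigma> t (\<lambda>y. \<phi> (fst y))) x"
    and "integrable (gaussian UNIV (covar0 a0 \<sigma> t))
          (\<lambda>z. \<phi> (z + fst (delay_semigroup d a0 t x)) * (W k \<bullet> pseudoinverse R z))"
    and "B_gradient d a0 b0 b1 t (OU d a0 \<sigma> t (\<lambda>y. \<phi> (fst y))) x \<bullet> k =
          (LINT z|gaussian UNIV (covar0 a0 \<sigma> t). \<phi> (z + fst (delay_semigroup d a0 t x)) * (W k \<bullet> pseudoinverse R z))"
    and "\<bar>B_gradient d a0 b0 b1 t (OU d a0 \<sigma> t (\<lambda>y. \<phi> (fst y))) x \<bullet> k\<bar> \<le> (SUP y. \<bar>\<phi> y\<bar>) * norm (W k)"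
proof -
  note R = psd_sqrt_covar0[of a0 \<sigma> t, folded R_def]
  let ?F = "etAB0 d a0 b0 b1 t" and ?m = "fst (delay_semigroup d a0 t x)"
  let ?f = "OU d a0 \<sigma> t (\<lambda>y. \<phi> (fst y))"
  define K where "K = (SUP y. \<bar>\<phi> y\<bar>)"
  have "bdd_above (range (\<lambda>y. \<bar>\<phi> y\<bar>))"
    using bdd by (auto simp: bounded_iff bdd_above_def)
  then have K: "\<bar>\<phi> y\<bar> \<le> K" for y unfolding K_def by (intro cSUP_upper) auto
  have K0: "0 \<le> K" using K[of 0] by linarith
  have W_eq: "W k = pseudoinverse R (?F k)" for k by (simp add: W_def R_def)
  have dual: "?F k \<in> range R" "norm (pseudoinverse R (?F k)) \<le> c * norm k" for k
    using range_dual[OF R(1,2), where v="?F k" and c="c * norm k"] cost[of k] c by (simp_all add: R_def)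
  then show range: "?F ` UNIV \<subseteq> range R" by blast
  show normW: "norm (W k) \<le> c * norm k" for k using dual(2) by (simp add: W_eq)
  have linW: "linear W"
    by (intro linearI) (simp_all add: W_eq linear_add[OF linear_etAB0] linear_cmul[OF linear_etAB0]
        pseudoinverse_add[OF R(1,2) dual(1) dual(1)] pseudoinverse_scaleR[OF R(1,2) dual(1)])
  then show blW: "bounded_linear W" by (simp add: linear_conv_bounded_linear)
  have RW: "R (W k) = ?F k" and Wr: "W k \<in> range R" for k
    using dual(1)[of k] pseudoinverse_symmetric[OF R(1,2)] by (auto simp: W_eq)
  \<comment> \<open>At z = R \<xi> the product of the two pseudoinverses becomes the linear
    Cameron-Martin weight.\<close>
  have inner: "W k \<bullet> pseudoinverse R (R \<xi>) = W k \<bullet> \<xi>" for k \<xi>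
    by (rule pseudoinverse_symmetric(3)[OF R(1,2) Wr])
  have [measurable]: "R \<in> borel_measurable borel" by (rule borel_measurable_linear[OF R(1)])
  have [measurable]: "pseudoinverse R \<in> borel_measurable borel" by (rule pseudoinverse_measurable[OF R(1,2)])
  have G: "gaussian UNIV (covar0 a0 \<sigma> t) = distr std_gaussian borel R"
    unfolding R_def by (rule distr_psd_sqrt_gaussian[OF linear_covar0 covar0_symmetric covar0_psd])
  define g where "g v = (LINT \<xi>|std_gaussian. \<phi> (R \<xi> + v))" for v
  define L where "L k = (LINT \<xi>|std_gaussian. \<phi> (R \<xi> + ?m) * (W k \<bullet> \<xi>))" for k
  \<comment> \<open>The first two conclusions do not involve s, and s = 0 satisfies the norm
    condition for every k.\<close>
  have CM: "integrable std_gaussian (\<lambda>\<xi>. \<phi> (R \<xi> + ?m) * (W k \<bullet> \<xi>))" "\<bar>L k\<bar> \<le> K * norm (W k)" for k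
    using Cameron_Martin_remainder(1,2)[OF R(1) \<phi> K, of 0 "W k" ?m] by (simp_all add: L_def)
  have rem: "\<bar>g (?m + s *\<^sub>R ?F k) - g ?m - s * L k\<bar> \<le> K * (s\<^sup>2 * (norm (W k))\<^sup>2)" if "norm (s *\<^sub>R W k) \<le> 1" for s k
    using Cameron_Martin_remainder(3)[OF R(1) \<phi> K that, of ?m] by (simp add: L_def g_def RW)
  have f: "?f y = g (fst (delay_semigroup d a0 t y))" for y
    unfolding OU_eq[OF \<phi>] G g_def by (subst integral_distr) auto
  have quot: "(B_shift d a0 b0 b1 t ?f x s k - ?f x) / s = (g (?m + s *\<^sub>R ?F k) - g ?m) / s" for s k
    by (simp add: B_shift_eq[where f="?f" and g=g, OF b1 t f] f[of x])
  have near: "\<bar>(g (?m + s *\<^sub>R ?F k) - g ?m) / s - L k\<bar> \<le> K * (c * norm k)\<^sup>2 * \<bar>s\<bar>"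
    if "s \<noteq> 0" "\<bar>s\<bar> * (c * norm k) \<le> 1" for s k
  proof -
    have "norm (s *\<^sub>R W k) \<le> 1"
      using that(2) mult_left_mono[OF normW[of k] abs_ge_zero[of s]] by simp
    have "(g (?m + s *\<^sub>R ?F k) - g ?m) / s - L k = (g (?m + s *\<^sub>R ?F k) - g ?m - s * L k) / s"
      using that(1) by (simp add: diff_divide_distrib)
    then have "\<bar>(g (?m + s *\<^sub>R ?F k) - g ?m) / s - L k\<bar> = \<bar>g (?m + s *\<^sub>R ?F k) - g ?m - s * L k\<bar> / \<bar>s\<bar>"
      by (simp only: abs_divide)
    also have "\<dots> \<le> K * (s\<^sup>2 * (norm (W k))\<^sup>2) / \<bar>s\<bar>"
      by (intro divide_right_mono rem abs_ge_zero) fact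
    also have "\<dots> = K * (norm (W k))\<^sup>2 * \<bar>s\<bar>"
      using that(1) by (cases "0 \<le> s") (simp_all add: power2_eq_square)
    also have "\<dots> \<le> K * (c * norm k)\<^sup>2 * \<bar>s\<bar>"
      using K0 normW[of k] by (intro mult_right_mono mult_left_mono power_mono) auto
    finally show ?thesis .
  qed
  have linL: "linear L"
  proof (rule linearI)
    show "L (k + k') = L k + L k'" for k k'
      unfolding L_def linear_add[OF linW] inner_add_left distrib_left
      by (intro Bochner_Integration.integral_add CM)
    show "L (a *\<^sub>R k) = a *\<^sub>R L k" for a k
      by (simp add: L_def linear_cmul[OF linW] mult.left_commute)
  qed
  \<comment> \<open>Radius |k| gives the limit in a single direction, radius 1 the uniform limit of
    the Frechet property.\<close>
  have unif: "\<forall>\<^sub>F s in at 0. \<forall>k\<in>cball 0 r. \<bar>(g (?m + s *\<^sub>R ?F k) - g ?m) / s - L k\<bar> < \<epsilon>"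
    if r: "0 \<le> r" and \<epsilon>: "0 < \<epsilon>" for r \<epsilon>
  proof -
    define X where "X = K * (c * r)\<^sup>2"
    have X0: "0 \<le> X" using K0 by (simp add: X_def)
    have cr: "0 \<le> c * r" using c r by simp
    \<comment> \<open>The first bound on |s| keeps the shift small enough for the remainder
      estimate, the second makes the error smaller than \<epsilon>; the added ones keep the
      denominators positive.\<close>
    show ?thesis
      unfolding eventually_at
    proof (intro exI[of _ "min (1 / (c * r + 1)) (\<epsilon> / (X + 1))"] conjI ballI impI)
      show "0 < min (1 / (c * r + 1)) (\<epsilon> / (X + 1))" using X0 cr \<epsilon> by simp
      fix s :: real and k assume s: "s \<noteq> 0 \<and> dist s 0 < min (1 / (c * r + 1)) (\<epsilon> / (X + 1))" and k: "k \<in> cball (0 :: 'm) r"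
      have k': "c * norm k \<le> c * r" using k c by (intro mult_left_mono) auto
      have s1: "\<bar>s\<bar> * (c * r + 1) < 1" and s2: "\<bar>s\<bar> * (X + 1) < \<epsilon>"
        using s X0 cr by (simp_all add: pos_less_divide_eq)
      have "\<bar>s\<bar> * (c * norm k) \<le> \<bar>s\<bar> * (c * r + 1)" using k' by (intro mult_left_mono) auto
      then have "\<bar>s\<bar> * (c * norm k) \<le> 1" using s1 by linarith
      with s have "\<bar>(g (?m + s *\<^sub>R ?F k) - g ?m) / s - L k\<bar> \<le> K * (c * norm k)\<^sup>2 * \<bar>s\<bar>"
        by (intro near) auto
      also have "\<dots> \<le> X * \<bar>s\<bar>"
        unfolding X_def using power_mono[OF k', of 2] c K0 by (intro mult_right_mono mult_left_mono) simp_all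
      also have "\<dots> \<le> \<bar>s\<bar> * (X + 1)" by (simp add: algebra_simps)
      also have "\<dots> < \<epsilon>" by (rule s2)
      finally show "\<bar>(g (?m + s *\<^sub>R ?F k) - g ?m) / s - L k\<bar> < \<epsilon>" .
    qed
  qed
  have lim: "((\<lambda>s. (B_shift d a0 b0 b1 t ?f x s k - ?f x) / s) \<longlongrightarrow> L k) (at 0)" for k
    unfolding quot
  proof (rule tendstoI)
    fix \<epsilon> :: real assume "0 < \<epsilon>"
    from unif[OF norm_ge_zero[of k] this]
    show "\<forall>\<^sub>F s in at 0. dist ((g (?m + s *\<^sub>R ?F k) - g ?m) / s) (L k) < \<epsilon>"
      by (rule eventually_mono) (auto simp: dist_real_def)
  qed
  have "uniform_limit (cball 0 1) (\<lambda>s k. (B_shift d a0 b0 b1 t ?f x s k - ?f x) / s) L (at 0)"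
    unfolding quot by (rule uniform_limitI) (use unif[of 1] in \<open>simp add: dist_real_def\<close>)
  with lim linL show "B_Frechet_differentiable d a0 b0 b1 t ?f x"
    unfolding B_Frechet_differentiable_def by (auto simp: linear_conv_bounded_linear)
  \<comment> \<open>The Riesz vector of the functional \<open>L\<close>; uniqueness of limits makes
    it the only candidate for \<open>B_gradient\<close>.\<close>
  let ?v = "\<Sum>j\<in>Basis. L j *\<^sub>R j"
  have vL: "?v \<bullet> k = L k" for k
  proof -
    have "?v \<bullet> k = (\<Sum>j\<in>Basis. (k \<bullet> j) *\<^sub>R L j)"
      by (simp add: inner_sum_left inner_commute[of k] mult.commute)
    also have "\<dots> = L (\<Sum>j\<in>Basis. (k \<bullet> j) *\<^sub>R j)" by (simp only: linear_sum[OF linL] linear_cmul[OF linL])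
    finally show ?thesis by (simp only: euclidean_representation)
  qed
  have "B_gradient d a0 b0 b1 t ?f x = ?v"
    unfolding B_gradient_def
  proof (rule the_equality)
    show v: "\<forall>k. ((\<lambda>s. (B_shift d a0 b0 b1 t ?f x s k - ?f x) / s) \<longlongrightarrow> ?v \<bullet> k) (at 0)"
      using lim vL by simp
    fix u assume "\<forall>k. ((\<lambda>s. (B_shift d a0 b0 b1 t ?f x s k - ?f x) / s) \<longlongrightarrow> u \<bullet> k) (at 0)"
    then have "u \<bullet> k = ?v \<bullet> k" for k unfolding vL using tendsto_unique[OF at_neq_bot _ lim] by blast
    then show "u = ?v" by (blast intro: euclidean_eqI)
  qed
  then have grad: "B_gradient d a0 b0 b1 t ?f x \<bullet> k = L k" by (simp only: vL)
  show "integrable (gaussian UNIV (covar0 a0 \<sigma> t)) (\<lambda>z. \<phi> (z + ?m) * (W k \<bullet> pseudoinverse R z))"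
    unfolding G using CM(1)[of k] by (subst integrable_distr_eq) (auto simp: inner)
  show "B_gradient d a0 b0 b1 t ?f x \<bullet> k = (LINT z|gaussian UNIV (covar0 a0 \<sigma> t). \<phi> (z + ?m) * (W k \<bullet> pseudoinverse R z))"
    unfolding grad G L_def by (subst integral_distr) (auto simp: inner)
  show "\<bar>B_gradient d a0 b0 b1 t ?f x \<bullet> k\<bar> \<le> (SUP y. \<bar>\<phi> y\<bar>) * norm (W k)"
    unfolding grad using CM(2)[of k] by (simp add: K_def)
qed

theorem proposition4p11:
  fixes a0 :: "'n::euclidean_space \<Rightarrow>\<^sub>L 'n"
    and \<sigma> :: "'q::euclidean_space \<Rightarrow>\<^sub>L 'n"
    and b0 :: "'m::euclidean_space \<Rightarrow>\<^sub>L 'n"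
    and b1 :: "real set \<Rightarrow> 'm \<Rightarrow>\<^sub>L 'n"
    and d :: real
  assumes "0 < d"
    and "vector_measure {-d..0} b1"
    and "((\<forall>t>0. range (\<lambda>k. exp_op (t *\<^sub>R a0) (b0 k)) \<subseteq> range \<sigma>) \<and>
          (\<exists>\<beta>. has_L2_operator_density d b1 \<beta> \<and>
               (AE s in lborel. s \<in> {-d..0} \<longrightarrow> range (\<beta> s) \<subseteq> range \<sigma>)))
       \<or> (\<forall>t>0. range (etAB0 d a0 b0 b1 t) \<subseteq> range \<sigma>)"
  shows "(\<forall>\<phi> \<in> borel_measurable borel. bounded (range \<phi>) \<longrightarrow> (\<forall>t>0.
           (\<forall>x\<in>state_space d.
              B_Frechet_differentiable d a0 b0 b1 t (OU d a0 \<sigma> t (\<lambda>y. \<phi> (fst y))) x) \<and>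
           range (etAB0 d a0 b0 b1 t) \<subseteq> range (psd_sqrt (covar0 a0 \<sigma> t)) \<and>
           (\<forall>x\<in>state_space d. \<forall>k.
              integrable (gaussian UNIV (covar0 a0 \<sigma> t))
                (\<lambda>z. \<phi> (z + fst (delay_semigroup d a0 t x)) *
                     (pseudoinverse (psd_sqrt (covar0 a0 \<sigma> t)) (etAB0 d a0 b0 b1 t k)
                        \<bullet> pseudoinverse (psd_sqrt (covar0 a0 \<sigma> t)) z)) \<and>
              B_gradient d a0 b0 b1 t (OU d a0 \<sigma> t (\<lambda>y. \<phi> (fst y))) x \<bullet> k =
                (LINT z|gaussian UNIV (covar0 a0 \<sigma> t).
                   \<phi> (z + fst (delay_semigroup d a0 t x)) *
                   (pseudoinverse (psd_sqrt (covar0 a0 \<sigma> t)) (etAB0 d a0 b0 b1 t k)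
                      \<bullet> pseudoinverse (psd_sqrt (covar0 a0 \<sigma> t)) z)) \<and>
              \<bar>B_gradient d a0 b0 b1 t (OU d a0 \<sigma> t (\<lambda>y. \<phi> (fst y))) x \<bullet> k\<bar>
                \<le> (SUP y. \<bar>\<phi> y\<bar>) *
                  onorm (\<lambda>k. pseudoinverse (psd_sqrt (covar0 a0 \<sigma> t)) (etAB0 d a0 b0 b1 t k)) * norm k)))
       \<and> (\<forall>T>0. \<exists>C. \<forall>t\<in>{0<..T}. \<forall>\<phi> \<in> borel_measurable borel. bounded (range \<phi>) \<longrightarrow>
            (\<forall>x\<in>state_space d. \<forall>k.
               \<bar>B_gradient d a0 b0 b1 t (OU d a0 \<sigma> t (\<lambda>y. \<phi> (fst y))) x \<bullet> k\<bar>
                 \<le> C * t powr (-1/2) * (SUP y. \<bar>\<phi> y\<bar>) * norm k))"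
proof -
  let ?S = "\<lambda>\<phi> :: 'n \<Rightarrow> real. SUP y. \<bar>\<phi> y\<bar>"
  let ?bound = "\<lambda>t c. \<forall>k x. \<bar>etAB0 d a0 b0 b1 t k \<bullet> x\<bar> \<le> c * norm k * norm (psd_sqrt (covar0 a0 \<sigma> t) x)"
  have cost: "\<exists>C\<ge>0. \<forall>t\<in>{0<..T}. ?bound t (C * t powr (-1/2))" if "0 < T" for T
    by (rule etAB0_cost[OF assms(2,3) that]) blast
  \<comment> \<open>For a single time the bound with T = t suffices; a constant common to all t in
    (0,T] is kept for the last claim.\<close>
  have cost_at: "\<exists>c\<ge>0. ?bound t c" if t: "0 < t" for t
  proof -
    from cost[OF t] obtain C where "0 \<le> C" "?bound t (C * t powr (-1/2))" using t by auto
    then show ?thesis by (intro exI[of _ "C * t powr (-1/2)"]) simp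
  qed
  have sup_nonneg: "0 \<le> ?S \<phi>" if "bounded (range \<phi>)" for \<phi>
    using that by (intro cSUP_upper2[where x=0]) (auto simp: bounded_iff bdd_above_def)
  show ?thesis
  proof (intro conjI ballI impI allI, goal_cases)
    case (1 \<phi> t x)
    from cost_at[OF 1(3)] obtain c where c: "0 \<le> c" "?bound t c" by blast
    from OU_B_derivative(4)[OF assms(2) 1(3) c(1) c(2)[rule_format] 1(1,2)] show ?case .
  next
    case (2 \<phi> t)
    from cost_at[OF 2(3)] obtain c where c: "0 \<le> c" "?bound t c" by blast
    from OU_B_derivative(1)[OF assms(2) 2(3) c(1) c(2)[rule_format] 2(1,2)] show ?case .
  next
    case (3 \<phi> t x k)
    from cost_at[OF 3(3)] obtain c where c: "0 \<le> c" "?bound t c" by blast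
    from OU_B_derivative(5)[OF assms(2) 3(3) c(1) c(2)[rule_format] 3(1,2)] show ?case .
  next
    case (4 \<phi> t x k)
    from cost_at[OF 4(3)] obtain c where c: "0 \<le> c" "?bound t c" by blast
    from OU_B_derivative(6)[OF assms(2) 4(3) c(1) c(2)[rule_format] 4(1,2)] show ?case .
  next
    case (5 \<phi> t x k)
    from cost_at[OF 5(3)] obtain c where c: "0 \<le> c" "?bound t c" by blast
    note D = OU_B_derivative[OF assms(2) 5(3) c(1) c(2)[rule_format] 5(1,2)]
    have "?S \<phi> * norm (pseudoinverse (psd_sqrt (covar0 a0 \<sigma> t)) (etAB0 d a0 b0 b1 t k))
        \<le> ?S \<phi> * (onorm (\<lambda>k. pseudoinverse (psd_sqrt (covar0 a0 \<sigma> t)) (etAB0 d a0 b0 b1 t k)) * norm k)"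
      by (intro mult_left_mono onorm D(2) sup_nonneg 5)
    with D(7)[of x k] show ?case by (simp add: mult.assoc)
  next
    case (6 T)
    from cost[OF this] obtain C where C: "0 \<le> C" "\<And>t. t \<in> {0<..T} \<Longrightarrow> ?bound t (C * t powr (-1/2))" by blast
    show ?case
    proof (intro exI[of _ C] ballI impI allI)
      fix t and \<phi> :: "'n \<Rightarrow> real" and x k
      assume t: "t \<in> {0<..T}" and \<phi>: "\<phi> \<in> borel_measurable borel" "bounded (range \<phi>)"
      have "0 < t" "0 \<le> C * t powr (-1/2)" using t C(1) by auto
      note D = OU_B_derivative[OF assms(2) this C(2)[OF t, rule_format] \<phi>]
      have "?S \<phi> * norm (pseudoinverse (psd_sqrt (covar0 a0 \<sigma> t)) (etAB0 d a0 b0 b1 t k))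
          \<le> ?S \<phi> * (C * t powr (-1/2) * norm k)"
        by (intro mult_left_mono D(3) sup_nonneg \<phi>)
      with D(7)[of x k]
      show "\<bar>B_gradient d a0 b0 b1 t (OU d a0 \<sigma> t (\<lambda>y. \<phi> (fst y))) x \<bullet> k\<bar> \<le> C * t powr (-1/2) * ?S \<phi> * norm k"
        by (simp add: mult_ac)
    qed
  qed
qed

end
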